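(* Let $u\in W^{1,r}(\mathbb{T})$ for some $1<r\le d$. Then, for any $q\in[r,\,r\frac{d-1}{d-r})$ there exist a positive constant $C=C(r,d,q)$, a negligible set $N$ and nonnegative functions $a\in L^1(\mathbb{T})$ and $b\in L^q(\mathbb{T})$ satisfying $$\|a\|_{L^1}\le C\|Du\|_{L^r}\quad\text{and}\quad\|b\|_{L^q}\le C\|Du\|_{L^r},$$ together with $$|u(x)-u(y)|\le|x-y|\,(a(x)+b(y))\qquad\text{for any }x,y\in\mathbb{R}^d\setminus N.$$ Moreover, we can take $N=\emptyset$ provided we choose a suitable representative of $u$, $a$ and $b$, and the latter can be selected so that the respective map $W^{1,r}(\mathbb{T})\ni u\mapsto(a,b)\in L^1(\mathbb{T})\times L^q(\mathbb{T})$ is continuous.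
   Context: $\mathbb{T}=\mathbb{T}^d=\mathbb{R}^d/\mathbb{Z}^d$ is the $d$-dimensional torus. Functions on $\mathbb{T}$ are identified with $\mathbb{Z}^d$-periodic functions on $\mathbb{R}^d$, and $N$ with a periodic set; negligible means of zero Lebesgue measure. For $r=d$ the quantity $r\frac{d-1}{d-r}$ is interpreted as $+\infty$. The functions $a,b$ may take the value $+\infty$, in which case the inequality is regarded as trivially satisfied where its right-hand side is $+\infty$. *)

theory Defs
  imports "HOL-Analysis.Analysis"
begin

text \<open>Functions on the torus are \<open>\<int>\<^sup>d\<close>-periodic functions on \<open>\<real>\<^sup>d\<close>, with \<open>d = CARD('n)\<close>.\<close>

definition periodic :: "(real^'n \<Rightarrow> 'b) \<Rightarrow> bool" where
  "periodic f \<longleftrightarrow> (\<forall>x k. (\<forall>i. k $ i \<in> \<int>) \<longrightarrow> f (x + k) = f x)"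

text \<open>A fundamental domain up to a null set.\<close>

abbreviation unit_cube :: "(real^'n) set" where
  "unit_cube \<equiv> cbox 0 1"

text \<open>Powers \<open>t\<^sup>p\<close> with \<open>p > 0\<close> for \<open>t \<in> [0,\<infinity>]\<close>.\<close>

definition enn_powr :: "ennreal \<Rightarrow> real \<Rightarrow> ennreal" where
  "enn_powr t p = (if t = \<infinity> then \<infinity> else ennreal (enn2real t powr p))"

definition Lp_norm :: "real \<Rightarrow> (real^'n \<Rightarrow> ennreal) \<Rightarrow> ennreal" where
  "Lp_norm p f = enn_powr (\<integral>\<^sup>+x\<in>unit_cube. enn_powr (f x) p \<partial>lebesgue) (1 / p)"

abbreviation abs_Lp_norm :: "real \<Rightarrow> (real^'n \<Rightarrow> 'b::real_normed_vector) \<Rightarrow> ennreal" where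
  "abs_Lp_norm p f \<equiv> Lp_norm p (\<lambda>x. ennreal (norm (f x)))"

definition Lp :: "real \<Rightarrow> (real^'n \<Rightarrow> 'b::euclidean_space) set" where
  "Lp p = {f. periodic f \<and> f \<in> borel_measurable lebesgue \<and> abs_Lp_norm p f < \<infinity>}"

text \<open>The nonnegative elements of \<open>L\<^sup>p\<close>, as functions that may take the value \<open>\<infinity>\<close>
  (necessarily only on a null set).\<close>

definition Lp_nonneg :: "real \<Rightarrow> (real^'n \<Rightarrow> ennreal) set" where
  "Lp_nonneg p = {f. periodic f \<and> f \<in> borel_measurable lebesgue \<and> Lp_norm p f < \<infinity>}"

text \<open>The \<open>L\<^sup>p\<close> distance on \<open>Lp_nonneg p\<close>. Its elements are finite almost everywhere,
  so the value of \<open>enn2real\<close> at \<open>\<infinity>\<close> is irrelevant.\<close>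

definition Lp_dist :: "real \<Rightarrow> (real^'n \<Rightarrow> ennreal) \<Rightarrow> (real^'n \<Rightarrow> ennreal) \<Rightarrow> ennreal" where
  "Lp_dist p f g = abs_Lp_norm p (\<lambda>x. enn2real (f x) - enn2real (g x))"

definition partial_deriv :: "'n \<Rightarrow> (real^'n \<Rightarrow> real) \<Rightarrow> real^'n \<Rightarrow> real" where
  "partial_deriv i f x = frechet_derivative f (at x) (axis i 1)"

fun Ck :: "nat \<Rightarrow> (real^'n \<Rightarrow> real) \<Rightarrow> bool" where
  "Ck 0 f \<longleftrightarrow> continuous_on UNIV f"
| "Ck (Suc k) f \<longleftrightarrow> f differentiable_on UNIV \<and> (\<forall>i. Ck k (partial_deriv i f))"

definition smooth :: "(real^'n \<Rightarrow> real) \<Rightarrow> bool" where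
  "smooth f \<longleftrightarrow> (\<forall>k. Ck k f)"

text \<open>Weak gradients on the torus: the test functions are the smooth periodic functions, and
  no boundary terms occur.\<close>

definition has_weak_gradient :: "(real^'n \<Rightarrow> real) \<Rightarrow> (real^'n \<Rightarrow> real^'n) \<Rightarrow> bool" where
  "has_weak_gradient u g \<longleftrightarrow> u \<in> Lp 1 \<and> g \<in> Lp 1 \<and>
     (\<forall>\<phi> i. periodic \<phi> \<and> smooth \<phi> \<longrightarrow>
        (LINT x:unit_cube|lebesgue. u x * partial_deriv i \<phi> x) =
        - (LINT x:unit_cube|lebesgue. g x $ i * \<phi> x))"

text \<open>Weak gradients are unique only almost everywhere; all uses of \<open>weak_gradient\<close> below are
  inside \<open>L\<^sup>r\<close> norms, which do not depend on the choice.\<close>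

definition weak_gradient :: "(real^'n \<Rightarrow> real) \<Rightarrow> real^'n \<Rightarrow> real^'n" where
  "weak_gradient u = (SOME g. has_weak_gradient u g)"

definition W1 :: "real \<Rightarrow> (real^'n \<Rightarrow> real) set" where
  "W1 r = {u. u \<in> Lp r \<and> (\<exists>g \<in> Lp r. has_weak_gradient u g)}"

definition W1_norm :: "real \<Rightarrow> (real^'n \<Rightarrow> real) \<Rightarrow> ennreal" where
  "W1_norm r u = abs_Lp_norm r u + abs_Lp_norm r (weak_gradient u)"

text \<open>Continuity of \<open>u \<mapsto> (A u, B u)\<close> from \<open>W1 r\<close> to \<open>L\<^sup>1 \<times> L\<^sup>q\<close>, expressed on representatives.
  Taking \<open>v = u\<close> almost everywhere shows that such a map descends to equivalence classes.\<close>

definition continuous_pair ::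
  "real \<Rightarrow> real \<Rightarrow> ((real^'n \<Rightarrow> real) \<Rightarrow> real^'n \<Rightarrow> ennreal) \<Rightarrow>
   ((real^'n \<Rightarrow> real) \<Rightarrow> real^'n \<Rightarrow> ennreal) \<Rightarrow> bool" where
  "continuous_pair r q A B \<longleftrightarrow>
     (\<forall>u \<in> W1 r. \<forall>\<epsilon>>0. \<exists>\<delta>>0. \<forall>v \<in> W1 r. W1_norm r (\<lambda>x. v x - u x) < \<delta> \<longrightarrow>
        Lp_dist 1 (A v) (A u) < \<epsilon> \<and> Lp_dist q (B v) (B u) < \<epsilon>)"

end

theory Submission
  imports Defs
begin

text \<open>Let \<open>H = C M|Du|\<close> be the maximal function of the gradient, so that
  \<open>|u(x) - u(y)| \<le> |x - y| (H(x) + H(y))\<close> almost everywhere, and let \<open>\<mu>\<close> be the norm of \<open>Du\<close> in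
  \<open>L\<^sup>r\<close>. Put \<open>b = C \<mu>\<^sup>\<gamma> H\<^bsup>1 - \<gamma>\<^esup>\<close>, which lies in \<open>L\<^bsup>r / (1 - \<gamma>)\<^esup>\<close>. Where \<open>H(y)\<close> exceeds \<open>b(y)\<close>, the point
  \<open>y\<close> is joined to \<open>x\<close> by a chain of points \<open>z\<^sub>j\<close> at distance at most \<open>2\<^sup>-\<^sup>j |x - y|\<close> from \<open>y\<close>, chosen so that
  \<open>H(z\<^sub>j)\<^bsup>1 + \<kappa>\<^esup>\<close> is at most its average over the ball, hence at most \<open>C 2\<^bsup>j d\<^esup> M(H\<^bsup>1 + \<kappa>\<^esup>)(x)\<close>. Either
  \<open>H(z\<^sub>j) \<le> \<mu> 2\<^bsup>j / \<gamma>\<^esup>\<close>, which sums to \<open>b(y)\<close>, or the excess power \<open>\<kappa>\<close> gives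
  \<open>2\<^sup>-\<^sup>j H(z\<^sub>j) \<le> C \<mu>\<^bsup>-\<kappa>\<^esup> 2\<^bsup>-j (\<kappa> / \<gamma> - (d - 1))\<^esup> M(H\<^bsup>1 + \<kappa>\<^esup>)(x)\<close>, which sums if \<open>\<gamma> (d - 1) < \<kappa>\<close>. So
  \<open>a = 2 H + C \<mu>\<^bsup>-\<kappa>\<^esup> M(H\<^bsup>1 + \<kappa>\<^esup>)\<close> works; it is integrable if \<open>1 + \<kappa> < r\<close>. Both conditions on \<open>\<kappa>\<close> can
  be met for some \<open>\<gamma> > 1 - r / q\<close> exactly when \<open>q < r (d - 1) / (d - r)\<close>. The maps \<open>u \<mapsto> a\<close> and \<open>u \<mapsto> b\<close>
  are continuous because \<open>M\<close> is sublinear and powers act continuously between Lebesgue spaces.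
  Setting \<open>a = b = \<infinity>\<close> on the exceptional null set makes the inequality hold everywhere without
  changing \<open>u\<close>.\<close>

subsection \<open>Lattice translates and periodic integrals\<close>

text \<open>The values H(z_j) are charged to \<open>x\<close> because every ball used about
  \<open>y\<close> lies in the ball of radius 2|x - y| about \<open>x\<close>. This comparison loses
  2^(j d), the length of the j-th link returns 2^-j, and so d - 1 enters the condition on \<gamma>.
  The bound 1 + \<kappa> < r keeps the exponent r / (1 + \<kappa>) above 1, where the maximal
  function is bounded. The powers of \<mu> make \<open>a\<close> and \<open>b\<close> homogeneous of
  degree one in \<open>u\<close>, hence the linear norm bounds; they also make \<open>a\<close>
  formally singular at \<mu> = 0, which is the delicate point of continuity.

  The points z_j must avoid the null set on which the symmetric inequality may fail, so they are
  picked inside a set of full measure. Replacing \<open>y\<close> by its lattice translate nearest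
  to \<open>x\<close> keeps all distances bounded; a maximal function with bounded radii then
  suffices, and periodicity reduces its estimates to the cube. Sobolev functions are approximated by
  convolution with powers of one trigonometric polynomial: these are periodic test functions, and
  the convolution is a finite sum of products, so it can be differentiated term by term.\<close>

definition lattice :: "(real^'n) set" where
  "lattice = {k. \<forall>i. k $ i \<in> \<int>}"

text \<open>Half-open, so that every point has exactly one lattice translate in it; for
  \<open>unit_cube\<close> this holds only up to a null set.\<close>

definition cell :: "(real^'n) set" where
  "cell = {x. \<forall>i. 0 \<le> x $ i \<and> x $ i < 1}"

lemma lattice_eq_range: "lattice = range (\<lambda>g::'n::finite \<Rightarrow> int. \<chi> i. real_of_int (g i))"
proof -
  have "x \<in> range (\<lambda>g::'n \<Rightarrow> int. \<chi> i. real_of_int (g i))" if "x \<in> lattice" for x :: "real^'n"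
  proof (rule image_eqI)
    show "x = (\<chi> i. real_of_int \<lfloor>x $ i\<rfloor>)"
      using that by (auto simp: lattice_def vec_eq_iff elim!: Ints_cases)
  qed simp
  then show ?thesis by (auto simp: lattice_def)
qed

lemma countable_lattice: "countable (lattice :: (real^'n::finite) set)"
  unfolding lattice_eq_range by simp

lemma lattice_add: "x \<in> lattice \<Longrightarrow> y \<in> lattice \<Longrightarrow> x + y \<in> lattice"
  and lattice_diff: "x \<in> lattice \<Longrightarrow> y \<in> lattice \<Longrightarrow> x - y \<in> lattice"
  and lattice_uminus: "x \<in> lattice \<Longrightarrow> - x \<in> lattice"
  by (auto simp: lattice_def)

lemma periodic_add: "periodic f \<Longrightarrow> k \<in> lattice \<Longrightarrow> f (x + k) = f x"
  by (auto simp: periodic_def lattice_def)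

lemma periodic_diff: "periodic f \<Longrightarrow> k \<in> lattice \<Longrightarrow> f (x - k) = f x"
  using periodic_add[of f "- k" x] lattice_uminus[of k] by simp

lemma finite_lattice_bounded: "finite {k \<in> lattice. \<forall>i::'n::finite. \<bar>k $ i\<bar> \<le> real m}"
proof -
  let ?F = "PiE UNIV (\<lambda>_::'n. {- int m .. int m})"
  have "{k \<in> lattice. \<forall>i::'n. \<bar>k $ i\<bar> \<le> real m} \<subseteq> (\<lambda>g. \<chi> i. real_of_int (g i)) ` ?F"
  proof (safe)
    fix k :: "real^'n" assume "k \<in> lattice" and b: "\<forall>i. \<bar>k $ i\<bar> \<le> real m"
    then obtain g where g: "k = (\<chi> i. real_of_int (g i))" unfolding lattice_eq_range by auto
    have "g i \<in> {- int m .. int m}" for i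
      using b[rule_format, of i] unfolding g by simp linarith
    then show "k \<in> (\<lambda>g. \<chi> i. real_of_int (g i)) ` ?F" using g by auto
  qed
  moreover have "finite ?F" by (intro finite_PiE) auto
  ultimately show ?thesis using finite_subset by blast
qed

lemma cell_borel [measurable]: "(cell :: (real^'n::finite) set) \<in> sets borel"
proof -
  have "(cell :: (real^'n) set) = (\<Inter>i\<in>UNIV. {x. 0 \<le> x $ i} \<inter> {x. x $ i < 1})"
    by (auto simp: cell_def)
  also have "\<dots> \<in> sets borel"
    by (intro sets.finite_INT) auto
  finally show ?thesis .
qed

lemma cell_lebesgue [measurable]: "(cell :: (real^'n::finite) set) \<in> sets lebesgue"
  by (simp add: cell_borel)

definition cell_shift :: "real^'n \<Rightarrow> real^'n" where
  "cell_shift x = (\<chi> i. - real_of_int \<lfloor>x $ i\<rfloor>)"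

lemma cell_shift_lattice: "cell_shift x \<in> lattice"
  by (simp add: cell_shift_def lattice_def)

lemma cell_shift_cell: "x + cell_shift x \<in> cell"
  by (auto simp: cell_shift_def cell_def) linarith+

lemma cell_shift_unique:
  assumes k: "k \<in> lattice" "x + k \<in> cell" shows "k = cell_shift x"
proof -
  have "k $ i = - real_of_int \<lfloor>x $ i\<rfloor>" for i
  proof -
    have "k $ i \<in> \<int>" using k(1) by (simp add: lattice_def)
    then obtain m where m: "k $ i = real_of_int m" by (rule Ints_cases)
    have "0 \<le> x $ i + k $ i" "x $ i + k $ i < 1" using k(2) by (auto simp: cell_def)
    then have "\<lfloor>x $ i\<rfloor> = - m" unfolding m by linarith
    then show ?thesis using m by simp
  qed
  then show ?thesis by (simp add: cell_shift_def vec_eq_iff)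
qed

text \<open>Exactly one summand is nonzero. Writing the sum as an integral over
  \<open>count_space lattice\<close> allows it to be interchanged with Lebesgue integrals.\<close>

lemma sum_cell: "(\<integral>\<^sup>+k. indicator cell (x + k) \<partial>count_space lattice) = 1" for x :: "real^'n::finite"
proof -
  have "indicator cell (x + k) = (indicator {cell_shift x} k :: ennreal)" if "k \<in> lattice" for k
  proof -
    have "x + k \<in> cell \<longleftrightarrow> k \<in> {cell_shift x}"
      using cell_shift_unique[OF that, of x] cell_shift_cell[of x] by blast
    then show ?thesis by (simp only: indicator_def)
  qed
  then have "(\<integral>\<^sup>+k. indicator cell (x + k) \<partial>count_space lattice) = (\<integral>\<^sup>+k'. indicator {cell_shift x} k' \<partial>count_space lattice)"
    by (intro nn_integral_cong) auto
  also have "\<dots> = 1" using cell_shift_lattice by (subst nn_integral_indicator) (auto simp: emeasure_count_space)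
  finally show ?thesis .
qed

lemma sum_cell_diff: "(\<integral>\<^sup>+k. indicator cell (x - k) \<partial>count_space lattice) = 1" for x :: "real^'n::finite"
proof -
  have "bij_betw uminus (lattice :: (real^'n) set) lattice"
    by (rule bij_betwI[where g=uminus]) (auto intro: lattice_uminus)
  from nn_integral_bij_count_space[OF this, of "\<lambda>k. indicator cell (x + k)"]
  show ?thesis using sum_cell[of x] by simp
qed

lemma lebesgue_translation_measurable [measurable]: "(\<lambda>x. t + x) \<in> lebesgue \<rightarrow>\<^sub>M lebesgue"
  and nn_integral_lebesgue_translation:
    "f \<in> borel_measurable lebesgue \<Longrightarrow> (\<integral>\<^sup>+x. f (t + x) \<partial>lebesgue) = (\<integral>\<^sup>+x. f x \<partial>lebesgue)"
  for t :: "'a::euclidean_space"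
proof -
  have eq: "(\<lambda>x. t + (\<Sum>j\<in>Basis. (1 * (x \<bullet> j)) *\<^sub>R j)) = (\<lambda>x::'a. t + x)"
    by (simp add: euclidean_representation)
  show m: "(\<lambda>x. t + x) \<in> lebesgue \<rightarrow>\<^sub>M lebesgue"
    using lebesgue_affine_measurable[of "\<lambda>_. 1" t] unfolding eq by simp
  have "lebesgue = distr lebesgue lebesgue (\<lambda>x. t + x)"
    using lebesgue_affine_euclidean[of "\<lambda>_. 1" t] unfolding eq by (simp add: density_1)
  then show "f \<in> borel_measurable lebesgue \<Longrightarrow> (\<integral>\<^sup>+x. f (t + x) \<partial>lebesgue) = (\<integral>\<^sup>+x. f x \<partial>lebesgue)"
    using nn_integral_distr[OF m, of f] by simp
qed

lemma lebesgue_translation_measurable' [measurable]: "(\<lambda>x. x + t) \<in> lebesgue \<rightarrow>\<^sub>M lebesgue"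
  and lebesgue_translation_measurable'' [measurable]: "(\<lambda>x. x - t) \<in> lebesgue \<rightarrow>\<^sub>M lebesgue"
  for t :: "'a::euclidean_space"
proof -
  have "(\<lambda>x. x + t) = (+) t" "(\<lambda>x. x - t) = (+) (- t)" by (simp_all add: fun_eq_iff)
  then show "(\<lambda>x. x + t) \<in> lebesgue \<rightarrow>\<^sub>M lebesgue" "(\<lambda>x. x - t) \<in> lebesgue \<rightarrow>\<^sub>M lebesgue"
    using lebesgue_translation_measurable by metis+
qed

lemma AE_lebesgue_translation:
  fixes t :: "'a::euclidean_space"
  assumes "AE x in lebesgue. P x" shows "AE x in lebesgue. P (x + t)"
proof -
  have eq: "lebesgue = distr lebesgue lebesgue (\<lambda>x::'a. t + x)"
    using lebesgue_affine_euclidean[of "\<lambda>_. 1" t] by (simp add: density_1 euclidean_representation)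
  have "AE x in distr lebesgue lebesgue (\<lambda>x::'a. t + x). P x" using assms by (subst (asm) eq)
  from AE_distrD[OF lebesgue_translation_measurable this] show ?thesis by (simp add: add.commute)
qed

text \<open>Unfolding of a periodic integrand: a point of the cell is counted once for each of its
  lattice translates lying in \<open>E\<close>.\<close>

lemma periodic_nn_integral_unfold:
  fixes f :: "real^'n::finite \<Rightarrow> ennreal"
  assumes f [measurable]: "f \<in> borel_measurable lebesgue" and per: "periodic f"
    and E [measurable]: "E \<in> sets lebesgue"
  shows "(\<integral>\<^sup>+x\<in>E. f x \<partial>lebesgue) =
    (\<integral>\<^sup>+x\<in>cell. f x * (\<integral>\<^sup>+k. indicator E (x - k) \<partial>count_space lattice) \<partial>lebesgue)"
proof -
  \<comment> \<open>The inserted factor is the partition of unity \<open>sum_cell\<close>. After the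
    interchange the term of index \<open>k\<close> is translated by \<open>- k\<close>, which leaves
    the periodic \<open>f\<close> unchanged and moves the shift onto \<open>E\<close>.\<close>
  have "(\<integral>\<^sup>+x\<in>E. f x \<partial>lebesgue) =
      (\<integral>\<^sup>+x. (\<integral>\<^sup>+k. f x * indicator E x * indicator cell (x + k) \<partial>count_space lattice) \<partial>lebesgue)"
    by (subst nn_integral_cmult) (simp_all add: sum_cell)
  also have "\<dots> = (\<integral>\<^sup>+k. (\<integral>\<^sup>+x. f x * indicator E x * indicator cell (x + k) \<partial>lebesgue) \<partial>count_space lattice)"
    by (rule nn_integral_count_space_nn_integral) (auto simp: countable_lattice)
  also have "\<dots> = (\<integral>\<^sup>+k. (\<integral>\<^sup>+x. f x * indicator E (x - k) * indicator cell x \<partial>lebesgue) \<partial>count_space lattice)"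
  proof (rule nn_integral_cong)
    fix k :: "real^'n" assume "k \<in> space (count_space lattice)"
    then have k: "k \<in> lattice" by simp
    have "(\<integral>\<^sup>+x. f x * indicator E x * indicator cell (x + k) \<partial>lebesgue) =
       (\<integral>\<^sup>+x. f (-k + x) * indicator E (-k + x) * indicator cell (-k + x + k) \<partial>lebesgue)"
      by (rule nn_integral_lebesgue_translation[symmetric]) simp
    also have "\<dots> = (\<integral>\<^sup>+x. f x * indicator E (x - k) * indicator cell x \<partial>lebesgue)"
      by (simp add: periodic_diff[OF per k])
    finally show "(\<integral>\<^sup>+x. f x * indicator E x * indicator cell (x + k) \<partial>lebesgue) = \<dots>" .
  qed
  also have "\<dots> = (\<integral>\<^sup>+x. (\<integral>\<^sup>+k. f x * indicator E (x - k) * indicator cell x \<partial>count_space lattice) \<partial>lebesgue)"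
    by (rule nn_integral_count_space_nn_integral[symmetric]) (auto simp: countable_lattice)
  also have "\<dots> = (\<integral>\<^sup>+x\<in>cell. f x * (\<integral>\<^sup>+k. indicator E (x - k) \<partial>count_space lattice) \<partial>lebesgue)"
    by (rule nn_integral_cong, subst nn_integral_multc, simp, subst nn_integral_cmult, simp_all)
  finally show ?thesis .
qed

lemma AE_cell_unit_cube: "AE x::real^'n::finite in lebesgue. x \<in> cell \<longleftrightarrow> x \<in> unit_cube"
proof -
  have "negligible (cbox 0 1 - box 0 1 :: (real^'n) set)" by (rule negligible_frontier_interval)
  then have "AE x::real^'n in lebesgue. x \<notin> cbox 0 1 - box 0 1"
    by (intro AE_not_in) (simp only: negligible_iff_null_sets)
  then show ?thesis
  proof eventually_elim
    case (elim x)
    then show ?case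
      by (auto simp: cell_def mem_box_cart dest: less_imp_le)
  qed
qed

abbreviation qint :: "(real^'n \<Rightarrow> ennreal) \<Rightarrow> ennreal" where
  "qint f \<equiv> (\<integral>\<^sup>+x\<in>unit_cube. f x \<partial>lebesgue)"

lemma nn_integral_cell: "(\<integral>\<^sup>+x\<in>cell. f x \<partial>lebesgue) = qint f" for f :: "real^'n::finite \<Rightarrow> ennreal"
  by (rule nn_integral_cong_AE) (use AE_cell_unit_cube in eventually_elim, auto simp: indicator_def)

text \<open>A translated cell still contains exactly one point of each lattice orbit, so unfolding
  over it gives back the integral over the cell.\<close>

lemma periodic_nn_integral_translation:
  fixes f :: "real^'n::finite \<Rightarrow> ennreal"
  assumes [measurable]: "f \<in> borel_measurable lebesgue" and per: "periodic f"
  shows "qint (\<lambda>x. f (x + t)) = qint f"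
proof -
  have "qint (\<lambda>x. f (x + t)) = (\<integral>\<^sup>+x. f (t + x) * indicator cell (t + x - t) \<partial>lebesgue)"
    unfolding nn_integral_cell[symmetric] by (simp add: add.commute)
  also have "\<dots> = (\<integral>\<^sup>+x. f x * indicator cell (x - t) \<partial>lebesgue)"
    by (rule nn_integral_lebesgue_translation) simp
  also have "\<dots> = (\<integral>\<^sup>+x. f x * indicator {x. x - t \<in> cell} x \<partial>lebesgue)"
    by (simp add: indicator_def)
  also have "\<dots> = (\<integral>\<^sup>+x\<in>cell. f x * (\<integral>\<^sup>+k. indicator {x. x - t \<in> cell} (x - k) \<partial>count_space lattice) \<partial>lebesgue)"
  proof (rule periodic_nn_integral_unfold)
    have "{x. x - t \<in> cell} = (\<lambda>x. x - t) -` cell \<inter> space lebesgue" by auto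
    also have "\<dots> \<in> sets lebesgue" by measurable
    finally show "{x. x - t \<in> cell} \<in> sets lebesgue" .
  qed (use assms in auto)
  also have "\<dots> = (\<integral>\<^sup>+x\<in>cell. f x * (\<integral>\<^sup>+k. indicator cell ((x - t) - k) \<partial>count_space lattice) \<partial>lebesgue)"
    by (simp add: indicator_def algebra_simps)
  also have "\<dots> = qint f" by (simp only: sum_cell_diff nn_integral_cell mult_1_right)
  finally show ?thesis .
qed

text \<open>The constant counts lattice translates: a point of the cell has only boundedly many of
  them in a bounded set. It depends on \<open>E\<close> alone, which makes the estimates for maximal
  functions uniform in \<open>f\<close>.\<close>

lemma periodic_nn_integral_bounded:
  fixes E :: "(real^'n::finite) set"
  assumes "bounded E"
  obtains K where "K > 0" "\<And>f. f \<in> borel_measurable lebesgue \<Longrightarrow> periodic f \<Longrightarrow>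
     (\<integral>\<^sup>+x\<in>E. f x \<partial>lebesgue) \<le> ennreal K * qint f"
proof -
  obtain B where B: "\<And>x. x \<in> E \<Longrightarrow> norm x \<le> B" using assms by (auto simp: bounded_iff)
  obtain m where m: "B + 1 \<le> real m" using real_arch_simple by blast
  let ?E = "{x::real^'n. norm x \<le> B}"
  let ?F = "{k \<in> lattice. \<forall>i::'n. \<bar>k $ i\<bar> \<le> real m}"
  have cnt: "(\<integral>\<^sup>+k. indicator ?E (x - k) \<partial>count_space lattice) \<le> ennreal (real (card ?F) + 1)" if "x \<in> cell" for x
  proof -
    have *: "k \<in> ?F" if k: "k \<in> lattice" "x - k \<in> ?E" for k
    proof -
      have "\<bar>k $ i\<bar> \<le> real m" for i
      proof -
        have "\<bar>(x - k) $ i\<bar> \<le> B" using component_le_norm_cart[of "x - k" i] k by auto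
        moreover have "0 \<le> x $ i" "x $ i < 1" using \<open>x \<in> cell\<close> by (auto simp: cell_def)
        ultimately show ?thesis using m by auto
      qed
      with k show ?thesis by auto
    qed
    have "(\<integral>\<^sup>+k. indicator ?E (x - k) \<partial>count_space lattice) \<le> (\<integral>\<^sup>+k. indicator ?F k \<partial>count_space lattice)"
      using * by (intro nn_integral_mono) (auto simp: indicator_def)
    also have "\<dots> = of_nat (card ?F)"
      using finite_lattice_bounded[of m, where 'n='n] by (subst nn_integral_indicator) (auto simp: emeasure_count_space)
    also have "\<dots> \<le> ennreal (real (card ?F) + 1)"
      by (simp add: ennreal_of_nat_eq_real_of_nat)
    finally show ?thesis .
  qed
  show thesis
  proof (rule that[of "real (card ?F) + 1"])
    fix f :: "real^'n \<Rightarrow> ennreal" assume f: "f \<in> borel_measurable lebesgue" "periodic f"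
    have "(\<integral>\<^sup>+x\<in>E. f x \<partial>lebesgue) \<le> (\<integral>\<^sup>+x\<in>?E. f x \<partial>lebesgue)"
      using B by (intro nn_integral_mono) (auto simp: indicator_def)
    also have "\<dots> = (\<integral>\<^sup>+x\<in>cell. f x * (\<integral>\<^sup>+k. indicator ?E (x - k) \<partial>count_space lattice) \<partial>lebesgue)"
      by (rule periodic_nn_integral_unfold) (use f in auto)
    also have "\<dots> \<le> (\<integral>\<^sup>+x\<in>cell. ennreal (real (card ?F) + 1) * f x \<partial>lebesgue)"
      using cnt by (intro nn_integral_mono) (auto simp: indicator_def mult.commute intro!: mult_left_mono)
    also have "\<dots> = (\<integral>\<^sup>+x. ennreal (real (card ?F) + 1) * (f x * indicator cell x) \<partial>lebesgue)"
      by (simp add: mult.assoc)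
    also have "\<dots> = ennreal (real (card ?F) + 1) * qint f"
      using f by (subst nn_integral_cmult) (auto simp: nn_integral_cell)
    finally show "(\<integral>\<^sup>+x\<in>E. f x \<partial>lebesgue) \<le> ennreal (real (card ?F) + 1) * qint f" .
  qed (simp add: add_nonneg_pos)
qed

text \<open>Countably many translates of a null set form a null set, so almost every
  \<open>x\<close> has all its translates behave well in the cube; invariance of \<open>P\<close>
  brings the property back from the one translate that lies there.\<close>

lemma AE_periodic:
  fixes P :: "real^'n::finite \<Rightarrow> bool"
  assumes "AE x in lebesgue. x \<in> unit_cube \<longrightarrow> P x"
    and per: "\<And>x k. k \<in> lattice \<Longrightarrow> P (x + k) \<longleftrightarrow> P x"
  shows "AE x in lebesgue. P x"
proof -
  have "AE x::real^'n in lebesgue. \<forall>k\<in>lattice. x + k \<in> unit_cube \<longrightarrow> P (x + k)"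
    using AE_lebesgue_translation[OF assms(1)] by (subst AE_ball_countable) (auto simp: countable_lattice)
  then show ?thesis
  proof eventually_elim
    case (elim x)
    have "x + cell_shift x \<in> unit_cube"
      using cell_shift_cell[of x] by (auto simp: cell_def mem_box_cart less_imp_le)
    with elim cell_shift_lattice per show ?case by blast
  qed
qed

text \<open>A periodic Borel representative is obtained by extending a Borel representative
  periodically from the cell.\<close>

lemma periodic_borel_representative:
  fixes f :: "real^'n::finite \<Rightarrow> real"
  assumes "f \<in> borel_measurable lebesgue" and per: "periodic f"
  obtains g where "g \<in> borel_measurable borel" "periodic g" "AE x in lebesgue. f x = g x"
proof -
  obtain f' where f' [measurable]: "f' \<in> borel_measurable lborel" and ae: "AE x in lborel. f x = f' x"
    using completion_ex_borel_measurable_real assms(1) by blast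
  let ?fr = "\<lambda>x::real^'n. (\<chi> i. frac (x $ i))"
  have fr [measurable]: "?fr \<in> borel_measurable borel"
    unfolding frac_def by (rule borel_measurable_euclidean_space[THEN iffD2])
      (auto simp: Basis_vec_def inner_axis)
  have fr_per: "?fr (x + k) = ?fr x" if "k \<in> lattice" for x k
  proof -
    have "frac (x $ i + k $ i) = frac (x $ i)" for i
    proof -
      have "k $ i \<in> \<int>" using that by (simp add: lattice_def)
      then obtain m where "k $ i = of_int m" by (rule Ints_cases)
      then show ?thesis by (simp add: frac_def)
    qed
    then show ?thesis by (simp add: vec_eq_iff)
  qed
  have fr_cell: "?fr x = x" if "x \<in> cell" for x
    using that by (auto simp: cell_def vec_eq_iff frac_eq)
  show thesis
  proof
    show "(\<lambda>x. f' (?fr x)) \<in> borel_measurable borel"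
      using measurable_compose[OF fr, of f'] f' by simp
    show per': "periodic (\<lambda>x. f' (?fr x))"
      using fr_per unfolding periodic_def lattice_def by simp
    show "AE x in lebesgue. f x = f' (?fr x)"
    proof (rule AE_periodic)
      show "AE x in lebesgue. x \<in> unit_cube \<longrightarrow> f x = f' (?fr x)"
        using AE_cell_unit_cube AE_completion[OF ae] by eventually_elim (auto simp: fr_cell)
      show "(f (x + k) = f' (?fr (x + k))) = (f x = f' (?fr x))" if "k \<in> lattice" for x k
        using periodic_add[OF per that] fr_per[OF that, of x] by simp
    qed
  qed
qed

subsection \<open>The maximal function\<close>

text \<open>The Hardy-Littlewood maximal function, normalised by the power of the radius instead of
  the volume of the ball. The radii are bounded so that balls centred in the cube stay in a fixed
  bounded set; the bound exceeds the diameter-type quantity 2|x - y| for nearest lattice translates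
  \<open>x\<close>, \<open>y\<close>.\<close>

definition maxf :: "(real^'n \<Rightarrow> real) \<Rightarrow> real^'n \<Rightarrow> ennreal" where
  "maxf f x = (SUP \<rho>\<in>{0<..<real CARD('n) + 1}.
     ennreal (1 / \<rho> ^ CARD('n)) * (\<integral>\<^sup>+z\<in>ball x \<rho>. ennreal \<bar>f z\<bar> \<partial>lebesgue))"

lemma ennreal_divide_mult_less_iff:
  assumes "c > 0" shows "t < ennreal (1 / c) * s \<longleftrightarrow> ennreal c * t < s"
proof -
  have *: "ennreal (1/c) * (ennreal c * s) = s" for s
    using assms by (simp add: mult.assoc[symmetric] ennreal_mult[symmetric])
  have **: "ennreal c * (ennreal (1/c) * s) = s" for s
    using assms by (simp add: mult.assoc[symmetric] ennreal_mult[symmetric])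
  have "a < b \<Longrightarrow> ennreal c * a < ennreal c * b" for a b
    using assms by (intro ennreal_mult_strict_left_mono) auto
  moreover have "a < b \<Longrightarrow> ennreal (1/c) * a < ennreal (1/c) * b" for a b
    using assms by (intro ennreal_mult_strict_left_mono) auto
  ultimately show ?thesis using * ** by metis
qed

lemma maxf_gt_iff:
  "t < maxf f x \<longleftrightarrow> (\<exists>\<rho>. 0 < \<rho> \<and> \<rho> < real CARD('n::finite) + 1 \<and>
     ennreal (\<rho> ^ CARD('n)) * t < (\<integral>\<^sup>+z\<in>ball x \<rho>. ennreal \<bar>f z\<bar> \<partial>lebesgue))"
  for f :: "real^'n \<Rightarrow> real"
  unfolding maxf_def less_SUP_iff by (auto simp: ennreal_divide_mult_less_iff)

lemma ball_integral_le_maxf: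
  fixes f :: "real^'n::finite \<Rightarrow> real"
  assumes "0 < \<rho>" "\<rho> < real CARD('n) + 1"
  shows "(\<integral>\<^sup>+z\<in>ball x \<rho>. ennreal \<bar>f z\<bar> \<partial>lebesgue) \<le> ennreal (\<rho> ^ CARD('n)) * maxf f x"
proof (rule ccontr)
  assume "\<not> ?thesis"
  then have "maxf f x < maxf f x"
    using assms maxf_gt_iff[of "maxf f x" f x] by auto
  then show False by simp
qed

lemma maxf_leI:
  fixes f :: "real^'n::finite \<Rightarrow> real"
  assumes "\<And>\<rho>. 0 < \<rho> \<Longrightarrow> \<rho> < real CARD('n) + 1 \<Longrightarrow>
    (\<integral>\<^sup>+z\<in>ball x \<rho>. ennreal \<bar>f z\<bar> \<partial>lebesgue) \<le> ennreal (\<rho> ^ CARD('n)) * c"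
  shows "maxf f x \<le> c"
proof (rule ccontr)
  assume "\<not> maxf f x \<le> c"
  then show False using assms maxf_gt_iff[of c f x] by (auto simp: not_le dest: leD)
qed

lemma ball_lebesgue [measurable]: "ball x r \<in> sets (lebesgue :: 'a::euclidean_space measure)"
  and cbox_lebesgue [measurable]: "cbox a b \<in> sets (lebesgue :: 'a::euclidean_space measure)"
  by auto

text \<open>Lower semicontinuity: by monotone convergence a ball that witnesses the inequality can
  be shrunk slightly, and the ball of the original radius about any nearby centre still contains the
  shrunken one. This gives measurability although the supremum runs over uncountably many
  radii.\<close>

lemma open_maxf_gt:
  fixes f :: "real^'n::finite \<Rightarrow> real"
  assumes [measurable]: "f \<in> borel_measurable lebesgue"
  shows "open {x. t < maxf f x}"
proof (rule openI)
  fix x assume "x \<in> {x. t < maxf f x}"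
  then obtain \<rho> where \<rho>: "0 < \<rho>" "\<rho> < real CARD('n) + 1"
      "ennreal (\<rho> ^ CARD('n)) * t < (\<integral>\<^sup>+z\<in>ball x \<rho>. ennreal \<bar>f z\<bar> \<partial>lebesgue)"
    by (auto simp: maxf_gt_iff)
  let ?r = "\<lambda>n. \<rho> - \<rho> / real (n + 2)"
  have sup: "(SUP n. indicator (ball x (?r n)) z) = (indicator (ball x \<rho>) z :: ennreal)" for z
  proof (cases "z \<in> ball x \<rho>")
    case True
    then have "0 < \<rho> - dist x z" by simp
    then obtain n where n: "\<rho> / (\<rho> - dist x z) < real n" using reals_Archimedean2 by blast
    then have "\<rho> < real n * (\<rho> - dist x z)" using \<open>0 < \<rho> - dist x z\<close> by (simp add: field_simps)
    also have "\<dots> \<le> real (n + 2) * (\<rho> - dist x z)" using \<open>0 < \<rho> - dist x z\<close> by (intro mult_right_mono) auto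
    finally have "dist x z < ?r n" by (simp add: field_simps)
    then have "1 \<le> (indicator (ball x (?r n)) z :: ennreal)" by simp
    also have "\<dots> \<le> (SUP n. indicator (ball x (?r n)) z)" by (rule SUP_upper) simp
    finally show ?thesis using True by (auto intro!: antisym SUP_least simp: indicator_def)
  next
    case False
    have "indicator (ball x (?r n)) z = (0::ennreal)" for n
    proof -
      have "0 \<le> \<rho> / real (n + 2)" using \<rho>(1) by (intro divide_nonneg_nonneg) auto
      then have "\<not> dist x z < ?r n" using False by simp
      then show ?thesis by simp
    qed
    then show ?thesis using False by simp
  qed
  have "(\<integral>\<^sup>+z\<in>ball x \<rho>. ennreal \<bar>f z\<bar> \<partial>lebesgue) = (\<integral>\<^sup>+z. (SUP n. ennreal \<bar>f z\<bar> * indicator (ball x (?r n)) z) \<partial>lebesgue)"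
    by (simp only: sup SUP_mult_left_ennreal[symmetric])
  also have "\<dots> = (SUP n. (\<integral>\<^sup>+z. ennreal \<bar>f z\<bar> * indicator (ball x (?r n)) z \<partial>lebesgue))"
  proof (rule nn_integral_monotone_convergence_SUP)
    show "incseq (\<lambda>n z. ennreal \<bar>f z\<bar> * indicator (ball x (?r n)) z)"
    proof (rule incseq_SucI, rule le_funI, rule mult_left_mono)
      fix n z
      have "?r n \<le> ?r (Suc n)" using \<rho>(1) by (auto intro!: divide_left_mono)
      then have "ball x (?r n) \<subseteq> ball x (?r (Suc n))" by (rule subset_ball)
      then show "indicator (ball x (?r n)) z \<le> (indicator (ball x (?r (Suc n))) z :: ennreal)"
        by (auto simp: indicator_def split: if_splits)
    qed simp
  qed simp
  finally obtain n where n: "ennreal (\<rho> ^ CARD('n)) * t < (\<integral>\<^sup>+z\<in>ball x (?r n). ennreal \<bar>f z\<bar> \<partial>lebesgue)"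
    using \<rho>(3) by (auto simp: less_SUP_iff)
  show "\<exists>\<epsilon>>0. ball x \<epsilon> \<subseteq> {x. t < maxf f x}"
  proof (intro exI[of _ "\<rho> / real (n+2)"] conjI)
    show "ball x (\<rho> / real (n+2)) \<subseteq> {x. t < maxf f x}"
    proof
      fix y assume "y \<in> ball x (\<rho> / real (n+2))"
      then have "ball x (?r n) \<subseteq> ball y \<rho>"
        using dist_triangle[of y _ x] by (auto simp: dist_commute) (smt (verit) dist_commute dist_triangle)
      then have "(\<integral>\<^sup>+z\<in>ball x (?r n). ennreal \<bar>f z\<bar> \<partial>lebesgue) \<le> (\<integral>\<^sup>+z\<in>ball y \<rho>. ennreal \<bar>f z\<bar> \<partial>lebesgue)"
        by (intro nn_integral_mono mult_left_mono) (auto simp: indicator_def)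
      with n \<rho> show "y \<in> {x. t < maxf f x}" by (auto simp: maxf_gt_iff intro: less_le_trans)
    qed
    show "0 < \<rho> / real (n+2)" using \<rho>(1) by (intro divide_pos_pos) auto
  qed
qed

lemma maxf_measurable [measurable]:
  fixes f :: "real^'n::finite \<Rightarrow> real"
  assumes "f \<in> borel_measurable lebesgue"
  shows "maxf f \<in> borel_measurable lebesgue"
  by (rule borel_measurableI_greater) (use open_maxf_gt[OF assms] in auto)

lemma periodic_maxf:
  fixes f :: "real^'n::finite \<Rightarrow> real"
  assumes [measurable]: "f \<in> borel_measurable lebesgue" and per: "periodic f"
  shows "periodic (maxf f)"
proof -
  have *: "(\<integral>\<^sup>+z\<in>ball (x + k) \<rho>. ennreal \<bar>f z\<bar> \<partial>lebesgue) = (\<integral>\<^sup>+z\<in>ball x \<rho>. ennreal \<bar>f z\<bar> \<partial>lebesgue)"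
    if "k \<in> lattice" for x k \<rho>
  proof -
    have "(\<integral>\<^sup>+z\<in>ball (x + k) \<rho>. ennreal \<bar>f z\<bar> \<partial>lebesgue) =
        (\<integral>\<^sup>+z. ennreal \<bar>f (k + z)\<bar> * indicator (ball (x + k) \<rho>) (k + z) \<partial>lebesgue)"
      by (rule nn_integral_lebesgue_translation[symmetric]) simp
    also have "\<dots> = (\<integral>\<^sup>+z\<in>ball x \<rho>. ennreal \<bar>f z\<bar> \<partial>lebesgue)"
      using periodic_add[OF per that] by (intro nn_integral_cong) (simp add: add.commute[of k] indicator_def dist_norm)
    finally show ?thesis .
  qed
  show ?thesis unfolding periodic_def maxf_def using * by (auto simp: lattice_def)
qed

lemma maxf_mono_AE:
  assumes "AE x in lebesgue. \<bar>f x\<bar> \<le> \<bar>g x\<bar>"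
  shows "maxf f x \<le> maxf g x"
proof -
  have "(\<integral>\<^sup>+z\<in>ball x \<rho>. ennreal \<bar>f z\<bar> \<partial>lebesgue) \<le> (\<integral>\<^sup>+z\<in>ball x \<rho>. ennreal \<bar>g z\<bar> \<partial>lebesgue)" for \<rho>
    by (rule nn_integral_mono_AE) (use assms in \<open>eventually_elim, auto simp: indicator_def ennreal_leI\<close>)
  then show ?thesis
    unfolding maxf_def by (intro SUP_mono, elim bexI[rotated]) (rule mult_left_mono, simp_all)
qed

lemma maxf_cong_AE:
  assumes "AE x in lebesgue. \<bar>f x\<bar> = \<bar>g x\<bar>"
  shows "maxf f x = maxf g x"
  by (intro antisym maxf_mono_AE) (use assms in \<open>auto elim!: eventually_mono\<close>)

text \<open>Sublinearity in a form with a third function \<open>h\<close>, so that it applies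
  equally to sums, to differences and to the splitting of a function by size.\<close>

lemma maxf_add:
  fixes f g :: "real^'n::finite \<Rightarrow> real"
  assumes [measurable]: "f \<in> borel_measurable lebesgue" "g \<in> borel_measurable lebesgue"
    and "AE x in lebesgue. \<bar>h x\<bar> \<le> \<bar>f x\<bar> + \<bar>g x\<bar>"
  shows "maxf h x \<le> maxf f x + maxf g x"
proof (rule maxf_leI)
  fix \<rho> :: real assume \<rho>: "0 < \<rho>" "\<rho> < real CARD('n) + 1"
  have "(\<integral>\<^sup>+z\<in>ball x \<rho>. ennreal \<bar>h z\<bar> \<partial>lebesgue) \<le>
     (\<integral>\<^sup>+z. ennreal \<bar>f z\<bar> * indicator (ball x \<rho>) z + ennreal \<bar>g z\<bar> * indicator (ball x \<rho>) z \<partial>lebesgue)"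
    by (rule nn_integral_mono_AE) (use assms(3) in \<open>eventually_elim, auto simp: indicator_def ennreal_leI ennreal_plus[symmetric] simp del: ennreal_plus\<close>)
  also have "\<dots> = (\<integral>\<^sup>+z\<in>ball x \<rho>. ennreal \<bar>f z\<bar> \<partial>lebesgue) + (\<integral>\<^sup>+z\<in>ball x \<rho>. ennreal \<bar>g z\<bar> \<partial>lebesgue)"
    by (rule nn_integral_add) auto
  also have "\<dots> \<le> ennreal (\<rho> ^ CARD('n)) * maxf f x + ennreal (\<rho> ^ CARD('n)) * maxf g x"
    by (intro add_mono ball_integral_le_maxf \<rho>)
  finally show "(\<integral>\<^sup>+z\<in>ball x \<rho>. ennreal \<bar>h z\<bar> \<partial>lebesgue) \<le> ennreal (\<rho> ^ CARD('n)) * (maxf f x + maxf g x)"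
    by (simp add: distrib_left)
qed

lemma maxf_cmult:
  fixes f :: "real^'n::finite \<Rightarrow> real"
  assumes [measurable]: "f \<in> borel_measurable lebesgue"
  shows "maxf (\<lambda>x. c * f x) x = ennreal \<bar>c\<bar> * maxf f x"
proof -
  have "(\<integral>\<^sup>+z\<in>ball x \<rho>. ennreal \<bar>c * f z\<bar> \<partial>lebesgue) = ennreal \<bar>c\<bar> * (\<integral>\<^sup>+z\<in>ball x \<rho>. ennreal \<bar>f z\<bar> \<partial>lebesgue)" for \<rho>
    by (subst nn_integral_cmult[symmetric]) (auto simp: abs_mult ennreal_mult mult.assoc)
  then show ?thesis
    unfolding maxf_def by (simp add: SUP_mult_left_ennreal mult.left_commute)
qed

lemma maxf_bounded:
  fixes f :: "real^'n::finite \<Rightarrow> real"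
  assumes "\<And>x. \<bar>f x\<bar> \<le> c"
  shows "maxf f x \<le> ennreal (unit_ball_vol (real CARD('n)) * c)"
proof (rule maxf_leI)
  fix \<rho> :: real assume \<rho>: "0 < \<rho>" "\<rho> < real CARD('n) + 1"
  have "0 \<le> c" using assms[of undefined] by (meson abs_ge_zero order_trans)
  have "(\<integral>\<^sup>+z\<in>ball x \<rho>. ennreal \<bar>f z\<bar> \<partial>lebesgue) \<le> (\<integral>\<^sup>+z\<in>ball x \<rho>. ennreal c \<partial>lebesgue)"
    by (intro nn_integral_mono mult_right_mono ennreal_leI assms) auto
  also have "\<dots> = ennreal c * emeasure lborel (ball x \<rho>)"
    by (simp add: nn_integral_cmult_indicator)
  also have "\<dots> = ennreal (\<rho> ^ CARD('n)) * ennreal (unit_ball_vol (real CARD('n)) * c)"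
    using \<rho> \<open>0 \<le> c\<close> by (simp add: emeasure_ball ennreal_mult[symmetric] mult_ac)
  finally show "(\<integral>\<^sup>+z\<in>ball x \<rho>. ennreal \<bar>f z\<bar> \<partial>lebesgue) \<le> \<dots>" .
qed

lemma norm_unit_cube: "x \<in> unit_cube \<Longrightarrow> norm x \<le> real CARD('n)" for x :: "real^'n::finite"
proof -
  assume x: "x \<in> unit_cube"
  have "norm x \<le> (\<Sum>i\<in>UNIV. \<bar>x $ i\<bar>)" by (rule norm_le_l1_cart)
  also have "\<dots> \<le> (\<Sum>i\<in>(UNIV::'n set). 1)" using x by (intro sum_mono) (auto simp: mem_box_cart)
  finally show ?thesis by simp
qed

text \<open>Vitali covering: the balls that witness the level set contain a disjoint subfamily whose
  fivefold dilates cover it, so its measure is controlled by integrals over disjoint balls. These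
  lie in one bounded set, where periodicity replaces the integral by one over the cube.\<close>

lemma maxf_weak_type:
  obtains C where "C > 0" "\<And>(f :: real^'n::finite \<Rightarrow> real) t. f \<in> borel_measurable lebesgue \<Longrightarrow> periodic f \<Longrightarrow>
    0 < t \<Longrightarrow> ennreal t * emeasure lebesgue ({x. ennreal t < maxf f x} \<inter> unit_cube) \<le>
      ennreal C * qint (\<lambda>x. ennreal \<bar>f x\<bar>)"
proof -
  let ?d = "CARD('n)" and ?V = "unit_ball_vol (real CARD('n))"
  \<comment> \<open>A centre in the cube has norm at most \<open>?d\<close>, and the radii are below
    \<open>?d + 1\<close>.\<close>
  let ?B = "ball (0::real^'n) (2 * real ?d + 1)"
  obtain K where K: "K > 0" "\<And>f. f \<in> borel_measurable lebesgue \<Longrightarrow> periodic f \<Longrightarrow>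
     (\<integral>\<^sup>+x\<in>?B. f x \<partial>lebesgue) \<le> ennreal K * qint f"
    using periodic_nn_integral_bounded[of ?B] by auto
  have V: "?V > 0" by simp
  show thesis
  proof (rule that[of "?V * 5 ^ ?d * K"])
    fix f :: "real^'n \<Rightarrow> real" and t :: real
    assume f [measurable]: "f \<in> borel_measurable lebesgue" and per: "periodic f" and t: "0 < t"
    define E where "E = {x. ennreal t < maxf f x} \<inter> unit_cube"
    have "\<forall>x\<in>E. \<exists>\<rho>. 0 < \<rho> \<and> \<rho> < real ?d + 1 \<and>
       ennreal (\<rho> ^ ?d) * ennreal t < (\<integral>\<^sup>+z\<in>ball x \<rho>. ennreal \<bar>f z\<bar> \<partial>lebesgue)"
      by (auto simp: E_def maxf_gt_iff)
    from bchoice[OF this] obtain r where "\<forall>x\<in>E. 0 < r x \<and> r x < real ?d + 1 \<and>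
       ennreal (r x ^ ?d) * ennreal t < (\<integral>\<^sup>+z\<in>ball x (r x). ennreal \<bar>f z\<bar> \<partial>lebesgue)" ..
    then have r: "\<And>x. x \<in> E \<Longrightarrow> 0 < r x" "\<And>x. x \<in> E \<Longrightarrow> r x < real ?d + 1"
       "\<And>x. x \<in> E \<Longrightarrow> ennreal (r x ^ ?d) * ennreal t < (\<integral>\<^sup>+z\<in>ball x (r x). ennreal \<bar>f z\<bar> \<partial>lebesgue)"
      by blast+
    have "E \<subseteq> (\<Union>x\<in>E. ball x (r x))" using r(1) by force
    then obtain I where I: "countable I" "I \<subseteq> E"
       "pairwise (\<lambda>i j. disjnt (ball i (r i)) (ball j (r j))) I" "E \<subseteq> (\<Union>i\<in>I. ball i (5 * r i))"
      by (rule Vitali_covering_lemma_balls[where B = "real ?d + 1"]) (use r in \<open>auto intro: less_imp_le\<close>)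
    have "ennreal t * emeasure lebesgue E \<le> ennreal t * (\<integral>\<^sup>+x. (\<integral>\<^sup>+i. indicator (ball i (5 * r i)) x \<partial>count_space I) \<partial>lebesgue)"
    proof (rule mult_left_mono)
      have "E \<in> sets lebesgue" unfolding E_def using open_maxf_gt[OF f, of "ennreal t"] by auto
      then have "emeasure lebesgue E = (\<integral>\<^sup>+x. indicator E x \<partial>lebesgue)" by simp
      also have "\<dots> \<le> (\<integral>\<^sup>+x. (\<integral>\<^sup>+i. indicator (ball i (5 * r i)) x \<partial>count_space I) \<partial>lebesgue)"
      proof (rule nn_integral_mono)
        fix x :: "real^'n"
        show "indicator E x \<le> (\<integral>\<^sup>+i. indicator (ball i (5 * r i)) x \<partial>count_space I)"
        proof (cases "x \<in> E")
          case True
          then obtain i where i: "i \<in> I" "x \<in> ball i (5 * r i)" using I(4) by auto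
          have "1 = (indicator (ball i (5 * r i)) x :: ennreal)" using i(2) by simp
          also have "\<dots> \<le> (\<integral>\<^sup>+i. indicator (ball i (5 * r i)) x \<partial>count_space I)"
            by (rule nn_integral_ge_point[OF i(1)])
          finally show ?thesis using True by simp
        qed simp
      qed
      finally show "emeasure lebesgue E \<le> \<dots>" .
    qed simp
    also have "\<dots> = ennreal t * (\<integral>\<^sup>+i. emeasure lebesgue (ball i (5 * r i)) \<partial>count_space I)"
      by (subst nn_integral_count_space_nn_integral) (auto simp: I(1))
    also have "\<dots> = (\<integral>\<^sup>+i. ennreal t * emeasure lebesgue (ball i (5 * r i)) \<partial>count_space I)"
      by (simp add: nn_integral_cmult)
    also have "\<dots> \<le> (\<integral>\<^sup>+i. ennreal (?V * 5 ^ ?d) * (\<integral>\<^sup>+z\<in>ball i (r i). ennreal \<bar>f z\<bar> \<partial>lebesgue) \<partial>count_space I)"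
    proof (rule nn_integral_mono)
      fix i assume "i \<in> space (count_space I)"
      then have i: "i \<in> E" using I(2) by auto
      have "ennreal t * emeasure lebesgue (ball i (5 * r i)) = ennreal (?V * 5 ^ ?d) * (ennreal (r i ^ ?d) * ennreal t)"
        using r(1)[OF i] t V by (simp add: emeasure_ball ennreal_mult[symmetric] power_mult_distrib mult_ac)
      also have "\<dots> \<le> ennreal (?V * 5 ^ ?d) * (\<integral>\<^sup>+z\<in>ball i (r i). ennreal \<bar>f z\<bar> \<partial>lebesgue)"
        using r(3)[OF i] by (intro mult_left_mono less_imp_le) auto
      finally show "ennreal t * emeasure lebesgue (ball i (5 * r i)) \<le> \<dots>" .
    qed
    also have "\<dots> = ennreal (?V * 5 ^ ?d) * (\<integral>\<^sup>+i. (\<integral>\<^sup>+z\<in>ball i (r i). ennreal \<bar>f z\<bar> \<partial>lebesgue) \<partial>count_space I)"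
      by (simp add: nn_integral_cmult)
    also have "(\<integral>\<^sup>+i. (\<integral>\<^sup>+z\<in>ball i (r i). ennreal \<bar>f z\<bar> \<partial>lebesgue) \<partial>count_space I) =
        (\<integral>\<^sup>+z. (\<integral>\<^sup>+i. ennreal \<bar>f z\<bar> * indicator (ball i (r i)) z \<partial>count_space I) \<partial>lebesgue)"
      by (rule nn_integral_count_space_nn_integral[symmetric]) (auto simp: I(1))
    also have "\<dots> \<le> (\<integral>\<^sup>+z\<in>?B. ennreal \<bar>f z\<bar> \<partial>lebesgue)"
    proof (rule nn_integral_mono)
      fix z :: "real^'n"
      have "(\<integral>\<^sup>+i. indicator (ball i (r i)) z \<partial>count_space I) \<le> (indicator ?B z :: ennreal)"
      proof (cases "\<exists>i\<in>I. z \<in> ball i (r i)")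
        case True
        then obtain i where i: "i \<in> I" "z \<in> ball i (r i)" by auto
        then have iE: "i \<in> E" using I(2) by auto
        have "norm z \<le> norm i + dist i z" by (metis add.commute dist_norm norm_minus_commute norm_triangle_sub)
        moreover have "norm i \<le> real ?d" using iE by (intro norm_unit_cube) (simp add: E_def)
        ultimately have zB: "z \<in> ?B" using i(2) r(2)[OF iE] by simp
        \<comment> \<open>Disjointness of the selected balls: at most one of them contains
          \<open>z\<close>, so the sum of their indicators is at most 1.\<close>
        have "j = i" if "j \<in> I" "z \<in> ball j (r j)" for j
        proof (rule ccontr)
          assume "j \<noteq> i"
          then have "disjnt (ball j (r j)) (ball i (r i))" using I(3) that(1) i(1) by (auto simp: pairwise_def)
          then show False using that(2) i(2) by (auto simp: disjnt_def)
        qed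
        then have "(\<integral>\<^sup>+i. indicator (ball i (r i)) z \<partial>count_space I) \<le> (\<integral>\<^sup>+j. indicator {i} j \<partial>count_space I)"
          by (intro nn_integral_mono) (auto simp: indicator_def)
        also have "\<dots> \<le> 1" using i(1) by (subst nn_integral_indicator) (auto simp: emeasure_count_space)
        finally show ?thesis using zB by simp
      next
        case False
        then have "(\<integral>\<^sup>+i. indicator (ball i (r i)) z \<partial>count_space I) = (\<integral>\<^sup>+i. 0 \<partial>count_space I)"
          by (intro nn_integral_cong) (auto simp: indicator_def)
        then show ?thesis by simp
      qed
      then show "(\<integral>\<^sup>+i. ennreal \<bar>f z\<bar> * indicator (ball i (r i)) z \<partial>count_space I) \<le> ennreal \<bar>f z\<bar> * indicator ?B z"
        by (simp add: nn_integral_cmult mult_left_mono)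
    qed
    also have "\<dots> \<le> ennreal K * qint (\<lambda>x. ennreal \<bar>f x\<bar>)"
      using per by (intro K(2)) (auto simp: periodic_def)
    finally have "ennreal t * emeasure lebesgue E \<le> ennreal (?V * 5 ^ ?d) * (ennreal K * qint (\<lambda>x. ennreal \<bar>f x\<bar>))"
      by (simp add: mult_left_mono)
    then show "ennreal t * emeasure lebesgue ({x. ennreal t < maxf f x} \<inter> unit_cube) \<le>
       ennreal (?V * 5 ^ ?d * K) * qint (\<lambda>x. ennreal \<bar>f x\<bar>)"
      unfolding E_def using V K(1) by (simp add: ennreal_mult mult.assoc)
  qed (use V K(1) in simp)
qed

section \<open>Powers of extended reals, dyadic sums and the strong type estimate\<close>

lemma enn_powr_ennreal: "0 \<le> x \<Longrightarrow> enn_powr (ennreal x) p = ennreal (x powr p)"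
  by (simp add: enn_powr_def)

lemma enn_powr_mono: "s \<le> t \<Longrightarrow> 0 \<le> p \<Longrightarrow> enn_powr s p \<le> enn_powr t p"
  by (cases s; cases t) (auto simp: enn_powr_def top_unique intro!: ennreal_leI powr_mono2)

lemma enn_powr_mult:
  assumes "0 \<le> x" "x \<noteq> 0" shows "enn_powr (ennreal x * t) p = ennreal (x powr p) * enn_powr t p"
  using assms by (cases t) (auto simp: enn_powr_def ennreal_mult[symmetric] powr_mult ennreal_mult_top enn2real_mult)

lemma enn_powr_measurable [measurable]:
  assumes [measurable]: "f \<in> borel_measurable M"
  shows "(\<lambda>x. enn_powr (f x) p) \<in> borel_measurable M"
  unfolding enn_powr_def by measurable

text \<open>A geometric series is dominated by its last term, here the one with the largest
  \<open>k\<close> such that \<open>2 ^ k < y\<close>. In the interpolation argument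
  \<open>y\<close> is a multiple of the modulus of the function.\<close>

lemma sum_powr_below:
  fixes y s :: real
  assumes "s > 0" "0 \<le> y"
  shows "(\<Sum>k. ennreal (2 powr (real k * s)) * indicator {2 ^ k<..} y) \<le> ennreal (2 powr s / (2 powr s - 1) * y powr s)"
proof -
  let ?b = "2 powr s" and ?D = "2 powr s / (2 powr s - 1)"
  have b: "?b > 1" using \<open>s > 0\<close> by simp
  have pw: "2 powr (real k * s) = ?b ^ k" for k
    by (simp add: powr_powr[symmetric] powr_realpow mult.commute[of _ s])
  have part: "(\<Sum>k<n. ?b ^ k * indicator {2 ^ k<..} y) \<le> ?D * y powr s" for n
  proof (induction n)
    case 0
    then show ?case using b by simp
  next
    case (Suc n)
    show ?case
    proof (cases "2 ^ n < y")
      case True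
      have "(\<Sum>k<Suc n. ?b ^ k * indicator {2 ^ k<..} y) \<le> (\<Sum>k<Suc n. ?b ^ k)"
        by (intro sum_mono) (auto simp: indicator_def)
      also have "\<dots> = (?b ^ Suc n - 1) / (?b - 1)"
        using b by (subst geometric_sum) auto
      also have "\<dots> \<le> ?D * ?b ^ n"
        using b by (auto simp: divide_right_mono)
      also have "?b ^ n = (2 ^ n) powr s"
        by (simp add: powr_powr powr_realpow[symmetric] mult.commute)
      also have "?D * (2 ^ n) powr s \<le> ?D * y powr s"
        using True b \<open>s > 0\<close> by (intro mult_left_mono powr_mono2 divide_nonneg_nonneg) (auto intro: ge_one_powr_ge_zero)
      finally show ?thesis .
    next
      case False
      then show ?thesis using Suc by simp
    qed
  qed
  have "(\<Sum>k. ennreal (2 powr (real k * s)) * indicator {2 ^ k<..} y) = (\<Sum>k. ennreal (?b ^ k * indicator {2 ^ k<..} y))"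
    by (intro suminf_cong) (auto simp: pw indicator_def)
  also have "\<dots> = (SUP n. \<Sum>k<n. ennreal (?b ^ k * indicator {2 ^ k<..} y))"
    by (rule suminf_eq_SUP)
  also have "\<dots> \<le> ennreal (?D * y powr s)"
    using part by (intro SUP_least) (simp add: sum_ennreal ennreal_leI)
  finally show ?thesis .
qed

lemma ennreal_le_suminf: "f k \<le> (\<Sum>k. f k)" for f :: "nat \<Rightarrow> ennreal"
  using sum_le_suminf[of f "{k}"] by simp

text \<open>A dyadic layer-cake bound. One summand is enough: if \<open>m\<close> exceeds 1 and is
  finite, take the \<open>k\<close> with \<open>m\<close> between \<open>2 ^ k\<close> and
  \<open>2 ^ (k + 1)\<close>; the 1 handles small \<open>m\<close>. For infinite \<open>m\<close>
  every summand is at least 1 and the series diverges.\<close>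

lemma enn_powr_le_dyadic_sum:
  assumes "p > 0"
  shows "enn_powr m p \<le> 1 + (\<Sum>k. ennreal (2 powr (real (k + 1) * p)) * indicator {t. ennreal (2 ^ k) < t} m)"
    (is "_ \<le> 1 + (\<Sum>k. ?f k)")
proof (cases m)
  case (real x)
  show ?thesis
  proof (cases "x \<le> 1")
    case True
    then have "x powr p \<le> 1" using real(1) assms by (simp add: powr_le1)
    then have "enn_powr m p \<le> 1" using real by (simp add: enn_powr_ennreal ennreal_le_1)
    then show ?thesis by (rule order_trans) simp
  next
    case False
    obtain k0 where "x < 2 ^ k0" using real_arch_pow[of 2 x] by auto
    define n where "n = (LEAST n. x \<le> 2 ^ n)"
    have n: "x \<le> 2 ^ n" unfolding n_def using \<open>x < 2 ^ k0\<close> by (intro LeastI[of "\<lambda>n. x \<le> 2 ^ n" k0]) simp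
    have "n \<noteq> 0" using n False by (auto intro: ccontr)
    then obtain k where k: "n = Suc k" by (cases n) auto
    have "\<not> x \<le> 2 ^ k" using not_less_Least[of k "\<lambda>n. x \<le> 2 ^ n"] k unfolding n_def by simp
    then have less: "ennreal (2 ^ k) < m" using real by (simp add: ennreal_less_iff)
    have "enn_powr m p = ennreal (x powr p)" using real by (simp add: enn_powr_ennreal)
    also have "\<dots> \<le> ennreal ((2 ^ n) powr p)" using n real assms by (intro ennreal_leI powr_mono2) auto
    also have "(2 ^ n) powr p = 2 powr (real (k + 1) * p)" unfolding k by (subst powr_realpow[symmetric]) (simp_all add: powr_powr)
    also have "ennreal (2 powr (real (k + 1) * p)) = ?f k" using less by simp
    also have "\<dots> \<le> (\<Sum>k. ?f k)" by (rule ennreal_le_suminf)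
    finally show ?thesis by (rule order_trans) simp
  qed
next
  case top
  have "of_nat N \<le> (\<Sum>k. ?f k)" for N
  proof -
    have "of_nat N = (\<Sum>k<N. 1::ennreal)" by simp
    also have "\<dots> \<le> (\<Sum>k<N. ?f k)"
    proof (rule sum_mono)
      fix k
      have "1 \<le> 2 powr (real (k + 1) * p)" using assms by (intro ge_one_powr_ge_zero) auto
      then show "1 \<le> ?f k" using top by (simp add: ennreal_ge_1)
    qed
    also have "\<dots> \<le> (\<Sum>k. ?f k)" by (rule sum_le_suminf) auto
    finally show ?thesis .
  qed
  then have "\<not> (\<Sum>k. ?f k) < of_nat N" for N by (simp add: not_less)
  then have "\<not> (\<Sum>k. ?f k) < top"
    using ennreal_Ex_less_of_nat[of "\<Sum>k. ?f k"] by blast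
  then have "(\<Sum>k. ?f k) = top"
    by (rule contrapos_np) (simp only: top.not_eq_extremum)
  then show ?thesis by simp
qed

lemma emeasure_unit_cube: "emeasure lborel (unit_cube :: (real^'n::finite) set) = 1"
proof -
  have "(1 - 0 :: real^'n) \<bullet> b = 1 \<and> (0 :: real^'n) \<bullet> b \<le> 1 \<bullet> b" if "b \<in> Basis" for b
    using that by (auto simp: Basis_vec_def inner_axis)
  then show ?thesis by (auto simp: emeasure_lborel_cbox_eq intro!: prod.neutral)
qed

lemma maxf_level_sets:
  fixes f :: "real^'n::finite \<Rightarrow> real"
  assumes "f \<in> borel_measurable lebesgue"
  shows "{x. t < maxf f x} \<in> sets lebesgue"
  using borel_open[OF open_maxf_gt[OF assms, of t]] by simp

text \<open>Marcinkiewicz interpolation between the weak type (1,1) bound and the trivial bound on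
  \<open>L\<^sup>\<infinity>\<close>, over dyadic levels. The normalisation makes levels below 1 irrelevant.\<close>

lemma maxf_strong_type_normalized:
  assumes "p > 1"
  obtains C where "C > 0" "\<And>f :: real^'n::finite \<Rightarrow> real. f \<in> borel_measurable lebesgue \<Longrightarrow> periodic f \<Longrightarrow>
    qint (\<lambda>x. ennreal (\<bar>f x\<bar> powr p)) \<le> 1 \<Longrightarrow> qint (\<lambda>x. enn_powr (maxf f x) p) \<le> ennreal C"
proof -
  obtain C where C: "C > 0" "\<And>(f :: real^'n::finite \<Rightarrow> real) t. f \<in> borel_measurable lebesgue \<Longrightarrow> periodic f \<Longrightarrow>
    0 < t \<Longrightarrow> ennreal t * emeasure lebesgue ({x. ennreal t < maxf f x} \<inter> unit_cube) \<le>
      ennreal C * qint (\<lambda>x. ennreal \<bar>f x\<bar>)"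
    using maxf_weak_type by blast
  define V where "V = unit_ball_vol (real CARD('n))"
  have V: "V > 0" unfolding V_def by simp
  have mb: "maxf f x \<le> ennreal (V * c)" if "\<And>x. \<bar>f x\<bar> \<le> c" for f :: "real^'n \<Rightarrow> real" and x c
    unfolding V_def using that by (rule maxf_bounded)
  \<comment> \<open>The weight of level \<open>k\<close> is of order 2^(k p), and the weak type
    bound contributes 2^-k. Summing what is left over the levels below
    \<open>2 * V * \<bar>f x\<bar>\<close> produces the power p - 1 of the function, to be
    multiplied by the function itself.\<close>
  let ?s = "p - 1"
  let ?D = "2 powr ?s / (2 powr ?s - 1)"
  have D: "?D > 0" using assms by simp
  let ?A = "2 powr p * 2 * C"
  let ?C = "?A * (?D * (2 * V) powr ?s)"
  have V3: "(2 * V) powr ?s > 0" using V by simp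
  have C': "?C > 0" by (intro mult_pos_pos V3 D C(1)) simp_all
  show thesis
  proof (rule that[of "1 + ?C"])
    fix f :: "real^'n \<Rightarrow> real"
    assume f [measurable]: "f \<in> borel_measurable lebesgue" and per: "periodic f"
      and int: "qint (\<lambda>x. ennreal (\<bar>f x\<bar> powr p)) \<le> 1"
    \<comment> \<open>The threshold makes the discarded part at most \<open>2 ^ k / (2 * V)\<close>,
      so that by \<open>maxf_bounded\<close> its maximal function is at most half of the level. The
      other half must come from \<open>?F k\<close>, to which the weak type bound is
      applied.\<close>
    let ?F = "\<lambda>k x. if 2 ^ k < 2 * V * \<bar>f x\<bar> then f x else 0"
    have level: "emeasure lebesgue ({x. ennreal (2 ^ k) < maxf f x} \<inter> unit_cube) \<le>
        ennreal (2 * C / 2 ^ k) * qint (\<lambda>x. ennreal \<bar>?F k x\<bar>)" for k :: nat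
    proof -
      let ?G = "\<lambda>x. if 2 ^ k < 2 * V * \<bar>f x\<bar> then 0 else f x"
      have sub: "{x. ennreal (2 ^ k) < maxf f x} \<subseteq> {x. ennreal (2 ^ k / 2) < maxf (?F k) x}"
      proof safe
        fix x assume "ennreal (2 ^ k) < maxf f x"
        also have "maxf f x \<le> maxf (?F k) x + maxf ?G x" by (rule maxf_add) auto
        also have "maxf ?G x \<le> ennreal (V * (2 ^ k / (2 * V)))"
          using V by (intro mb) (auto simp: field_simps not_less)
        also have "V * (2 ^ k / (2 * V)) = 2 ^ k / 2" using V by simp
        finally have *: "ennreal (2 ^ k) < maxf (?F k) x + ennreal (2 ^ k / 2)"
          by (simp add: add_left_mono)
        show "ennreal (2 ^ k / 2) < maxf (?F k) x"
        proof (rule ccontr)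
          assume "\<not> ?thesis"
          then have "maxf (?F k) x + ennreal (2 ^ k / 2) \<le> ennreal (2 ^ k / 2) + ennreal (2 ^ k / 2)"
            by (intro add_right_mono) simp
          also have "\<dots> = ennreal (2 ^ k)" by (subst ennreal_plus[symmetric]) auto
          finally show False using * by simp
        qed
      qed
      have one: "ennreal (2 / 2 ^ k) * ennreal (2 ^ k / 2) = 1"
        by (subst ennreal_mult[symmetric]) auto
      have "emeasure lebesgue ({x. ennreal (2 ^ k) < maxf f x} \<inter> unit_cube) \<le>
          emeasure lebesgue ({x. ennreal (2 ^ k / 2) < maxf (?F k) x} \<inter> unit_cube)"
      proof (rule emeasure_mono)
        have "?F k \<in> borel_measurable lebesgue" by measurable
        then show "{x. ennreal (2 ^ k / 2) < maxf (?F k) x} \<inter> unit_cube \<in> sets lebesgue"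
          by (intro sets.Int maxf_level_sets) auto
      qed (use sub in blast)
      also have "\<dots> = ennreal (2 / 2 ^ k) * (ennreal (2 ^ k / 2) * emeasure lebesgue ({x. ennreal (2 ^ k / 2) < maxf (?F k) x} \<inter> unit_cube))"
        by (simp only: mult.assoc[symmetric] one mult_1_left)
      also have "\<dots> \<le> ennreal (2 / 2 ^ k) * (ennreal C * qint (\<lambda>x. ennreal \<bar>?F k x\<bar>))"
        by (intro mult_left_mono C(2)) (use per in \<open>auto simp: periodic_def\<close>)
      also have "\<dots> = ennreal (2 * C / 2 ^ k) * qint (\<lambda>x. ennreal \<bar>?F k x\<bar>)"
        using C(1) by (subst mult.assoc[symmetric], subst ennreal_mult[symmetric]) auto
      finally show ?thesis .
    qed
    note sets = maxf_level_sets[OF f]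
    have "qint (\<lambda>x. enn_powr (maxf f x) p) \<le>
        qint (\<lambda>x. 1 + (\<Sum>k. ennreal (2 powr (real (k + 1) * p)) * indicator {t. ennreal (2 ^ k) < t} (maxf f x)))"
      using assms by (intro nn_integral_mono mult_right_mono enn_powr_le_dyadic_sum) auto
    also have "\<dots> = (\<integral>\<^sup>+x. indicator unit_cube x + (\<Sum>k. ennreal (2 powr (real (k + 1) * p)) *
        indicator ({x. ennreal (2 ^ k) < maxf f x} \<inter> unit_cube) x) \<partial>lebesgue)"
      by (intro nn_integral_cong) (auto simp: indicator_def)
    also have "\<dots> = 1 + (\<integral>\<^sup>+x. (\<Sum>k. ennreal (2 powr (real (k + 1) * p)) *
        indicator ({x. ennreal (2 ^ k) < maxf f x} \<inter> unit_cube) x) \<partial>lebesgue)"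
      using sets by (subst nn_integral_add) (auto simp: emeasure_unit_cube)
    also have "(\<integral>\<^sup>+x. (\<Sum>k. ennreal (2 powr (real (k + 1) * p)) *
        indicator ({x. ennreal (2 ^ k) < maxf f x} \<inter> unit_cube) x) \<partial>lebesgue) =
        (\<Sum>k. ennreal (2 powr (real (k + 1) * p)) * emeasure lebesgue ({x. ennreal (2 ^ k) < maxf f x} \<inter> unit_cube))"
      using sets by (subst nn_integral_suminf) (auto simp: nn_integral_cmult)
    also have "\<dots> \<le> (\<Sum>k. ennreal (2 powr (real (k + 1) * p)) * (ennreal (2 * C / 2 ^ k) * qint (\<lambda>x. ennreal \<bar>?F k x\<bar>)))"
      by (intro suminf_le mult_left_mono level) auto
    also have "\<dots> = (\<Sum>k. qint (\<lambda>x. ennreal ?A * (ennreal \<bar>f x\<bar> * (ennreal (2 powr (real k * ?s)) * indicator {2 ^ k<..} (2 * V * \<bar>f x\<bar>)))))"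
    proof (intro suminf_cong)
      fix k :: nat
      have "2 powr (real (k + 1) * p) * (2 * C / 2 ^ k) = ?A * 2 powr (real k * ?s)"
      proof -
        have "2 powr (real (k + 1) * p) = 2 powr p * (2 powr (real k * ?s) * 2 powr real k)"
          by (simp add: powr_add[symmetric] algebra_simps)
        also have "2 powr real k = 2 ^ k" by (simp add: powr_realpow)
        finally show ?thesis by simp
      qed
      then have "ennreal (2 powr (real (k + 1) * p)) * ennreal (2 * C / 2 ^ k) = ennreal ?A * ennreal (2 powr (real k * ?s))"
        using C(1) by (subst (1 2) ennreal_mult[symmetric]) (simp_all del: ennreal_mult)
      then have "ennreal (2 powr (real (k + 1) * p)) * (ennreal (2 * C / 2 ^ k) * qint (\<lambda>x. ennreal \<bar>?F k x\<bar>)) =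
          (ennreal ?A * ennreal (2 powr (real k * ?s))) * qint (\<lambda>x. ennreal \<bar>?F k x\<bar>)"
        by (simp only: mult.assoc[symmetric])
      also have "\<dots> = (\<integral>\<^sup>+x. (ennreal ?A * ennreal (2 powr (real k * ?s))) * (ennreal \<bar>?F k x\<bar> * indicator unit_cube x) \<partial>lebesgue)"
        by (rule nn_integral_cmult[symmetric]) simp
      also have "\<dots> = qint (\<lambda>x. ennreal ?A * (ennreal \<bar>f x\<bar> * (ennreal (2 powr (real k * ?s)) * indicator {2 ^ k<..} (2 * V * \<bar>f x\<bar>))))"
        by (intro nn_integral_cong) (auto simp: indicator_def mult_ac)
      finally show "ennreal (2 powr (real (k + 1) * p)) * (ennreal (2 * C / 2 ^ k) * qint (\<lambda>x. ennreal \<bar>?F k x\<bar>)) = \<dots>" .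
    qed
    also have "\<dots> = (\<integral>\<^sup>+x. (\<Sum>k. ennreal ?A * (ennreal \<bar>f x\<bar> * (ennreal (2 powr (real k * ?s)) * indicator {2 ^ k<..} (2 * V * \<bar>f x\<bar>))) * indicator unit_cube x) \<partial>lebesgue)"
      by (rule nn_integral_suminf[symmetric]) measurable
    also have "\<dots> = qint (\<lambda>x. ennreal ?A * (ennreal \<bar>f x\<bar> * (\<Sum>k. ennreal (2 powr (real k * ?s)) * indicator {2 ^ k<..} (2 * V * \<bar>f x\<bar>))))"
      by simp
    also have "\<dots> \<le> qint (\<lambda>x. ennreal ?A * (ennreal \<bar>f x\<bar> * ennreal (?D * (2 * V * \<bar>f x\<bar>) powr ?s)))"
      using assms V by (intro nn_integral_mono mult_right_mono mult_left_mono sum_powr_below) auto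
    also have "\<dots> = (\<integral>\<^sup>+x. ennreal ?C * (ennreal (\<bar>f x\<bar> powr p) * indicator unit_cube x) \<partial>lebesgue)"
    proof (intro nn_integral_cong)
      fix x
      have pw: "\<bar>f x\<bar> * \<bar>f x\<bar> powr ?s = \<bar>f x\<bar> powr p"
        using powr_mult_base[of "\<bar>f x\<bar>" ?s] by simp
      have "?A * (\<bar>f x\<bar> * (?D * (2 * V * \<bar>f x\<bar>) powr ?s)) = ?C * (\<bar>f x\<bar> * \<bar>f x\<bar> powr ?s)"
        using V by (simp add: powr_mult)
      then have "?A * (\<bar>f x\<bar> * (?D * (2 * V * \<bar>f x\<bar>) powr ?s)) = ?C * \<bar>f x\<bar> powr p"
        unfolding pw .
      moreover have "ennreal ?A * (ennreal \<bar>f x\<bar> * ennreal (?D * (2 * V * \<bar>f x\<bar>) powr ?s)) = ennreal (?A * (\<bar>f x\<bar> * (?D * (2 * V * \<bar>f x\<bar>) powr ?s)))"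
      proof -
        have A0: "0 \<le> ?A" using C(1) by simp
        have Y0: "0 \<le> ?D * (2 * V * \<bar>f x\<bar>) powr ?s" by (intro mult_nonneg_nonneg less_imp_le[OF D]) simp
        show ?thesis
          by (simp only: ennreal_mult[OF A0 mult_nonneg_nonneg[OF abs_ge_zero Y0]] ennreal_mult[OF abs_ge_zero Y0])
      qed
      moreover have "ennreal (?C * \<bar>f x\<bar> powr p) = ennreal ?C * ennreal (\<bar>f x\<bar> powr p)"
        using C' by (intro ennreal_mult) auto
      ultimately show "ennreal ?A * (ennreal \<bar>f x\<bar> * ennreal (?D * (2 * V * \<bar>f x\<bar>) powr ?s)) * indicator unit_cube x =
         ennreal ?C * (ennreal (\<bar>f x\<bar> powr p) * indicator unit_cube x)"
        by (simp only: mult.assoc)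
    qed
    also have "\<dots> = ennreal ?C * qint (\<lambda>x. ennreal (\<bar>f x\<bar> powr p))"
      by (rule nn_integral_cmult) simp
    also have "\<dots> \<le> ennreal ?C * 1" by (intro mult_left_mono int) simp
    finally have "qint (\<lambda>x. enn_powr (maxf f x) p) \<le> 1 + ennreal ?C" by (simp add: add_left_mono)
    then show "qint (\<lambda>x. enn_powr (maxf f x) p) \<le> ennreal (1 + ?C)"
      using C' by (subst ennreal_plus) auto
  qed (use C' in linarith)
qed

text \<open>Both sides are homogeneous of degree \<open>p\<close>, so the normalised estimate is
  applied to \<open>f\<close> divided by its norm. The norm 0 admits no such division, but then
  \<open>f\<close> vanishes almost everywhere and its maximal function vanishes identically.\<close>

lemma maxf_strong_type:
  assumes "p > 1"
  obtains C where "C > 0" "\<And>f :: real^'n::finite \<Rightarrow> real. f \<in> borel_measurable lebesgue \<Longrightarrow> periodic f \<Longrightarrow>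
    qint (\<lambda>x. enn_powr (maxf f x) p) \<le> ennreal C * qint (\<lambda>x. ennreal (\<bar>f x\<bar> powr p))"
proof -
  obtain C where C: "C > 0" "\<And>f :: real^'n::finite \<Rightarrow> real. f \<in> borel_measurable lebesgue \<Longrightarrow> periodic f \<Longrightarrow>
    qint (\<lambda>x. ennreal (\<bar>f x\<bar> powr p)) \<le> 1 \<Longrightarrow> qint (\<lambda>x. enn_powr (maxf f x) p) \<le> ennreal C"
    using maxf_strong_type_normalized[OF assms] by blast
  show thesis
  proof (rule that[OF C(1)])
    fix f :: "real^'n \<Rightarrow> real"
    assume f [measurable]: "f \<in> borel_measurable lebesgue" and per: "periodic f"
    show "qint (\<lambda>x. enn_powr (maxf f x) p) \<le> ennreal C * qint (\<lambda>x. ennreal (\<bar>f x\<bar> powr p))"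
    proof (cases "qint (\<lambda>x. ennreal (\<bar>f x\<bar> powr p))")
      case top
      then show ?thesis using C(1) by (simp add: ennreal_mult_top)
    next
      case (real N)
      show ?thesis
      proof (cases "N = 0")
        case True
        then have "AE x in lebesgue. ennreal (\<bar>f x\<bar> powr p) * indicator unit_cube x = 0"
          using real by (subst nn_integral_0_iff_AE[symmetric]) auto
        then have "AE x in lebesgue. x \<in> unit_cube \<longrightarrow> f x = 0"
          by eventually_elim (auto simp: indicator_def split: if_splits)
        then have "AE x in lebesgue. f x = 0"
          by (rule AE_periodic) (simp add: periodic_add[OF per])
        then have "maxf f x = maxf (\<lambda>_. 0) x" for x
          by (intro maxf_cong_AE) auto
        then have "maxf f x = 0" for x
          using maxf_bounded[of "\<lambda>_. 0" 0 x] by simp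
        then show ?thesis using assms by (simp add: enn_powr_def)
      next
        case False
        then have N: "N > 0" using real by simp
        define l where "l = N powr (1 / p)"
        have l: "l > 0" "l powr p = N" using N assms by (auto simp: l_def powr_powr)
        let ?h = "\<lambda>x. (1 / l) * f x"
        have hp: "\<bar>?h x\<bar> powr p = \<bar>f x\<bar> powr p / N" for x
          using l N by (simp add: abs_mult powr_divide abs_divide)
        have "qint (\<lambda>x. ennreal (\<bar>?h x\<bar> powr p)) = (\<integral>\<^sup>+x. ennreal (1 / N) * (ennreal (\<bar>f x\<bar> powr p) * indicator unit_cube x) \<partial>lebesgue)"
          unfolding hp using N by (intro nn_integral_cong) (auto simp: ennreal_mult[symmetric] indicator_def)
        also have "\<dots> = ennreal (1 / N) * ennreal N"
          by (subst nn_integral_cmult) (auto simp: real)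
        also have "\<dots> = 1" using N by (simp add: ennreal_mult[symmetric])
        finally have *: "qint (\<lambda>x. enn_powr (maxf ?h x) p) \<le> ennreal C"
          by (intro C(2)) (use per in \<open>auto simp: periodic_def\<close>)
        have "maxf f x = ennreal l * maxf ?h x" for x
          using maxf_cmult[of ?h l x] l by simp
        then have "enn_powr (maxf f x) p = ennreal N * enn_powr (maxf ?h x) p" for x
          using l by (simp add: enn_powr_mult)
        then have "qint (\<lambda>x. enn_powr (maxf f x) p) = (\<integral>\<^sup>+x. ennreal N * (enn_powr (maxf ?h x) p * indicator unit_cube x) \<partial>lebesgue)"
          by (simp add: mult.assoc)
        also have "\<dots> = ennreal N * qint (\<lambda>x. enn_powr (maxf ?h x) p)"
          by (rule nn_integral_cmult) simp
        also have "\<dots> \<le> ennreal N * ennreal C" by (intro mult_left_mono *) simp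
        finally show ?thesis by (simp only: real mult.commute[of "ennreal N"])
      qed
    qed
  qed
qed

subsection \<open>Continuity of translations in \<open>L\<^sup>1\<close>\<close>

lemma nn_integral_lborel_translation:
  fixes f :: "'a::euclidean_space \<Rightarrow> ennreal"
  assumes "f \<in> borel_measurable borel"
  shows "(\<integral>\<^sup>+x. f (x + t) \<partial>lborel) = (\<integral>\<^sup>+x. f x \<partial>lborel)"
  using nn_integral_lebesgue_translation[of f t] measurable_completion[of f lborel borel] assms
  by (simp add: nn_integral_completion add.commute)

text \<open>Stated along sequences of shifts, the form in which dominated convergence
  applies.\<close>

definition translation_continuous :: "('a::euclidean_space \<Rightarrow> real) \<Rightarrow> bool" where
  "translation_continuous w \<longleftrightarrow>
     (\<forall>t. t \<longlonglongrightarrow> 0 \<longrightarrow> (\<lambda>n. \<integral>\<^sup>+x. ennreal \<bar>w (x + t n) - w x\<bar> \<partial>lborel) \<longlonglongrightarrow> 0)"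

lemma tendsto_0_le_ennreal:
  fixes f g :: "nat \<Rightarrow> ennreal"
  assumes "g \<longlonglongrightarrow> 0" "\<And>n. f n \<le> g n" shows "f \<longlonglongrightarrow> 0"
  by (rule tendsto_sandwich[OF _ _ tendsto_const assms(1)]) (auto simp: assms)

text \<open>A point of an open set stays in it under small shifts, so the part of \<open>U\<close>
  that leaves \<open>U\<close> tends to the empty set pointwise, dominated by \<open>U\<close>
  itself. The part that enters \<open>U\<close> is the part that leaves it under the opposite shift,
  after a translation.\<close>

lemma translation_continuous_indicator_open:
  fixes U :: "'a::euclidean_space set"
  assumes "open U" "emeasure lborel U < \<infinity>"
  shows "translation_continuous (indicator U)"
  unfolding translation_continuous_def
proof (intro allI impI)
  fix t :: "nat \<Rightarrow> 'a" assume t: "t \<longlonglongrightarrow> 0"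
  have [measurable]: "U \<in> sets borel" using assms by simp
  let ?h = "\<lambda>s x. indicator U x * indicator (- U) (x + s) :: ennreal"
  have [measurable]: "?h s \<in> borel_measurable borel" for s by measurable
  have conv: "(\<lambda>n. \<integral>\<^sup>+x. ?h (s n) x \<partial>lborel) \<longlonglongrightarrow> 0" if s: "s \<longlonglongrightarrow> 0" for s
  proof -
    have "(\<lambda>n. \<integral>\<^sup>+x. ?h (s n) x \<partial>lborel) \<longlonglongrightarrow> (\<integral>\<^sup>+x. 0 \<partial>(lborel :: 'a measure))"
    proof (rule nn_integral_dominated_convergence[where w="indicator U"])
      show "AE x in lborel. (\<lambda>n. ?h (s n) x) \<longlonglongrightarrow> 0"
      proof (rule AE_I2)
        fix x
        show "(\<lambda>n. ?h (s n) x) \<longlonglongrightarrow> 0"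
        proof (cases "x \<in> U")
          case True
          have "(\<lambda>n. x + s n) \<longlonglongrightarrow> x + 0" by (intro tendsto_intros s)
          then have "\<forall>\<^sub>F n in sequentially. x + s n \<in> U"
            using True assms(1) by (intro topological_tendstoD) auto
          then have "\<forall>\<^sub>F n in sequentially. ?h (s n) x = 0" by eventually_elim simp
          then show ?thesis by (rule tendsto_eventually)
        qed simp
      qed
      show "AE x in lborel. ?h (s n) x \<le> indicator U x" for n
        by (rule AE_I2) (simp add: indicator_def)
    qed (use assms in auto)
    then show ?thesis by simp
  qed
  have eq: "(\<integral>\<^sup>+x. ennreal \<bar>indicator U (x + s) - indicator U x\<bar> \<partial>lborel) =
      (\<integral>\<^sup>+x. ?h s x \<partial>lborel) + (\<integral>\<^sup>+x. ?h (- s) x \<partial>lborel)" for s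
  proof -
    have "(\<integral>\<^sup>+x. ennreal \<bar>indicator U (x + s) - indicator U x\<bar> \<partial>lborel) =
       (\<integral>\<^sup>+x. ?h s x + ?h (-s) (x + s) \<partial>lborel)"
      by (intro nn_integral_cong) (auto simp: indicator_def)
    also have "\<dots> = (\<integral>\<^sup>+x. ?h s x \<partial>lborel) + (\<integral>\<^sup>+x. ?h (-s) (x + s) \<partial>lborel)"
      by (rule nn_integral_add) auto
    also have "(\<integral>\<^sup>+x. ?h (-s) (x + s) \<partial>lborel) = (\<integral>\<^sup>+x. ?h (- s) x \<partial>lborel)"
      by (rule nn_integral_lborel_translation) simp
    finally show ?thesis .
  qed
  have "(\<lambda>n. - t n) \<longlonglongrightarrow> 0" using tendsto_minus[OF t] by simp
  from tendsto_add[OF conv[OF t] conv[OF this]]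
  show "(\<lambda>n. \<integral>\<^sup>+x. ennreal \<bar>indicator U (x + t n) - indicator U x\<bar> \<partial>lborel) \<longlonglongrightarrow> 0"
    by (simp add: eq)
qed

text \<open>The property is closed under limits in L^1: by translation invariance the approximation
  error is the same before and after the shift, so three terms of size \<open>r/4\<close>
  suffice.\<close>

lemma translation_continuous_approx:
  fixes w :: "'a::euclidean_space \<Rightarrow> real"
  assumes [measurable]: "w \<in> borel_measurable borel"
    and ap: "\<And>e. 0 < e \<Longrightarrow> \<exists>s. s \<in> borel_measurable borel \<and> translation_continuous s \<and>
        (\<integral>\<^sup>+x. ennreal \<bar>w x - s x\<bar> \<partial>lborel) \<le> ennreal e"
  shows "translation_continuous w"
  unfolding translation_continuous_def
proof (intro allI impI)
  fix t :: "nat \<Rightarrow> 'a" assume t: "t \<longlonglongrightarrow> 0"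
  show "(\<lambda>n. \<integral>\<^sup>+x. ennreal \<bar>w (x + t n) - w x\<bar> \<partial>lborel) \<longlonglongrightarrow> 0"
  proof (rule tendsto_zero_ennreal)
    fix r :: real assume r: "0 < r"
    then obtain s where s [measurable]: "s \<in> borel_measurable borel" and ts: "translation_continuous s"
      and le: "(\<integral>\<^sup>+x. ennreal \<bar>w x - s x\<bar> \<partial>lborel) \<le> ennreal (r/4)"
      using ap[of "r/4"] by auto
    have "(\<lambda>n. \<integral>\<^sup>+x. ennreal \<bar>s (x + t n) - s x\<bar> \<partial>lborel) \<longlonglongrightarrow> 0"
      using ts t by (auto simp: translation_continuous_def)
    then have "\<forall>\<^sub>F n in sequentially. (\<integral>\<^sup>+x. ennreal \<bar>s (x + t n) - s x\<bar> \<partial>lborel) < ennreal (r/4)"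
      by (rule order_tendstoD) (use r in simp)
    then show "\<forall>\<^sub>F n in sequentially. (\<integral>\<^sup>+x. ennreal \<bar>w (x + t n) - w x\<bar> \<partial>lborel) < ennreal r"
    proof eventually_elim
      case (elim n)
      have "(\<integral>\<^sup>+x. ennreal \<bar>w (x + t n) - w x\<bar> \<partial>lborel) \<le>
        (\<integral>\<^sup>+x. ennreal \<bar>w (x + t n) - s (x + t n)\<bar> + (ennreal \<bar>s (x + t n) - s x\<bar> + ennreal \<bar>w x - s x\<bar>) \<partial>lborel)"
        by (intro nn_integral_mono) (auto simp flip: ennreal_plus intro!: ennreal_leI)
      also have "\<dots> = (\<integral>\<^sup>+x. ennreal \<bar>w (x + t n) - s (x + t n)\<bar> \<partial>lborel) +
          ((\<integral>\<^sup>+x. ennreal \<bar>s (x + t n) - s x\<bar> \<partial>lborel) + (\<integral>\<^sup>+x. ennreal \<bar>w x - s x\<bar> \<partial>lborel))"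
        by (subst nn_integral_add, simp, simp, subst nn_integral_add) auto
      also have "(\<integral>\<^sup>+x. ennreal \<bar>w (x + t n) - s (x + t n)\<bar> \<partial>lborel) = (\<integral>\<^sup>+x. ennreal \<bar>w x - s x\<bar> \<partial>lborel)"
        by (rule nn_integral_lborel_translation) simp
      also have "(\<integral>\<^sup>+x. ennreal \<bar>w x - s x\<bar> \<partial>lborel) + ((\<integral>\<^sup>+x. ennreal \<bar>s (x + t n) - s x\<bar> \<partial>lborel) + (\<integral>\<^sup>+x. ennreal \<bar>w x - s x\<bar> \<partial>lborel))
         \<le> ennreal (r/4) + (ennreal (r/4) + ennreal (r/4))"
        using le elim by (intro add_mono) auto
      also have "\<dots> < ennreal r" using r by (simp flip: ennreal_plus add: ennreal_less_iff)
      finally show ?case .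
    qed
  qed
qed

lemma translation_continuous_add:
  assumes [measurable]: "f \<in> borel_measurable borel" "g \<in> borel_measurable borel"
    and "translation_continuous f" "translation_continuous g"
  shows "translation_continuous (\<lambda>x. f x + g x)"
  unfolding translation_continuous_def
proof (intro allI impI)
  fix t :: "nat \<Rightarrow> 'a" assume t: "t \<longlonglongrightarrow> 0"
  have "(\<lambda>n. (\<integral>\<^sup>+x. ennreal \<bar>f (x + t n) - f x\<bar> \<partial>lborel) + (\<integral>\<^sup>+x. ennreal \<bar>g (x + t n) - g x\<bar> \<partial>lborel)) \<longlonglongrightarrow> 0 + 0"
    using assms(3,4) t by (intro tendsto_add) (auto simp: translation_continuous_def)
  then show "(\<lambda>n. \<integral>\<^sup>+x. ennreal \<bar>f (x + t n) + g (x + t n) - (f x + g x)\<bar> \<partial>lborel) \<longlonglongrightarrow> 0"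
    unfolding add_0_left
  proof (rule tendsto_0_le_ennreal)
    fix n
    have "(\<integral>\<^sup>+x. ennreal \<bar>f (x + t n) + g (x + t n) - (f x + g x)\<bar> \<partial>lborel) \<le>
       (\<integral>\<^sup>+x. ennreal \<bar>f (x + t n) - f x\<bar> + ennreal \<bar>g (x + t n) - g x\<bar> \<partial>lborel)"
      by (intro nn_integral_mono) (auto simp flip: ennreal_plus intro!: ennreal_leI)
    also have "\<dots> = (\<integral>\<^sup>+x. ennreal \<bar>f (x + t n) - f x\<bar> \<partial>lborel) + (\<integral>\<^sup>+x. ennreal \<bar>g (x + t n) - g x\<bar> \<partial>lborel)"
      by (rule nn_integral_add) auto
    finally show "(\<integral>\<^sup>+x. ennreal \<bar>f (x + t n) + g (x + t n) - (f x + g x)\<bar> \<partial>lborel) \<le> \<dots>" .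
  qed
qed

lemma translation_continuous_cmult:
  assumes [measurable]: "f \<in> borel_measurable borel" and "translation_continuous f"
  shows "translation_continuous (\<lambda>x. c * f x)"
  unfolding translation_continuous_def
proof (intro allI impI)
  fix t :: "nat \<Rightarrow> 'a" assume t: "t \<longlonglongrightarrow> 0"
  have "(\<lambda>n. ennreal \<bar>c\<bar> * (\<integral>\<^sup>+x. ennreal \<bar>f (x + t n) - f x\<bar> \<partial>lborel)) \<longlonglongrightarrow> ennreal \<bar>c\<bar> * 0"
    using assms(2) t by (intro tendsto_mult_ennreal tendsto_const) (auto simp: translation_continuous_def)
  moreover have "ennreal \<bar>c\<bar> * (\<integral>\<^sup>+x. ennreal \<bar>f (x + t n) - f x\<bar> \<partial>lborel) = (\<integral>\<^sup>+x. ennreal \<bar>c * f (x + t n) - c * f x\<bar> \<partial>lborel)" for n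
    by (subst nn_integral_cmult[symmetric]) (auto simp: ennreal_mult[symmetric] abs_mult[symmetric] algebra_simps)
  ultimately show "(\<lambda>n. \<integral>\<^sup>+x. ennreal \<bar>c * f (x + t n) - c * f x\<bar> \<partial>lborel) \<longlonglongrightarrow> 0" by simp
qed

text \<open>Induction over integrable functions. Outer regularity reduces indicators of measurable
  sets to open sets of finite measure; linear combinations and dominated limits follow.\<close>

lemma translation_continuous_integrable:
  fixes w :: "'a::euclidean_space \<Rightarrow> real"
  assumes "integrable lborel w"
  shows "translation_continuous w"
  using assms
proof (induction rule: integrable_induct)
  case (base A c)
  then have A: "A \<in> sets borel" by simp
  have "translation_continuous (indicator A)"
  proof (rule translation_continuous_approx)
    fix e :: real assume "0 < e"
    obtain U where U: "open U" "A \<subseteq> U" "emeasure lborel (U - A) < ennreal e"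
      using outer_regular_lborel[OF A \<open>0 < e\<close>] by auto
    have "emeasure lborel U = emeasure lborel (A \<union> (U - A))" using U(2) by (simp add: Un_absorb1)
    also have "\<dots> \<le> emeasure lborel A + emeasure lborel (U - A)"
      using A U(1) by (intro emeasure_subadditive) auto
    also have "\<dots> < \<infinity>" using base(2) less_trans[OF U(3) ennreal_less_top] by simp
    finally have "translation_continuous (indicator U :: 'a \<Rightarrow> real)" by (rule translation_continuous_indicator_open[OF U(1)])
    moreover have "(\<integral>\<^sup>+x. ennreal \<bar>indicator A x - indicator U x\<bar> \<partial>lborel) = (\<integral>\<^sup>+x. indicator (U - A) x \<partial>lborel)"
      using U(2) by (intro nn_integral_cong) (auto simp: indicator_def)
    ultimately show "\<exists>s. s \<in> borel_measurable borel \<and> translation_continuous s \<and>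
        (\<integral>\<^sup>+x. ennreal \<bar>indicator A x - s x\<bar> \<partial>lborel) \<le> ennreal e"
      using U A by (intro exI[of _ "indicator U"]) (auto simp: less_imp_le)
  qed (use A in simp)
  then have "translation_continuous (\<lambda>x. c * indicator A x)"
    using A by (intro translation_continuous_cmult) auto
  then show ?case by (simp add: mult.commute)
next
  case (add f g)
  then show ?case by (intro translation_continuous_add) auto
next
  case (lim f s)
  have [measurable]: "f \<in> borel_measurable borel" "\<And>i. s i \<in> borel_measurable borel" using lim by auto
  have conv: "(\<lambda>i. \<integral>\<^sup>+x. ennreal (norm (s i x - f x)) \<partial>lborel) \<longlonglongrightarrow> (\<integral>\<^sup>+x. 0 \<partial>(lborel :: 'a measure))"
  \<comment> \<open>The induction rule supplies approximants bounded by twice the limit, and the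
    limit itself adds one more.\<close>
  proof (rule nn_integral_dominated_convergence[where w="\<lambda>x. ennreal (3 * norm (f x))"])
    show "(\<integral>\<^sup>+x. ennreal (3 * norm (f x)) \<partial>lborel) < \<infinity>"
      using lim(4) by (simp add: ennreal_mult nn_integral_cmult integrable_iff_bounded ennreal_mult_less_top)
    show "AE x in lborel. (\<lambda>i. ennreal (norm (s i x - f x))) \<longlonglongrightarrow> 0"
    proof (rule AE_I2)
      fix x assume "x \<in> space (lborel :: 'a measure)"
      then have "(\<lambda>i. norm (s i x - f x)) \<longlonglongrightarrow> norm (f x - f x)"
        using lim(2) by (intro tendsto_intros) auto
      then show "(\<lambda>i. ennreal (norm (s i x - f x))) \<longlonglongrightarrow> 0"
        using tendsto_ennrealI[of "\<lambda>i. norm (s i x - f x)" 0] by simp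
    qed
    show "AE x in lborel. ennreal (norm (s i x - f x)) \<le> ennreal (3 * norm (f x))" for i
    proof (rule AE_I2, rule ennreal_leI)
      fix x assume "x \<in> space (lborel :: 'a measure)"
      then have "norm (s i x) \<le> 2 * norm (f x)" using lim(3) by auto
      then show "norm (s i x - f x) \<le> 3 * norm (f x)" using norm_triangle_ineq4[of "s i x" "f x"] by linarith
    qed
  qed auto
  show ?case
  proof (rule translation_continuous_approx)
    fix e :: real assume e: "0 < e"
    have "\<forall>\<^sub>F i in sequentially. (\<integral>\<^sup>+x. ennreal (norm (s i x - f x)) \<partial>lborel) < ennreal e"
      using conv e by (intro order_tendstoD) auto
    then obtain i where "(\<integral>\<^sup>+x. ennreal (norm (s i x - f x)) \<partial>lborel) < ennreal e"
      by (auto simp: eventually_sequentially)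
    then show "\<exists>s. s \<in> borel_measurable borel \<and> translation_continuous s \<and>
        (\<integral>\<^sup>+x. ennreal \<bar>f x - s x\<bar> \<partial>lborel) \<le> ennreal e"
      using lim(5) by (intro exI[of _ "s i"]) (auto simp: abs_minus_commute less_imp_le)
  qed simp
qed

text \<open>A nonzero periodic function is not integrable on the whole space, so \<open>w\<close> is
  cut off to a ball that contains the cube and all its shifts by vectors of norm less than 1. The
  sequential statement yields \<delta> by contradiction.\<close>

lemma periodic_translation_continuity:
  fixes w :: "real^'n::finite \<Rightarrow> real"
  assumes [measurable]: "w \<in> borel_measurable borel" and per: "periodic w"
    and fin: "qint (\<lambda>x. ennreal \<bar>w x\<bar>) < \<infinity>" and e: "0 < e"
  obtains \<delta> where "0 < \<delta>" "\<And>t. norm t < \<delta> \<Longrightarrow> qint (\<lambda>x. ennreal \<bar>w (x + t) - w x\<bar>) \<le> ennreal e"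
proof -
  let ?B = "ball (0::real^'n) (real CARD('n) + 2)"
  let ?W = "\<lambda>x. w x * indicator ?B x"
  obtain K where K: "K > 0" "\<And>f. f \<in> borel_measurable lebesgue \<Longrightarrow> periodic f \<Longrightarrow>
     (\<integral>\<^sup>+x\<in>?B. f x \<partial>lebesgue) \<le> ennreal K * qint f"
    using periodic_nn_integral_bounded[of ?B] by auto
  have [measurable]: "?B \<in> sets borel" by simp
  have wl: "w \<in> borel_measurable lebesgue"
    by (intro measurable_completion) simp
  have "(\<integral>\<^sup>+x. ennreal (norm (?W x)) \<partial>lborel) = (\<integral>\<^sup>+x\<in>?B. ennreal \<bar>w x\<bar> \<partial>lebesgue)"
    unfolding nn_integral_completion by (intro nn_integral_cong) (simp add: indicator_def)
  also have "\<dots> \<le> ennreal K * qint (\<lambda>x. ennreal \<bar>w x\<bar>)"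
    using per wl by (intro K(2)) (auto simp: periodic_def)
  also have "\<dots> < \<infinity>" using fin by (simp add: ennreal_mult_less_top)
  finally have "integrable lborel ?W" by (simp add: integrable_iff_bounded)
  then have tc: "translation_continuous ?W" by (rule translation_continuous_integrable)
  have le: "qint (\<lambda>x. ennreal \<bar>w (x + t) - w x\<bar>) \<le> (\<integral>\<^sup>+x. ennreal \<bar>?W (x + t) - ?W x\<bar> \<partial>lborel)" if "norm t < 1" for t
    unfolding nn_integral_completion
  proof (intro nn_integral_mono)
    fix x :: "real^'n"
    show "ennreal \<bar>w (x + t) - w x\<bar> * indicator unit_cube x \<le> ennreal \<bar>?W (x + t) - ?W x\<bar>"
    proof (cases "x \<in> unit_cube")
      case True
      then have "x \<in> ?B" "x + t \<in> ?B"
        using norm_unit_cube[OF True] norm_triangle_ineq[of x t] that by auto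
      then show ?thesis using True by simp
    qed simp
  qed
  show thesis
  proof (rule ccontr)
    assume neg: "\<not> thesis"
    have "\<forall>n. \<exists>t. norm t < 1 / real (n + 1) \<and> \<not> qint (\<lambda>x. ennreal \<bar>w (x + t) - w x\<bar>) \<le> ennreal e"
    proof (rule allI, rule ccontr)
      fix n assume "\<nexists>t. norm t < 1 / real (n + 1) \<and> \<not> qint (\<lambda>x. ennreal \<bar>w (x + t) - w x\<bar>) \<le> ennreal e"
      then have "qint (\<lambda>x. ennreal \<bar>w (x + t) - w x\<bar>) \<le> ennreal e" if "norm t < 1 / real (n + 1)" for t
        using that by blast
      then have thesis by (intro that[of "1 / real (n + 1)"]) auto
      with neg show False ..
    qed
    from choice[OF this] obtain t where t': "\<forall>n. norm (t n) < 1 / real (n + 1) \<and>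
       \<not> qint (\<lambda>x. ennreal \<bar>w (x + t n) - w x\<bar>) \<le> ennreal e" ..
    then have t: "\<And>n. norm (t n) < 1 / real (n + 1)" "\<And>n. \<not> qint (\<lambda>x. ennreal \<bar>w (x + t n) - w x\<bar>) \<le> ennreal e"
      by blast+
    have "t \<longlonglongrightarrow> 0"
    proof (rule Lim_null_comparison)
      show "\<forall>\<^sub>F n in sequentially. norm (t n) \<le> 1 / real (n + 1)" using t(1) by (simp add: less_imp_le)
      show "(\<lambda>n. 1 / real (n + 1)) \<longlonglongrightarrow> 0" using LIMSEQ_Suc[OF lim_1_over_n] by simp
    qed
    then have "(\<lambda>n. \<integral>\<^sup>+x. ennreal \<bar>?W (x + t n) - ?W x\<bar> \<partial>lborel) \<longlonglongrightarrow> 0"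
      using tc by (simp add: translation_continuous_def)
    then have "\<forall>\<^sub>F n in sequentially. (\<integral>\<^sup>+x. ennreal \<bar>?W (x + t n) - ?W x\<bar> \<partial>lborel) < ennreal e"
      using e by (intro order_tendstoD) auto
    then obtain n where n: "(\<integral>\<^sup>+x. ennreal \<bar>?W (x + t n) - ?W x\<bar> \<partial>lborel) < ennreal e"
      by (auto simp: eventually_sequentially)
    have "1 / real (n + 1) \<le> 1" by simp
    then have "norm (t n) < 1" using t(1)[of n] by linarith
    from le[OF this] n t(2)[of n] show False by auto
  qed
qed

subsection \<open>Trigonometric polynomials and mollification\<close>

text \<open>The phase \<open>c\<close> makes cosines instances of the sine rule and gives closure
  under translation; higher frequencies arise as products. Closure under partial derivatives makes
  every member smooth in the sense of the recursive predicate \<open>Ck\<close>.\<close>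

inductive trig_poly :: "(real^'n \<Rightarrow> real) \<Rightarrow> bool" where
  const: "trig_poly (\<lambda>_. c)"
| sin: "trig_poly (\<lambda>x. sin (2 * pi * x $ i + c))"
| add: "trig_poly f \<Longrightarrow> trig_poly g \<Longrightarrow> trig_poly (\<lambda>x. f x + g x)"
| mult: "trig_poly f \<Longrightarrow> trig_poly g \<Longrightarrow> trig_poly (\<lambda>x. f x * g x)"

lemma trig_poly_cos: "trig_poly (\<lambda>x. cos (2 * pi * x $ i + c))"
  using trig_poly.sin[of i "c + pi / 2"] by (simp add: sin_add cos_add)

lemma trig_poly_has_derivative:
  fixes f :: "real^'n::finite \<Rightarrow> real"
  assumes "trig_poly f"
  obtains f' where "\<And>x. (f has_derivative (\<lambda>h. \<Sum>i\<in>UNIV. f' i x * h $ i)) (at x)" "\<And>i. trig_poly (f' i)"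
proof -
  have "\<exists>f'. (\<forall>x. (f has_derivative (\<lambda>h. \<Sum>i\<in>UNIV. f' i x * h $ i)) (at x)) \<and> (\<forall>i. trig_poly (f' i))"
    using assms
  proof induction
    case (const c)
    show ?case by (rule exI[of _ "\<lambda>_ _. 0"]) (auto intro: trig_poly.const)
  next
    case (sin i c)
    let ?f' = "\<lambda>j x. (if j = i then 2 * pi else 0) * cos (2 * pi * x $ i + c)"
    have "((\<lambda>x. sin (2 * pi * x $ i + c)) has_derivative (\<lambda>h. \<Sum>j\<in>UNIV. ?f' j x * h $ j)) (at x)" for x :: "real^'n"
    proof -
      have "((\<lambda>x. sin (2 * pi * x $ i + c)) has_derivative (\<lambda>h. cos (2 * pi * x $ i + c) * (2 * pi * h $ i))) (at x)"
        by (auto intro!: derivative_eq_intros bounded_linear_imp_has_derivative)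
      moreover have "(\<Sum>j\<in>UNIV. ?f' j x * h $ j) = cos (2 * pi * x $ i + c) * (2 * pi * h $ i)" for h :: "real^'n"
        by (subst sum.remove[of _ i]) auto
      ultimately show ?thesis by simp
    qed
    moreover have "trig_poly (?f' j)" for j
      by (intro trig_poly.mult trig_poly.const trig_poly_cos)
    ultimately show ?case by (intro exI[of _ ?f'] conjI allI)
  next
    case (add f g)
    then obtain f' g' where
      "\<And>x. (f has_derivative (\<lambda>h. \<Sum>i\<in>UNIV. f' i x * h $ i)) (at x)" "\<And>i. trig_poly (f' i)"
      "\<And>x. (g has_derivative (\<lambda>h. \<Sum>i\<in>UNIV. g' i x * h $ i)) (at x)" "\<And>i. trig_poly (g' i)" by blast
    then show ?case
      by (intro exI[of _ "\<lambda>i x. f' i x + g' i x"])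
         (auto intro!: trig_poly.add derivative_eq_intros simp: sum.distrib distrib_right)
  next
    case (mult f g)
    then obtain f' g' where
      d: "\<And>x. (f has_derivative (\<lambda>h. \<Sum>i\<in>UNIV. f' i x * h $ i)) (at x)" "\<And>i. trig_poly (f' i)"
      "\<And>x. (g has_derivative (\<lambda>h. \<Sum>i\<in>UNIV. g' i x * h $ i)) (at x)" "\<And>i. trig_poly (g' i)" by blast
    have "((\<lambda>x. f x * g x) has_derivative (\<lambda>h. \<Sum>i\<in>UNIV. (f x * g' i x + f' i x * g x) * h $ i)) (at x)" for x
      by (rule has_derivative_eq_rhs[OF has_derivative_mult[OF d(1) d(3)]])
         (simp add: fun_eq_iff sum_distrib_left sum_distrib_right sum.distrib[symmetric] algebra_simps)
    then show ?case using d(2,4) mult(1,2)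
      by (intro exI[of _ "\<lambda>i x. f x * g' i x + f' i x * g x"])
         (auto intro!: trig_poly.add trig_poly.mult)
  qed
  then show thesis using that by blast
qed

lemma has_derivative_axis:
  fixes f :: "real^'n::finite \<Rightarrow> real"
  assumes "(f has_derivative (\<lambda>h. \<Sum>i\<in>UNIV. f' i * h $ i)) (at x)"
  shows "partial_deriv i f x = f' i"
proof -
  have "partial_deriv i f x = (\<Sum>j\<in>UNIV. f' j * axis i 1 $ j)"
    using fun_cong[OF frechet_derivative_at[OF assms], of "axis i 1"] by (simp add: partial_deriv_def)
  also have "\<dots> = f' i" by (subst sum.remove[of _ i]) (auto simp: axis_def)
  finally show ?thesis .
qed

lemma trig_poly_partial_deriv: "trig_poly (f :: real^'n::finite \<Rightarrow> real) \<Longrightarrow> trig_poly (partial_deriv i f)"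
proof -
  assume "trig_poly f"
  then obtain f' where f': "\<And>x. (f has_derivative (\<lambda>h. \<Sum>i\<in>UNIV. f' i x * h $ i)) (at x)" "\<And>i. trig_poly (f' i)"
    using trig_poly_has_derivative by blast
  have "partial_deriv i f = f' i" using has_derivative_axis[OF f'(1)] by (simp add: fun_eq_iff)
  then show ?thesis using f'(2) by simp
qed

lemma trig_poly_differentiable: "trig_poly (f :: real^'n::finite \<Rightarrow> real) \<Longrightarrow> f differentiable_on UNIV"
proof -
  assume "trig_poly f"
  then obtain f' where f': "\<And>x. (f has_derivative (\<lambda>h. \<Sum>i\<in>UNIV. f' i x * h $ i)) (at x)"
    using trig_poly_has_derivative by blast
  then show ?thesis unfolding differentiable_on_def by (auto simp: differentiable_def)
qed

lemma trig_poly_continuous: "trig_poly (f :: real^'n::finite \<Rightarrow> real) \<Longrightarrow> continuous_on UNIV f"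
  by (intro differentiable_imp_continuous_on trig_poly_differentiable)

lemma trig_poly_measurable: "trig_poly (f :: real^'n::finite \<Rightarrow> real) \<Longrightarrow> f \<in> borel_measurable borel"
  by (intro borel_measurable_continuous_onI trig_poly_continuous)

lemma smooth_trig_poly: "trig_poly (f :: real^'n::finite \<Rightarrow> real) \<Longrightarrow> smooth f"
proof -
  have "trig_poly f \<Longrightarrow> Ck k f" for k and f :: "real^'n \<Rightarrow> real"
    by (induction k arbitrary: f) (auto intro: trig_poly_continuous trig_poly_differentiable trig_poly_partial_deriv)
  then show "trig_poly f \<Longrightarrow> smooth f" by (simp add: smooth_def)
qed

lemma periodic_trig_poly: "trig_poly f \<Longrightarrow> periodic f"
proof (induction rule: trig_poly.induct)
  case (sin i c)
  show ?case unfolding periodic_def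
  proof (intro allI impI)
    fix x k :: "real^'a" assume "\<forall>i. k $ i \<in> \<int>"
    then have "k $ i \<in> \<int>" by blast
    then obtain m where m: "k $ i = of_int m" by (rule Ints_cases)
    have "2 * pi * (x + k) $ i + c = (2 * pi * x $ i + c) + 2 * pi * of_int m"
      by (simp add: m algebra_simps)
    also have "sin \<dots> = sin (2 * pi * x $ i + c)" using sin.plus_of_int[of "2 * pi * x $ i + c" m]
      by (simp add: sin_add sin_int_2pin cos_int_2pin)
    finally show "sin (2 * pi * (x + k) $ i + c) = sin (2 * pi * x $ i + c)" .
  qed
qed (simp_all add: periodic_def)

lemma trig_poly_translate: "trig_poly f \<Longrightarrow> trig_poly (\<lambda>x. f (x - a))"
proof (induction rule: trig_poly.induct)
  case (sin i c)
  have "(\<lambda>x. sin (2 * pi * (x - a) $ i + c)) = (\<lambda>x. sin (2 * pi * x $ i + (c - 2 * pi * a $ i)))"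
    by (simp add: algebra_simps)
  then show ?case by (simp only: trig_poly.sin)
qed (auto intro: trig_poly.intros)

section \<open>Separable kernels and the differentiation of convolutions\<close>

inductive separable :: "(real^'n \<Rightarrow> real^'n \<Rightarrow> real) \<Rightarrow> bool" where
  prod: "trig_poly c \<Longrightarrow> trig_poly e \<Longrightarrow> separable (\<lambda>x z. c x * e z)"
| add: "separable K \<Longrightarrow> separable L \<Longrightarrow> separable (\<lambda>x z. K x z + L x z)"

lemma separable_scale: "separable K \<Longrightarrow> trig_poly c \<Longrightarrow> trig_poly e \<Longrightarrow> separable (\<lambda>x z. (c x * e z) * K x z)"
proof (induction rule: separable.induct)
  case (prod c' e')
  have "separable (\<lambda>x z. (c x * c' x) * (e z * e' z))"
    by (intro separable.prod trig_poly.mult prod)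
  then show ?case by (simp add: mult_ac)
next
  case (add K L)
  then show ?case by (auto simp: distrib_left intro: separable.add)
qed

lemma separable_mult: "separable K \<Longrightarrow> separable L \<Longrightarrow> separable (\<lambda>x z. K x z * L x z)"
proof (induction rule: separable.induct)
  case (prod c e)
  then show ?case by (intro separable_scale)
next
  case (add K L')
  then show ?case by (auto simp: distrib_right intro: separable.add)
qed

lemma separable_const: "separable (\<lambda>_ _. c)"
  using separable.prod[OF trig_poly.const[of c] trig_poly.const[of 1]] by simp

lemma separable_sum:
  "finite A \<Longrightarrow> (\<And>i. i \<in> A \<Longrightarrow> separable (K i)) \<Longrightarrow> separable (\<lambda>x z. \<Sum>i\<in>A. K i x z)"
  by (induction A rule: finite_induct) (auto intro: separable_const separable.add)

lemma separable_power: "separable K \<Longrightarrow> separable (\<lambda>x z. K x z ^ n)"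
  by (induction n) (auto intro: separable_const separable_mult)

text \<open>Separability lets the convolution of an integrable function with the kernel be
  differentiated without exchanging a limit and an integral.\<close>

lemma separable_convolution_derivative:
  fixes w :: "real^'n::finite \<Rightarrow> real"
  assumes "separable K" and w: "set_integrable lborel unit_cube w"
  obtains K' where "\<And>x z. ((\<lambda>x. K x z) has_derivative (\<lambda>h. \<Sum>i\<in>UNIV. K' i x z * h $ i)) (at x)"
    "\<And>x. ((\<lambda>x. LINT z:unit_cube|lborel. w z * K x z) has_derivative
       (\<lambda>h. \<Sum>i\<in>UNIV. (LINT z:unit_cube|lborel. w z * K' i x z) * h $ i)) (at x)"
proof -
  have int: "set_integrable lborel unit_cube (\<lambda>z. w z * e z)" if "trig_poly e" for e
  proof -
    have "compact (e ` unit_cube)"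
      using trig_poly_continuous[OF that] by (intro compact_continuous_image) (auto intro: continuous_on_subset)
    then obtain B where "\<forall>z\<in>unit_cube. \<bar>e z\<bar> \<le> B"
      by (auto dest!: compact_imp_bounded simp: bounded_iff)
    then have B: "\<And>z. z \<in> unit_cube \<Longrightarrow> \<bar>e z\<bar> \<le> B" by blast
    have [measurable]: "e \<in> borel_measurable borel" using that by (rule trig_poly_measurable)
    have [measurable]: "(\<lambda>z. indicator unit_cube z * w z) \<in> borel_measurable borel"
      using borel_measurable_integrable[OF w[unfolded set_integrable_def]] by simp
    show ?thesis unfolding set_integrable_def
    proof (rule Bochner_Integration.integrable_bound)
      show "integrable lborel (\<lambda>z. B * (indicator unit_cube z *\<^sub>R w z))"
        using w unfolding set_integrable_def by simp
      have "(\<lambda>z. indicator unit_cube z *\<^sub>R (w z * e z)) = (\<lambda>z. (indicator unit_cube z * w z) * e z)" by auto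
      also have "\<dots> \<in> borel_measurable lborel" by measurable
      finally show "(\<lambda>z. indicator unit_cube z *\<^sub>R (w z * e z)) \<in> borel_measurable lborel" .
      show "AE z in lborel. norm (indicator unit_cube z *\<^sub>R (w z * e z)) \<le> norm (B * (indicator unit_cube z *\<^sub>R w z))"
      proof (rule AE_I2)
        fix z :: "real^'n"
        show "norm (indicator unit_cube z *\<^sub>R (w z * e z)) \<le> norm (B * (indicator unit_cube z *\<^sub>R w z))"
        proof (cases "z \<in> unit_cube")
          case True
          then have "\<bar>w z\<bar> * \<bar>e z\<bar> \<le> \<bar>w z\<bar> * \<bar>B\<bar>" using B[OF True] by (intro mult_left_mono) auto
          then show ?thesis using True by (simp add: abs_mult mult.commute)
        qed simp
      qed
    qed
  qed
  have "\<exists>K'. (\<forall>x z. ((\<lambda>x. K x z) has_derivative (\<lambda>h. \<Sum>i\<in>UNIV. K' i x z * h $ i)) (at x)) \<and>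
     (\<forall>x. ((\<lambda>x. LINT z:unit_cube|lborel. w z * K x z) has_derivative
       (\<lambda>h. \<Sum>i\<in>UNIV. (LINT z:unit_cube|lborel. w z * K' i x z) * h $ i)) (at x)) \<and>
     (\<forall>x. set_integrable lborel unit_cube (\<lambda>z. w z * K x z)) \<and>
     (\<forall>i x. set_integrable lborel unit_cube (\<lambda>z. w z * K' i x z))"
    using assms(1)
  proof induction
    case (prod c e)
    then obtain c' where c': "\<And>x. (c has_derivative (\<lambda>h. \<Sum>i\<in>UNIV. c' i x * h $ i)) (at x)" "\<And>i. trig_poly (c' i)"
      using trig_poly_has_derivative by blast
    have c'': "((\<lambda>x. c x * y) has_derivative (\<lambda>h. \<Sum>i\<in>UNIV. (c' i x * y) * h $ i)) (at x)" for x y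
      by (rule has_derivative_eq_rhs[OF has_derivative_mult_left[OF c'(1)]])
         (auto simp: fun_eq_iff sum_distrib_left sum_distrib_right mult_ac)
    have eq: "(LINT z:unit_cube|lborel. w z * (a * e z)) = a * (LINT z:unit_cube|lborel. w z * e z)" for a
      by (simp add: mult.left_commute)
    have int': "set_integrable lborel unit_cube (\<lambda>z. w z * (a * e z))" for a
      using int[OF prod(2)] by (simp add: mult.left_commute)
    show ?case
      by (rule exI[of _ "\<lambda>i x z. c' i x * e z"]) (use c'' int' in \<open>auto simp: eq\<close>)
  next
    case (add K L)
    then obtain K' L' where
      K': "\<And>x z. ((\<lambda>x. K x z) has_derivative (\<lambda>h. \<Sum>i\<in>UNIV. K' i x z * h $ i)) (at x)"
       "\<And>x. ((\<lambda>x. LINT z:unit_cube|lborel. w z * K x z) has_derivative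
         (\<lambda>h. \<Sum>i\<in>UNIV. (LINT z:unit_cube|lborel. w z * K' i x z) * h $ i)) (at x)"
       "\<And>x. set_integrable lborel unit_cube (\<lambda>z. w z * K x z)"
       "\<And>i x. set_integrable lborel unit_cube (\<lambda>z. w z * K' i x z)" and
      L': "\<And>x z. ((\<lambda>x. L x z) has_derivative (\<lambda>h. \<Sum>i\<in>UNIV. L' i x z * h $ i)) (at x)"
       "\<And>x. ((\<lambda>x. LINT z:unit_cube|lborel. w z * L x z) has_derivative
         (\<lambda>h. \<Sum>i\<in>UNIV. (LINT z:unit_cube|lborel. w z * L' i x z) * h $ i)) (at x)"
       "\<And>x. set_integrable lborel unit_cube (\<lambda>z. w z * L x z)"
       "\<And>i x. set_integrable lborel unit_cube (\<lambda>z. w z * L' i x z)" by blast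
    have 1: "((\<lambda>x. K x z + L x z) has_derivative (\<lambda>h. \<Sum>i\<in>UNIV. (K' i x z + L' i x z) * h $ i)) (at x)" for x z
      by (rule has_derivative_eq_rhs[OF has_derivative_add[OF K'(1) L'(1)]]) (simp add: distrib_right sum.distrib)
    have eq: "(LINT z:unit_cube|lborel. w z * (K x z + L x z)) =
      (LINT z:unit_cube|lborel. w z * K x z) + (LINT z:unit_cube|lborel. w z * L x z)" for x
      using set_integral_add(2)[OF K'(3) L'(3)] by (simp add: distrib_left)
    have eq': "(LINT z:unit_cube|lborel. w z * (K' i x z + L' i x z)) =
      (LINT z:unit_cube|lborel. w z * K' i x z) + (LINT z:unit_cube|lborel. w z * L' i x z)" for i x
      using set_integral_add(2)[OF K'(4) L'(4)] by (simp add: distrib_left)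
    have 2: "((\<lambda>x. LINT z:unit_cube|lborel. w z * (K x z + L x z)) has_derivative
         (\<lambda>h. \<Sum>i\<in>UNIV. (LINT z:unit_cube|lborel. w z * (K' i x z + L' i x z)) * h $ i)) (at x)" for x
      unfolding eq eq'
      by (rule has_derivative_eq_rhs[OF has_derivative_add[OF K'(2) L'(2)]]) (simp add: distrib_right sum.distrib)
    have 3: "set_integrable lborel unit_cube (\<lambda>z. w z * (K x z + L x z))" for x
      using set_integral_add(1)[OF K'(3) L'(3)] by (simp add: distrib_left)
    have 4: "set_integrable lborel unit_cube (\<lambda>z. w z * (K' i x z + L' i x z))" for i x
      using set_integral_add(1)[OF K'(4) L'(4)] by (simp add: distrib_left)
    show ?case
      by (rule exI[of _ "\<lambda>i x z. K' i x z + L' i x z"]) (use 1 2 3 4 in auto)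
  qed
  then show thesis using that by blast
qed

text \<open>A mean of the functions cos^2(\<pi> x_i). It takes values in [0, 1] and reaches 1
  exactly on the lattice, so its powers concentrate there. The addition theorem for the cosine makes
  \<open>bump (z - x)\<close> separable, and hence also its powers.\<close>

definition bump :: "real^'n \<Rightarrow> real" where
  "bump x = (\<Sum>i\<in>UNIV. (1 + cos (2 * pi * x $ i)) / 2) / real CARD('n)"

lemma trig_poly_sum: "finite A \<Longrightarrow> (\<And>i. i \<in> A \<Longrightarrow> trig_poly (f i)) \<Longrightarrow> trig_poly (\<lambda>x. \<Sum>i\<in>A. f i x)"
  by (induction A rule: finite_induct) (auto intro: trig_poly.intros)

lemma trig_poly_power: "trig_poly f \<Longrightarrow> trig_poly (\<lambda>x. f x ^ n)"
  by (induction n) (auto intro: trig_poly.intros)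

lemma trig_poly_bump: "trig_poly (bump :: real^'n::finite \<Rightarrow> real)"
proof -
  have "trig_poly (\<lambda>x::real^'n. (\<Sum>i\<in>UNIV. (1 + cos (2 * pi * x $ i + 0)) * (1/2)) * (1 / real CARD('n)))"
    by (intro trig_poly.mult trig_poly_sum trig_poly.add trig_poly.const trig_poly_cos) auto
  then show ?thesis by (simp add: bump_def[abs_def])
qed

lemma separable_bump: "separable (\<lambda>(x :: real^'n::finite) z. bump (z - x))"
proof -
  have cs: "cos (2 * pi * (z - x) $ i) = cos (2 * pi * x $ i + 0) * cos (2 * pi * z $ i + 0) + sin (2 * pi * x $ i + 0) * sin (2 * pi * z $ i + 0)" for x z :: "real^'n" and i
    by (simp add: right_diff_distrib cos_diff)
  have "separable (\<lambda>x z::real^'n. (1 / (2 * real CARD('n))) * (\<Sum>i\<in>UNIV. 1 + (cos (2 * pi * x $ i + 0) * cos (2 * pi * z $ i + 0) + sin (2 * pi * x $ i + 0) * sin (2 * pi * z $ i + 0))))"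
    by (intro separable_mult separable_const separable_sum separable.add separable.prod trig_poly_cos trig_poly.sin) auto
  then show ?thesis
    unfolding bump_def cs[symmetric] by (simp add: sum_divide_distrib[symmetric])
qed

lemma bump_bounds: "0 \<le> bump x" "bump x \<le> 1" for x :: "real^'n::finite"
proof -
  have "0 \<le> (1 + cos t) / 2" for t :: real
    by (rule divide_nonneg_pos) (use cos_ge_minus_one[of t] in linarith, simp)
  then show "0 \<le> bump x"
    unfolding bump_def by (intro divide_nonneg_nonneg sum_nonneg) simp_all
  have "(\<Sum>i\<in>UNIV. (1 + cos (2 * pi * x $ i)) / 2) \<le> (\<Sum>i\<in>(UNIV::'n set). 1)"
    by (intro sum_mono) simp
  then show "bump x \<le> 1" unfolding bump_def by simp
qed

lemma bump_eq_1D: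
  fixes x :: "real^'n::finite"
  assumes "bump x = 1" shows "x \<in> lattice"
proof -
  have "(\<Sum>i\<in>UNIV. 1 - (1 + cos (2 * pi * x $ i)) / 2) = 0"
    using assms by (simp add: bump_def sum_subtractf)
  then have *: "1 - (1 + cos (2 * pi * x $ i)) / 2 = 0" for i
    by (subst (asm) sum_nonneg_eq_0_iff) auto
  have "x $ i \<in> \<int>" for i
  proof -
    have "cos (2 * pi * x $ i) = 1" using *[of i] by simp
    then obtain n :: int where "2 * pi * x $ i = n * 2 * pi" by (auto simp: cos_one_2pi_int)
    then show ?thesis by simp
  qed
  then show ?thesis by (simp add: lattice_def)
qed

lemma bump_0: "bump (0 :: real^'n::finite) = 1" by (simp add: bump_def)

lemma bump_measurable [measurable]: "bump \<in> borel_measurable (borel :: (real^'n::finite) measure)"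
  by (rule trig_poly_measurable[OF trig_poly_bump])

lemma box_0_1_nonempty: "box 0 1 \<noteq> ({} :: (real^'n::finite) set)"
proof -
  have "(\<chi> i. 1/2) \<in> (box 0 1 :: (real^'n) set)" by (simp add: mem_box_cart)
  then show ?thesis by blast
qed

definition bump_mass :: "'n::finite itself \<Rightarrow> nat \<Rightarrow> real" where
  "bump_mass _ n = enn2real (\<integral>\<^sup>+x\<in>unit_cube. ennreal (bump (x :: real^'n) ^ n) \<partial>lborel)"

text \<open>Near 0 the bump exceeds \<open>m\<close>. Since 0 is a corner of the cube, it is not
  interior, but it lies in the closure of the open box, so the part of the cube close to it is not
  null. Its measure \<open>c\<close> does not depend on \<open>n\<close>.\<close>

lemma bump_near_0:
  assumes "m < 1"
  obtains c where "c > 0" "\<And>n. 0 \<le> m \<Longrightarrow> ennreal (m ^ n * c) \<le> (\<integral>\<^sup>+x\<in>unit_cube. ennreal (bump (x :: real^'n::finite) ^ n) \<partial>lborel)"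
proof -
  have "continuous (at 0) (bump :: real^'n \<Rightarrow> real)"
    using trig_poly_continuous[OF trig_poly_bump[where 'n='n]] by (simp add: continuous_on_eq_continuous_at)
  then have "\<exists>\<eta>>0. \<forall>x::real^'n. dist x 0 < \<eta> \<longrightarrow> dist (bump x) (bump (0::real^'n)) < 1 - m"
    unfolding continuous_at_eps_delta by (elim allE[of _ "1 - m"]) (simp add: assms)
  then obtain \<eta> where \<eta>: "\<eta> > 0" "\<And>x::real^'n. dist x 0 < \<eta> \<Longrightarrow> dist (bump x) (bump (0::real^'n)) < 1 - m"
    by blast
  let ?S = "box 0 1 \<inter> ball (0::real^'n) \<eta>"
  have "(0::real^'n) \<in> closure (box 0 1)"
    unfolding closure_box[OF box_0_1_nonempty] by (simp add: mem_box_cart)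
  then have "0 \<in> ball (0::real^'n) \<eta> \<inter> closure (box 0 1)" using \<eta>(1) by simp
  then have "?S \<noteq> {}"
    using open_Int_closure_eq_empty[of "ball (0::real^'n) \<eta>" "box 0 1"] by (metis Int_commute empty_iff open_ball)
  then have "\<not> negligible ?S" by (intro open_not_negligible) auto
  then have pos: "emeasure lborel ?S \<noteq> 0"
    by (auto simp: negligible_iff_emeasure0)
  have "emeasure lborel ?S \<le> emeasure lborel (unit_cube :: (real^'n) set)"
    by (intro emeasure_mono) (auto simp: box_subset_cbox[THEN subsetD])
  then have "emeasure lborel ?S \<le> 1" by (simp add: emeasure_unit_cube)
  then obtain c where c: "emeasure lborel ?S = ennreal c" "c \<ge> 0"
    by (cases "emeasure lborel ?S") (auto simp: top_unique)
  with pos have "c > 0" by (cases "c = 0") auto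
  show thesis
  proof (rule that[OF \<open>c > 0\<close>])
    fix n :: nat assume m: "0 \<le> m"
    have "ennreal (m ^ n * c) = (\<integral>\<^sup>+x\<in>?S. ennreal (m ^ n) \<partial>lborel)"
      using m c by (simp add: nn_integral_cmult_indicator ennreal_mult)
    also have "\<dots> \<le> (\<integral>\<^sup>+x\<in>unit_cube. ennreal (bump (x :: real^'n) ^ n) \<partial>lborel)"
    proof (intro nn_integral_mono)
      fix x :: "real^'n"
      show "ennreal (m ^ n) * indicator ?S x \<le> ennreal (bump x ^ n) * indicator unit_cube x"
      proof (cases "x \<in> ?S")
        case True
        then have "dist (bump x) (bump (0::real^'n)) < 1 - m" by (intro \<eta>(2)) (simp add: dist_commute)
        then have "m \<le> bump x" using bump_0[where 'n='n] by (auto simp: dist_real_def)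
        then have "m ^ n \<le> bump x ^ n" using m by (intro power_mono)
        moreover have "x \<in> unit_cube" using True box_subset_cbox by auto
        ultimately show ?thesis by (simp add: indicator_def ennreal_leI)
      qed simp
    qed
    finally show "ennreal (m ^ n * c) \<le> \<dots>" .
  qed
qed

lemma bump_mass:
  "bump_mass TYPE('n) n > 0"
  "(\<integral>\<^sup>+x\<in>unit_cube. ennreal (bump (x :: real^'n::finite) ^ n) \<partial>lborel) = ennreal (bump_mass TYPE('n) n)"
proof -
  let ?I = "(\<integral>\<^sup>+x\<in>unit_cube. ennreal (bump (x :: real^'n) ^ n) \<partial>lborel)"
  have "?I \<le> (\<integral>\<^sup>+x. indicator (unit_cube :: (real^'n) set) x \<partial>lborel)"
    by (intro nn_integral_mono) (auto simp: indicator_def bump_bounds power_le_one)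
  also have "\<dots> = 1" by (simp add: emeasure_unit_cube)
  finally have "?I < top" by (simp add: le_less_trans[OF _ ennreal_one_less_top])
  then show eq: "?I = ennreal (bump_mass TYPE('n) n)" by (simp add: bump_mass_def)
  obtain c where c: "c > 0" "\<And>n. ennreal ((1/2) ^ n * c) \<le> (\<integral>\<^sup>+x\<in>unit_cube. ennreal (bump (x :: real^'n) ^ n) \<partial>lborel)"
    using bump_near_0[of "1/2", where 'n='n] by auto
  have "0 < ennreal ((1/2) ^ n * c)" using c(1) by simp
  also have "\<dots> \<le> ennreal (bump_mass TYPE('n) n)" using c(2)[of n] eq by simp
  finally show "bump_mass TYPE('n) n > 0" by simp
qed

text \<open>On the torus, the complement of the ball of radius \<delta> about 0.\<close>

definition far :: "real \<Rightarrow> (real^'n) set" where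
  "far \<delta> = {t. \<forall>l\<in>lattice. \<delta> \<le> norm (t - l)}"

lemma closed_far: "closed (far \<delta> :: (real^'n::finite) set)"
proof -
  have "far \<delta> = (\<Inter>l\<in>lattice. {t::real^'n. \<delta> \<le> norm (t - l)})" by (auto simp: far_def)
  also have "closed \<dots>" by (intro closed_INT ballI closed_Collect_le continuous_intros)
  finally show ?thesis .
qed

text \<open>On the compact far part of the cube the bump is at most some \<open>m < 1\<close>, so
  its power contributes at most \<open>m ^ n\<close>, while the total mass is at least
  \<open>c * m' ^ n\<close> for a number \<open>m'\<close> strictly between \<open>m\<close> and 1.
  The quotient tends to 0.\<close>

lemma bump_concentration:
  assumes "\<delta> > 0" "e > 0"
  shows "\<forall>\<^sub>F n in sequentially. (\<integral>\<^sup>+x\<in>unit_cube \<inter> far \<delta>. ennreal (bump (x :: real^'n::finite) ^ n) \<partial>lborel) \<le>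
     ennreal (e * bump_mass TYPE('n) n)"
proof (cases "unit_cube \<inter> far \<delta> = ({} :: (real^'n) set)")
  case True
  then show ?thesis by simp
next
  case False
  have "compact (unit_cube \<inter> far \<delta> :: (real^'n) set)" by (intro compact_Int_closed compact_cbox closed_far)
  from continuous_attains_sup[OF this False continuous_on_subset[OF trig_poly_continuous[OF trig_poly_bump] subset_UNIV]]
  obtain p :: "real^'n" where p: "p \<in> unit_cube \<inter> far \<delta>" "\<forall>x::real^'n\<in>unit_cube \<inter> far \<delta>. bump x \<le> bump p" by (elim bexE) (rule that)
  define m where "m = bump p"
  have "p \<notin> lattice" using p(1) assms(1) by (auto simp: far_def)
  then have m: "0 \<le> m" "m < 1" using bump_eq_1D[of p] bump_bounds[of p] by (auto simp: m_def less_le)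
  define m' where "m' = (1 + m) / 2"
  have m': "m < m'" "m' < 1" "0 < m'" using m by (auto simp: m'_def)
  obtain c where c: "c > 0" "\<And>n. ennreal (m' ^ n * c) \<le> (\<integral>\<^sup>+x\<in>unit_cube. ennreal (bump (x :: real^'n) ^ n) \<partial>lborel)"
    using bump_near_0[OF m'(2), where 'n='n] m'(3) by (auto simp: less_imp_le)
  have "(\<lambda>n. (m / m') ^ n) \<longlonglongrightarrow> 0" using m m' by (intro LIMSEQ_realpow_zero) auto
  then have "\<forall>\<^sub>F n in sequentially. (m / m') ^ n < e * c"
    using assms(2) c(1) by (intro order_tendstoD) auto
  then show ?thesis
  proof eventually_elim
    case (elim n)
    then have "m ^ n \<le> e * (m' ^ n * c)"
      using m' by (simp add: power_divide field_simps)
    also have "m' ^ n * c \<le> bump_mass TYPE('n) n"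
      using c(2)[of n] bump_mass[of n, where 'n='n] by simp
    finally have le: "m ^ n \<le> e * bump_mass TYPE('n) n" using assms(2) by simp
    have "(\<integral>\<^sup>+x\<in>unit_cube \<inter> far \<delta>. ennreal (bump (x :: real^'n) ^ n) \<partial>lborel) \<le>
       (\<integral>\<^sup>+x\<in>(unit_cube :: (real^'n) set). ennreal (m ^ n) \<partial>lborel)"
    proof (intro nn_integral_mono)
      fix x :: "real^'n"
      show "ennreal (bump x ^ n) * indicator (unit_cube \<inter> far \<delta>) x \<le> ennreal (m ^ n) * indicator unit_cube x"
      proof (cases "x \<in> unit_cube \<inter> far \<delta>")
        case True
        then have "bump x ^ n \<le> m ^ n" using p(2) bump_bounds unfolding m_def by (intro power_mono) blast+
        then show ?thesis using True by (auto simp: indicator_def ennreal_leI)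
      qed simp
    qed
    also have "\<dots> = ennreal (m ^ n)" by (simp add: nn_integral_cmult_indicator emeasure_unit_cube)
    also have "\<dots> \<le> ennreal (e * bump_mass TYPE('n) n)" using le by (rule ennreal_leI)
    finally show ?case .
  qed
qed

text \<open>Convolution with an approximate identity on the torus whose kernels are nonnegative
  trigonometric polynomials of integral 1 over the cube. In dimension one they are the de la Vallee
  Poussin kernels.\<close>

definition mollify :: "nat \<Rightarrow> (real^'n \<Rightarrow> real) \<Rightarrow> real^'n \<Rightarrow> real" where
  "mollify n w x = (LINT z:unit_cube|lborel. w z * (bump (z - x) ^ n / bump_mass TYPE('n) n))"

section \<open>Convergence of the mollifications and of their gradients\<close>

lemma qint_lborel: "qint f = (\<integral>\<^sup>+x\<in>unit_cube. f x \<partial>lborel)"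
  by (rule nn_integral_completion)

lemma borel_measurable_lebesgueI: "f \<in> borel_measurable borel \<Longrightarrow> f \<in> borel_measurable lebesgue"
  by (intro measurable_completion) simp

lemma periodic_nn_integral_translation_borel:
  fixes f :: "real^'n::finite \<Rightarrow> ennreal"
  assumes "f \<in> borel_measurable borel" and per: "periodic f"
  shows "(\<integral>\<^sup>+x\<in>unit_cube. f (x + t) \<partial>lborel) = (\<integral>\<^sup>+x\<in>unit_cube. f x \<partial>lborel)"
  using periodic_nn_integral_translation[OF borel_measurable_lebesgueI[OF assms(1)] per, of t]
  unfolding qint_lborel .

lemma periodic_bump: "periodic (bump :: real^'n::finite \<Rightarrow> real)"
  by (rule periodic_trig_poly[OF trig_poly_bump])

lemma set_integrable_periodic:
  fixes w :: "real^'n::finite \<Rightarrow> real"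
  assumes [measurable]: "w \<in> borel_measurable borel" and fin: "qint (\<lambda>x. ennreal \<bar>w x\<bar>) < \<infinity>"
  shows "set_integrable lborel unit_cube w"
  unfolding set_integrable_def integrable_iff_bounded
proof safe
  have "(\<integral>\<^sup>+x. ennreal (norm (indicator unit_cube x *\<^sub>R w x)) \<partial>lborel) = qint (\<lambda>x. ennreal \<bar>w x\<bar>)"
    unfolding qint_lborel by (intro nn_integral_cong) (simp add: indicator_def)
  then show "(\<integral>\<^sup>+x. ennreal (norm (indicator unit_cube x *\<^sub>R w x)) \<partial>lborel) < \<infinity>" using fin by simp
qed simp

text \<open>The kernel has integral 1 over every translate of the cube, so the difference is an
  average of \<open>w z - w x\<close>. Periodicity allows the substitution z = x + t without moving
  the domain of integration.\<close>

lemma mollify_diff_le: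
  fixes w :: "real^'n::finite \<Rightarrow> real"
  assumes [measurable]: "w \<in> borel_measurable borel" and per: "periodic w"
    and fin: "qint (\<lambda>x. ennreal \<bar>w x\<bar>) < \<infinity>"
  shows "ennreal \<bar>mollify n w x - w x\<bar> \<le>
    (\<integral>\<^sup>+t\<in>unit_cube. ennreal \<bar>w (x + t) - w x\<bar> * ennreal (bump t ^ n / bump_mass TYPE('n) n) \<partial>lborel)"
proof -
  let ?Z = "bump_mass TYPE('n) n"
  let ?k = "\<lambda>z::real^'n. bump z ^ n / ?Z"
  have Z: "?Z > 0" by (rule bump_mass)
  have k: "0 \<le> ?k z" "?k z \<le> 1 / ?Z" for z
    using Z by (auto simp: bump_bounds power_le_one divide_right_mono)
  have kper: "periodic (\<lambda>z. f (?k z))" for f :: "real \<Rightarrow> 'b"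
    using periodic_bump[where 'n='n] by (simp add: periodic_def)
  have int1: "(\<integral>\<^sup>+z\<in>unit_cube. ennreal (?k (z - x)) \<partial>lborel) = 1"
  proof -
    have "(\<integral>\<^sup>+z\<in>unit_cube. ennreal (?k (z - x)) \<partial>lborel) = (\<integral>\<^sup>+z\<in>unit_cube. ennreal (?k z) \<partial>lborel)"
      using periodic_nn_integral_translation_borel[of "\<lambda>z. ennreal (?k z)" "- x"] kper[of ennreal] by simp
    also have "\<dots> = (\<integral>\<^sup>+z. ennreal (1 / ?Z) * (ennreal (bump (z :: real^'n) ^ n) * indicator unit_cube z) \<partial>lborel)"
      using Z by (intro nn_integral_cong) (auto simp: ennreal_mult[symmetric] bump_bounds indicator_def)
    also have "\<dots> = ennreal (1 / ?Z) * ennreal ?Z"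
      by (subst nn_integral_cmult) (simp_all add: bump_mass)
    also have "\<dots> = 1" using Z by (simp add: ennreal_mult[symmetric])
    finally show ?thesis .
  qed
  have bnd: "set_integrable lborel unit_cube (\<lambda>z. g z * ?k (z - x))"
    if g: "set_integrable lborel unit_cube g" and [measurable]: "g \<in> borel_measurable borel" for g
    unfolding set_integrable_def
  proof (rule Bochner_Integration.integrable_bound)
    show "integrable lborel (\<lambda>z. (1 / ?Z) * (indicator unit_cube z *\<^sub>R g z))"
      using g unfolding set_integrable_def by (rule integrable_mult_right)
    show "AE z in lborel. norm (indicator unit_cube z *\<^sub>R (g z * ?k (z - x))) \<le> norm ((1 / ?Z) * (indicator unit_cube z *\<^sub>R g z))"
    proof (rule AE_I2)
      fix z :: "real^'n"
      have "\<bar>g z\<bar> * ?k (z - x) \<le> \<bar>g z\<bar> * (1 / ?Z)" by (intro mult_left_mono k) auto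
      then show "norm (indicator unit_cube z *\<^sub>R (g z * ?k (z - x))) \<le> norm ((1 / ?Z) * (indicator unit_cube z *\<^sub>R g z))"
        using Z by (auto simp: abs_mult indicator_def bump_bounds)
    qed
  qed measurable
  have wi: "set_integrable lborel unit_cube w" by (rule set_integrable_periodic) (use fin in auto)
  have one: "set_integrable lborel unit_cube (\<lambda>_::real^'n. w x)"
    by (rule set_integrable_periodic) (auto simp: nn_integral_cmult_indicator emeasure_unit_cube)
  have lint1: "(LINT z:unit_cube|lborel. ?k (z - x)) = 1"
  proof -
    have "(LINT z:unit_cube|lborel. ?k (z - x)) = enn2real (\<integral>\<^sup>+z. ennreal (indicator unit_cube z *\<^sub>R ?k (z - x)) \<partial>lborel)"
      unfolding set_lebesgue_integral_def by (rule integral_eq_nn_integral) (use k in \<open>auto simp: indicator_def\<close>)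
    also have "(\<integral>\<^sup>+z. ennreal (indicator unit_cube z *\<^sub>R ?k (z - x)) \<partial>lborel) = (\<integral>\<^sup>+z\<in>unit_cube. ennreal (?k (z - x)) \<partial>lborel)"
      by (intro nn_integral_cong) (simp add: indicator_def)
    finally show ?thesis by (simp add: int1)
  qed
  have "mollify n w x - w x = (LINT z:unit_cube|lborel. w z * ?k (z - x)) - (LINT z:unit_cube|lborel. w x * ?k (z - x))"
    by (simp only: mollify_def set_integral_mult_right lint1 mult_1_right)
  also have "\<dots> = (LINT z:unit_cube|lborel. w z * ?k (z - x) - w x * ?k (z - x))"
    by (rule set_integral_diff(2)[symmetric]) (intro bnd wi one, simp)+
  also have "\<dots> = (LINT z:unit_cube|lborel. (w z - w x) * ?k (z - x))"
    by (simp only: left_diff_distrib)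
  finally have eq: "mollify n w x - w x = (LINT z:unit_cube|lborel. (w z - w x) * ?k (z - x))" .
  have wd: "set_integrable lborel unit_cube (\<lambda>z. (w z - w x) * ?k (z - x))"
    by (rule bnd) (use set_integral_diff(1)[OF wi one] in auto)
  have "ennreal \<bar>mollify n w x - w x\<bar> \<le> (\<integral>\<^sup>+z. ennreal (norm (indicator unit_cube z *\<^sub>R ((w z - w x) * ?k (z - x)))) \<partial>lborel)"
    unfolding eq set_lebesgue_integral_def real_norm_def[symmetric]
    by (rule integral_norm_bound_ennreal) (use wd in \<open>simp add: set_integrable_def\<close>)
  also have "\<dots> = (\<integral>\<^sup>+z\<in>unit_cube. ennreal \<bar>w (x + (z - x)) - w x\<bar> * ennreal (?k (z - x)) \<partial>lborel)"
  proof (intro nn_integral_cong)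
    fix z
    have "\<bar>?k (z - x)\<bar> = ?k (z - x)" by (rule abs_of_nonneg[OF k(1)])
    then have "norm ((w z - w x) * ?k (z - x)) = \<bar>w z - w x\<bar> * ?k (z - x)"
      by (simp only: real_norm_def abs_mult)
    then have "ennreal (norm ((w z - w x) * ?k (z - x))) = ennreal \<bar>w z - w x\<bar> * ennreal (?k (z - x))"
      by (simp only: ennreal_mult[OF abs_ge_zero k(1)])
    then show "ennreal (norm (indicator unit_cube z *\<^sub>R ((w z - w x) * ?k (z - x)))) =
        ennreal \<bar>w (x + (z - x)) - w x\<bar> * ennreal (?k (z - x)) * indicator unit_cube z"
      by (cases "z \<in> unit_cube") (simp only: indicator_simps scaleR_one mult_1_right add.commute[of x] diff_add_cancel, simp)
  qed
  also have "\<dots> = (\<integral>\<^sup>+t\<in>unit_cube. ennreal \<bar>w (x + t) - w x\<bar> * ennreal (?k t) \<partial>lborel)"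
  proof -
    have "periodic (\<lambda>t. ennreal \<bar>w (x + t) - w x\<bar> * ennreal (?k t))"
      using per periodic_bump[where 'n='n] by (simp add: periodic_def add.assoc[symmetric])
    from periodic_nn_integral_translation_borel[OF _ this, of "-x"] show ?thesis by simp
  qed
  finally show ?thesis .
qed

text \<open>After Tonelli the error is the L^1 modulus of translation averaged against the kernel.
  Shifts close to the lattice have a small modulus by periodicity and continuity of translations;
  for the others the modulus is at most twice the norm, and the kernel puts little mass on
  them.\<close>

lemma mollify_L1:
  fixes w :: "real^'n::finite \<Rightarrow> real"
  assumes [measurable]: "w \<in> borel_measurable borel" and per: "periodic w"
    and fin: "qint (\<lambda>x. ennreal \<bar>w x\<bar>) < \<infinity>" and e: "e > 0"
  shows "\<forall>\<^sub>F n in sequentially. qint (\<lambda>x. ennreal \<bar>mollify n w x - w x\<bar>) \<le> ennreal e"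
proof -
  obtain A where A: "qint (\<lambda>x. ennreal \<bar>w x\<bar>) = ennreal A" "A \<ge> 0"
    using fin by (cases "qint (\<lambda>x. ennreal \<bar>w x\<bar>)") auto
  obtain \<delta> where \<delta>: "0 < \<delta>" "\<And>t. norm t < \<delta> \<Longrightarrow> qint (\<lambda>x. ennreal \<bar>w (x + t) - w x\<bar>) \<le> ennreal (e/2)"
    using periodic_translation_continuity[OF assms(1-3), of "e/2"] e by auto
  \<comment> \<open>Chosen so that the far shifts cost at most \<open>2 * A * e1\<close>, which is
    below \<open>e / 2\<close>; adding 1 keeps the denominator positive when the norm
    \<open>A\<close> is 0.\<close>
  define e1 where "e1 = e / (4 * (A + 1))"
  have e1: "e1 > 0" using e A(2) by (simp add: e1_def)
  have e1': "2 * A * e1 \<le> e / 2" using e A(2) by (simp add: e1_def field_simps)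
  let ?\<omega> = "\<lambda>t. (\<integral>\<^sup>+x\<in>unit_cube. ennreal \<bar>w (x + t) - w x\<bar> \<partial>lborel)"
  have \<omega>_far: "?\<omega> t \<le> ennreal (2 * A)" for t
  proof -
    have "?\<omega> t \<le> (\<integral>\<^sup>+x. ennreal \<bar>w (x + t)\<bar> * indicator unit_cube x + ennreal \<bar>w x\<bar> * indicator unit_cube x \<partial>lborel)"
      by (intro nn_integral_mono) (auto simp: indicator_def simp flip: ennreal_plus intro!: ennreal_leI)
    also have "\<dots> = (\<integral>\<^sup>+x\<in>unit_cube. ennreal \<bar>w (x + t)\<bar> \<partial>lborel) + (\<integral>\<^sup>+x\<in>unit_cube. ennreal \<bar>w x\<bar> \<partial>lborel)"
      by (rule nn_integral_add) auto
    also have "(\<integral>\<^sup>+x\<in>unit_cube. ennreal \<bar>w (x + t)\<bar> \<partial>lborel) = (\<integral>\<^sup>+x\<in>unit_cube. ennreal \<bar>w x\<bar> \<partial>lborel)"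
      using per by (intro periodic_nn_integral_translation_borel[of "\<lambda>x. ennreal \<bar>w x\<bar>"]) (auto simp: periodic_def)
    also have "(\<integral>\<^sup>+x\<in>unit_cube. ennreal \<bar>w x\<bar> \<partial>lborel) = ennreal A" using A(1) by (simp add: qint_lborel)
    finally show ?thesis using A(2) by (simp flip: ennreal_plus)
  qed
  have \<omega>_near: "?\<omega> t \<le> ennreal (e/2)" if t: "t \<notin> far \<delta>" for t
  proof -
    obtain l where l: "l \<in> lattice" "norm (t - l) < \<delta>" using t by (auto simp: far_def not_le)
    have "w (x + t) = w (x + (t - l))" for x
      using periodic_diff[OF per l(1), of "x + t"] by (simp add: add_diff_eq)
    then show ?thesis using \<delta>(2)[OF l(2)] by (simp add: qint_lborel)
  qed
  have [measurable]: "(far \<delta> :: (real^'n) set) \<in> sets borel" using closed_far by (rule borel_closed)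
  from bump_concentration[OF \<delta>(1) e1, where 'n='n] show ?thesis
  proof eventually_elim
    case (elim n)
    let ?Z = "bump_mass TYPE('n) n"
    let ?k = "\<lambda>z::real^'n. bump z ^ n / ?Z"
    have Z: "?Z > 0" by (rule bump_mass)
    have kI: "(\<integral>\<^sup>+t\<in>E. ennreal (?k t) \<partial>lborel) = ennreal (1 / ?Z) * (\<integral>\<^sup>+t\<in>E. ennreal (bump t ^ n) \<partial>lborel)"
      if [measurable]: "E \<in> sets borel" for E
      using Z by (subst nn_integral_cmult[symmetric]) (auto intro!: nn_integral_cong simp: ennreal_mult[symmetric] bump_bounds indicator_def)
    have Z1: "ennreal (1 / ?Z) * ennreal ?Z = 1" using Z by (simp add: ennreal_mult[symmetric])
    have k1: "(\<integral>\<^sup>+t\<in>unit_cube. ennreal (?k t) \<partial>lborel) = 1"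
      by (subst kI) (simp_all only: bump_mass Z1 borel_closed[OF closed_cbox])
    have k2: "(\<integral>\<^sup>+t\<in>unit_cube \<inter> far \<delta>. ennreal (?k t) \<partial>lborel) \<le> ennreal e1"
    proof -
      have "(\<integral>\<^sup>+t\<in>unit_cube \<inter> far \<delta>. ennreal (?k t) \<partial>lborel) \<le> ennreal (1 / ?Z) * ennreal (e1 * ?Z)"
        by (subst kI) (auto intro!: mult_left_mono elim)
      also have "\<dots> = ennreal e1" using Z e1 by (simp add: ennreal_mult[symmetric])
      finally show ?thesis .
    qed
    have "qint (\<lambda>x. ennreal \<bar>mollify n w x - w x\<bar>) \<le>
        (\<integral>\<^sup>+x\<in>unit_cube. (\<integral>\<^sup>+t\<in>unit_cube. ennreal \<bar>w (x + t) - w x\<bar> * ennreal (?k t) \<partial>lborel) \<partial>lborel)"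
      unfolding qint_lborel by (intro nn_integral_mono mult_right_mono mollify_diff_le[OF assms(1-3)]) auto
    also have "\<dots> = (\<integral>\<^sup>+x. (\<integral>\<^sup>+t. ennreal \<bar>w (x + t) - w x\<bar> * ennreal (?k t) * indicator unit_cube t * indicator unit_cube x \<partial>lborel) \<partial>lborel)"
      by (subst nn_integral_multc) auto
    also have "\<dots> = (\<integral>\<^sup>+t. (\<integral>\<^sup>+x. ennreal \<bar>w (x + t) - w x\<bar> * ennreal (?k t) * indicator unit_cube t * indicator unit_cube x \<partial>lborel) \<partial>lborel)"
      by (rule lborel_pair.Fubini') measurable
    also have "\<dots> = (\<integral>\<^sup>+t. (\<integral>\<^sup>+x. (ennreal (?k t) * indicator unit_cube t) * (ennreal \<bar>w (x + t) - w x\<bar> * indicator unit_cube x) \<partial>lborel) \<partial>lborel)"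
      by (simp add: mult_ac)
    also have "\<dots> = (\<integral>\<^sup>+t. (ennreal (?k t) * indicator unit_cube t) * ?\<omega> t \<partial>lborel)"
      by (subst nn_integral_cmult) auto
    also have "\<dots> \<le> (\<integral>\<^sup>+t. ennreal (e/2) * (ennreal (?k t) * indicator unit_cube t) + ennreal (2 * A) * (ennreal (?k t) * indicator (unit_cube \<inter> far \<delta>) t) \<partial>lborel)"
    proof (rule nn_integral_mono)
      fix t :: "real^'n"
      show "(ennreal (?k t) * indicator unit_cube t) * ?\<omega> t \<le> ennreal (e/2) * (ennreal (?k t) * indicator unit_cube t) + ennreal (2 * A) * (ennreal (?k t) * indicator (unit_cube \<inter> far \<delta>) t)"
      proof (cases "t \<in> far \<delta>")
        case True
        have "(ennreal (?k t) * indicator unit_cube t) * ?\<omega> t \<le> (ennreal (?k t) * indicator unit_cube t) * ennreal (2 * A)"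
          by (intro mult_left_mono \<omega>_far) simp
        also have "\<dots> = ennreal (2 * A) * (ennreal (?k t) * indicator (unit_cube \<inter> far \<delta>) t)"
          using True by (simp add: indicator_def mult.commute)
        finally show ?thesis by (rule order_trans) simp
      next
        case False
        have "(ennreal (?k t) * indicator unit_cube t) * ?\<omega> t \<le> (ennreal (?k t) * indicator unit_cube t) * ennreal (e/2)"
          by (intro mult_left_mono \<omega>_near False) simp
        also have "\<dots> = ennreal (e/2) * (ennreal (?k t) * indicator unit_cube t)" by (rule mult.commute)
        finally show ?thesis by (rule order_trans) simp
      qed
    qed
    also have "\<dots> = ennreal (e/2) * (\<integral>\<^sup>+t\<in>unit_cube. ennreal (?k t) \<partial>lborel) + ennreal (2 * A) * (\<integral>\<^sup>+t\<in>unit_cube \<inter> far \<delta>. ennreal (?k t) \<partial>lborel)"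
      by (subst nn_integral_add, simp, simp, subst nn_integral_cmult, simp, subst nn_integral_cmult) auto
    also have "\<dots> \<le> ennreal (e/2) * 1 + ennreal (2 * A) * ennreal e1"
      by (intro add_mono mult_left_mono k2) (simp_all only: k1 order_refl zero_le)
    also have "\<dots> = ennreal (e/2 + 2 * A * e1)"
      using e e1 A(2) by (simp add: ennreal_mult ennreal_plus)
    also have "\<dots> \<le> ennreal e" using e1' by (intro ennreal_leI) simp
    finally show ?case .
  qed
qed

text \<open>As a function of \<open>z\<close> the kernel is an admissible test function. Its
  derivative in \<open>x\<close> is minus its derivative in \<open>z\<close>, and this sign cancels
  the one in the definition of the weak gradient.\<close>

lemma trig_poly_weak_gradient_mollify:
  fixes u :: "real^'n::finite \<Rightarrow> real" and g :: "real^'n \<Rightarrow> real^'n"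
  assumes u: "set_integrable lborel unit_cube u"
    and weak: "\<And>\<phi> i. trig_poly \<phi> \<Longrightarrow> (LINT z:unit_cube|lborel. u z * partial_deriv i \<phi> z) = - (LINT z:unit_cube|lborel. g z $ i * \<phi> z)"
  shows "(mollify n u has_derivative (\<lambda>h. (\<chi> i. mollify n (\<lambda>z. g z $ i) x) \<bullet> h)) (at x)"
proof -
  let ?Z = "bump_mass TYPE('n) n"
  let ?k = "\<lambda>z::real^'n. bump z ^ n * (1 / ?Z)"
  have ktrig: "trig_poly ?k" by (intro trig_poly.mult trig_poly_power trig_poly_bump trig_poly.const)
  then obtain k' where k': "\<And>x. (?k has_derivative (\<lambda>h. \<Sum>i\<in>UNIV. k' i x * h $ i)) (at x)"
    using trig_poly_has_derivative by blast
  have "separable (\<lambda>x z. ?k (z - x))" by (intro separable_mult separable_power separable_bump separable_const)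
  from separable_convolution_derivative[OF this u] obtain K' where
    K': "\<And>x z. ((\<lambda>x. ?k (z - x)) has_derivative (\<lambda>h. \<Sum>i\<in>UNIV. K' i x z * h $ i)) (at x)"
      "\<And>x. ((\<lambda>x. LINT z:unit_cube|lborel. u z * ?k (z - x)) has_derivative
       (\<lambda>h. \<Sum>i\<in>UNIV. (LINT z:unit_cube|lborel. u z * K' i x z) * h $ i)) (at x)" by blast
  have kd: "((\<lambda>z. ?k (z - x)) has_derivative (\<lambda>h. \<Sum>i\<in>UNIV. k' i (z - x) * h $ i)) (at z)" for x z
  proof -
    have "((\<lambda>z. z - x) has_derivative (\<lambda>h. h)) (at z)" by (auto intro!: derivative_eq_intros)
    from has_derivative_compose[OF this k'] show ?thesis .
  qed
  have "((\<lambda>x. ?k (z - x)) has_derivative (\<lambda>h. \<Sum>i\<in>UNIV. k' i (z - x) * (- h) $ i)) (at x)" for x z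
  proof -
    have "((\<lambda>x. z - x) has_derivative (\<lambda>h. - h)) (at x)" by (auto intro!: derivative_eq_intros)
    from has_derivative_compose[OF this k'] show ?thesis .
  qed
  then have kd': "((\<lambda>x. ?k (z - x)) has_derivative (\<lambda>h. \<Sum>i\<in>UNIV. (- k' i (z - x)) * h $ i)) (at x)" for x z
    by simp
  \<comment> \<open>\<open>K'\<close> is known only as a family of coefficients of a derivative;
    uniqueness of derivatives identifies it.\<close>
  have K'eq: "K' i x z = - partial_deriv i (\<lambda>z. ?k (z - x)) z" for i x z
    using has_derivative_axis[OF K'(1), of i z x] has_derivative_axis[OF kd', of i z x] has_derivative_axis[OF kd, of i x z]
    by simp
  have "(LINT z:unit_cube|lborel. u z * K' i x z) = mollify n (\<lambda>z. g z $ i) x" for i x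
  proof -
    have "(LINT z:unit_cube|lborel. u z * K' i x z) = - (LINT z:unit_cube|lborel. u z * partial_deriv i (\<lambda>z. ?k (z - x)) z)"
      unfolding K'eq set_lebesgue_integral_def by simp
    also have "\<dots> = (LINT z:unit_cube|lborel. g z $ i * ?k (z - x))"
      using weak[OF trig_poly_translate[OF ktrig], of i x] by simp
    finally show ?thesis by (simp add: mollify_def)
  qed
  then have "((\<lambda>x. LINT z:unit_cube|lborel. u z * ?k (z - x)) has_derivative
       (\<lambda>h. \<Sum>i\<in>UNIV. mollify n (\<lambda>z. g z $ i) x * h $ i)) (at x)" for x
    using K'(2) by simp
  then show ?thesis by (simp add: mollify_def[abs_def] inner_vec_def)
qed

lemma mollify_continuous:
  fixes w :: "real^'n::finite \<Rightarrow> real"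
  assumes w: "set_integrable lborel unit_cube w"
  shows "continuous_on UNIV (mollify n w)"
proof -
  let ?Z = "bump_mass TYPE('n) n"
  have "separable (\<lambda>x z::real^'n. bump (z - x) ^ n * (1 / ?Z))" by (intro separable_mult separable_power separable_bump separable_const)
  from separable_convolution_derivative[OF this w] obtain K' where
    "\<And>x z. ((\<lambda>x. bump (z - x) ^ n * (1 / ?Z)) has_derivative (\<lambda>h. \<Sum>i\<in>UNIV. K' i x z * h $ i)) (at x)"
    and K': "\<And>x. ((\<lambda>x. LINT z:unit_cube|lborel. w z * (bump (z - x) ^ n * (1 / ?Z))) has_derivative
       (\<lambda>h. \<Sum>i\<in>UNIV. (LINT z:unit_cube|lborel. w z * K' i x z) * h $ i)) (at x)" by blast
  have "isCont (mollify n w) x" for x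
    using has_derivative_continuous[OF K'] by (simp add: mollify_def[abs_def])
  then show ?thesis by (simp add: continuous_on_eq_continuous_at)
qed

lemma periodic_mollify: "periodic (mollify n w)" for w :: "real^'n::finite \<Rightarrow> real"
proof -
  have "bump (z - (x + k)) = bump (z - x)" if "k \<in> lattice" for z x k :: "real^'n"
    using periodic_diff[OF periodic_bump that, of "z - x"] by (simp add: diff_diff_eq)
  then show ?thesis by (simp add: periodic_def lattice_def mollify_def)
qed

text \<open>Trigonometric polynomials suffice as test functions.\<close>

definition borel_weak_gradient :: "(real^'n \<Rightarrow> real) \<Rightarrow> (real^'n \<Rightarrow> real^'n) \<Rightarrow> bool" where
  "borel_weak_gradient u g \<longleftrightarrow> u \<in> borel_measurable borel \<and> g \<in> borel_measurable borel \<and>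
     periodic u \<and> periodic g \<and> qint (\<lambda>x. ennreal \<bar>u x\<bar>) < \<infinity> \<and> qint (\<lambda>x. ennreal (norm (g x))) < \<infinity> \<and>
     (\<forall>\<phi> i. trig_poly \<phi> \<longrightarrow> (LINT z:unit_cube|lborel. u z * partial_deriv i \<phi> z) =
        - (LINT z:unit_cube|lborel. g z $ i * \<phi> z))"

lemma borel_weak_gradientD:
  assumes "borel_weak_gradient u g"
  shows "u \<in> borel_measurable borel" "g \<in> borel_measurable borel" "periodic u" "periodic g"
    "qint (\<lambda>x. ennreal \<bar>u x\<bar>) < \<infinity>" "qint (\<lambda>x. ennreal (norm (g x))) < \<infinity>"
    "trig_poly \<phi> \<Longrightarrow> (LINT z:unit_cube|lborel. u z * partial_deriv i \<phi> z) = - (LINT z:unit_cube|lborel. g z $ i * \<phi> z)"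
  using assms unfolding borel_weak_gradient_def by blast+

text \<open>Mollification commutes with weak differentiation, so a single index \<open>n\<close>
  approximates the function and the finitely many components of its gradient at once. Each component
  receives the share \<open>e / real CARD('n)\<close> of the error.\<close>

lemma smooth_approximation:
  fixes u :: "real^'n::finite \<Rightarrow> real" and g :: "real^'n \<Rightarrow> real^'n"
  assumes bw: "borel_weak_gradient u g" and e: "e > 0"
  obtains v G where "\<And>x. (v has_derivative (\<lambda>h. G x \<bullet> h)) (at x)" "continuous_on UNIV G"
    "periodic v" "periodic G" "qint (\<lambda>x. ennreal \<bar>u x - v x\<bar>) \<le> ennreal e"
    "qint (\<lambda>x. ennreal (norm (g x - G x))) \<le> ennreal e"
proof -
  note um [measurable] = borel_weak_gradientD(1,2)[OF bw]
  note per = borel_weak_gradientD(3,4)[OF bw] and fin = borel_weak_gradientD(5,6)[OF bw]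
    and weak = borel_weak_gradientD(7)[OF bw]
  have gm [measurable]: "(\<lambda>x. g x $ i) \<in> borel_measurable borel" for i
    by (rule measurable_compose[OF um(2)]) (intro borel_measurable_continuous_onI continuous_intros)
  have gper: "periodic (\<lambda>x. g x $ i)" for i using per(2) by (simp add: periodic_def)
  have gfin: "qint (\<lambda>x. ennreal \<bar>g x $ i\<bar>) < \<infinity>" for i
  proof -
    have "qint (\<lambda>x. ennreal \<bar>g x $ i\<bar>) \<le> qint (\<lambda>x. ennreal (norm (g x)))"
      by (intro nn_integral_mono mult_right_mono ennreal_leI component_le_norm_cart) auto
    then show ?thesis using fin(2) by (rule le_less_trans)
  qed
  let ?e = "e / real CARD('n)"
  have e': "?e > 0" using e by simp
  have "\<forall>\<^sub>F n in sequentially. qint (\<lambda>x. ennreal \<bar>mollify n u x - u x\<bar>) \<le> ennreal e \<and>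
     (\<forall>i. qint (\<lambda>x. ennreal \<bar>mollify n (\<lambda>z. g z $ i) x - g x $ i\<bar>) \<le> ennreal ?e)"
    by (intro eventually_conj eventually_all_finite mollify_L1 gm gper gfin e e' per fin um)
  then obtain n where n: "qint (\<lambda>x. ennreal \<bar>mollify n u x - u x\<bar>) \<le> ennreal e"
     "\<And>i. qint (\<lambda>x. ennreal \<bar>mollify n (\<lambda>z. g z $ i) x - g x $ i\<bar>) \<le> ennreal ?e"
    by (auto simp: eventually_sequentially)
  let ?G = "\<lambda>x. \<chi> i. mollify n (\<lambda>z. g z $ i) x"
  have ui: "set_integrable lborel unit_cube u" using fin by (intro set_integrable_periodic) auto
  have gi: "set_integrable lborel unit_cube (\<lambda>z. g z $ i)" for i using gfin by (intro set_integrable_periodic) auto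
  have cont: "continuous_on UNIV (mollify n (\<lambda>z. g z $ i))" for i by (rule mollify_continuous[OF gi])
  have [measurable]: "mollify n (\<lambda>z. g z $ i) \<in> borel_measurable borel" for i
    by (rule borel_measurable_continuous_onI[OF cont])
  show thesis
  proof (rule that[of "mollify n u" ?G])
    show "(mollify n u has_derivative (\<lambda>h. ?G x \<bullet> h)) (at x)" for x
      by (rule trig_poly_weak_gradient_mollify[OF ui weak])
    show "continuous_on UNIV ?G" by (intro continuous_on_vec_lambda cont)
    show "periodic (mollify n u)" by (rule periodic_mollify)
    show "periodic ?G" using periodic_mollify[of n "\<lambda>z. g z $ _"] by (simp add: periodic_def)
    show "qint (\<lambda>x. ennreal \<bar>u x - mollify n u x\<bar>) \<le> ennreal e" using n(1) by (simp add: abs_minus_commute)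
    have "qint (\<lambda>x. ennreal (norm (g x - ?G x))) \<le> (\<integral>\<^sup>+x. (\<Sum>i\<in>UNIV. ennreal \<bar>mollify n (\<lambda>z. g z $ i) x - g x $ i\<bar> * indicator unit_cube x) \<partial>lborel)"
      unfolding qint_lborel
    proof (intro nn_integral_mono)
      fix x :: "real^'n"
      have "norm (g x - ?G x) \<le> (\<Sum>i\<in>UNIV. \<bar>(g x - ?G x) $ i\<bar>)" by (rule norm_le_l1_cart)
      also have "\<dots> = (\<Sum>i\<in>UNIV. \<bar>mollify n (\<lambda>z. g z $ i) x - g x $ i\<bar>)" by (simp add: abs_minus_commute)
      finally have "ennreal (norm (g x - ?G x)) \<le> (\<Sum>i\<in>UNIV. ennreal \<bar>mollify n (\<lambda>z. g z $ i) x - g x $ i\<bar>)"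
        by (simp add: sum_ennreal ennreal_leI)
      then show "ennreal (norm (g x - ?G x)) * indicator unit_cube x \<le> (\<Sum>i\<in>UNIV. ennreal \<bar>mollify n (\<lambda>z. g z $ i) x - g x $ i\<bar> * indicator unit_cube x)"
        by (simp add: indicator_def)
    qed
    also have "\<dots> = (\<Sum>i\<in>UNIV. qint (\<lambda>x. ennreal \<bar>mollify n (\<lambda>z. g z $ i) x - g x $ i\<bar>))"
      unfolding qint_lborel by (rule nn_integral_sum) simp
    also have "\<dots> \<le> (\<Sum>i\<in>(UNIV::'n set). ennreal ?e)" by (intro sum_mono n(2))
    also have "\<dots> = ennreal (\<Sum>i\<in>(UNIV::'n set). ?e)" using e' by (intro sum_ennreal) simp
    also have "(\<Sum>i\<in>(UNIV::'n set). ?e) = e" by simp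
    finally show "qint (\<lambda>x. ennreal (norm (g x - ?G x))) \<le> ennreal e" .
  qed
qed

subsection \<open>Pointwise gradient estimates\<close>

lemma ball_borel [measurable]: "ball x r \<in> sets (borel :: 'a::euclidean_space measure)"
  by simp

lemma nn_integral_ball_affine:
  fixes f :: "'a::euclidean_space \<Rightarrow> ennreal"
  assumes [measurable]: "f \<in> borel_measurable borel" and c: "0 < c"
  shows "ennreal (c ^ DIM('a)) * (\<integral>\<^sup>+z\<in>ball x R. f (x + c *\<^sub>R (z - x)) \<partial>lborel) = (\<integral>\<^sup>+y\<in>ball x (c * R). f y \<partial>lborel)"
proof -
  let ?T = "\<lambda>z. (x - c *\<^sub>R x) + c *\<^sub>R z"
  have T: "?T z = x + c *\<^sub>R (z - x)" for z by (simp add: algebra_simps)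
  have "(\<integral>\<^sup>+y\<in>ball x (c * R). f y \<partial>lborel) = (\<integral>\<^sup>+y. f y * indicator (ball x (c * R)) y \<partial>density (distr lborel borel ?T) (\<lambda>_. ennreal (\<bar>c\<bar> ^ DIM('a))))"
    using lborel_affine[of c "x - c *\<^sub>R x"] c by simp
  also have "\<dots> = (\<integral>\<^sup>+y. ennreal (c ^ DIM('a)) * (f y * indicator (ball x (c * R)) y) \<partial>distr lborel borel ?T)"
    using c by (subst nn_integral_density) auto
  also have "\<dots> = (\<integral>\<^sup>+z. ennreal (c ^ DIM('a)) * (f (?T z) * indicator (ball x (c * R)) (?T z)) \<partial>lborel)"
    by (subst nn_integral_distr) auto
  also have "\<dots> = (\<integral>\<^sup>+z. ennreal (c ^ DIM('a)) * (f (x + c *\<^sub>R (z - x)) * indicator (ball x R) z) \<partial>lborel)"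
  proof (intro nn_integral_cong)
    fix z
    have "dist x (?T z) = c * dist x z"
      unfolding T using c by (simp add: dist_norm norm_minus_commute)
    then have "?T z \<in> ball x (c * R) \<longleftrightarrow> z \<in> ball x R" using c by simp
    then show "ennreal (c ^ DIM('a)) * (f (?T z) * indicator (ball x (c * R)) (?T z)) =
      ennreal (c ^ DIM('a)) * (f (x + c *\<^sub>R (z - x)) * indicator (ball x R) z)"
      unfolding T by (simp only: indicator_def)
  qed
  also have "\<dots> = ennreal (c ^ DIM('a)) * (\<integral>\<^sup>+z\<in>ball x R. f (x + c *\<^sub>R (z - x)) \<partial>lborel)"
    by (rule nn_integral_cmult) simp
  finally show ?thesis by simp
qed

lemma c1_segment_bound:
  fixes v :: "'a::euclidean_space \<Rightarrow> real"
  assumes v: "\<And>x. (v has_derivative (\<lambda>h. G x \<bullet> h)) (at x)" and G: "continuous_on UNIV G"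
  shows "ennreal \<bar>v x - v z\<bar> \<le> (\<integral>\<^sup>+t\<in>{0..1}. ennreal (norm (G (x + t *\<^sub>R (z - x))) * norm (z - x)) \<partial>lborel)"
proof -
  let ?p = "\<lambda>t. x + t *\<^sub>R (z - x)"
  let ?f = "\<lambda>t. G (?p t) \<bullet> (z - x)"
  have cont: "continuous_on {0..1} ?f"
    by (intro continuous_intros continuous_on_compose2[OF G]) auto
  have der: "((\<lambda>t. v (?p t)) has_vector_derivative ?f t) (at t within {0..1})" for t
  proof -
    have "(?p has_derivative (\<lambda>h. h *\<^sub>R (z - x))) (at t within {0..1})"
      by (auto intro!: derivative_eq_intros)
    from has_derivative_compose[OF this v[of "?p t"]] show ?thesis
      by (simp add: has_vector_derivative_def)
  qed
  have eq: "integral\<^sup>L lborel (\<lambda>t. indicator {0..1} t *\<^sub>R ?f t) = v (?p 1) - v (?p 0)"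
    by (rule integral_FTC_atLeastAtMost) (use der cont in auto)
  have "set_integrable lborel {0..1} ?f" by (rule borel_integrable_atLeastAtMost'[OF cont])
  then have int: "integrable lborel (\<lambda>t. indicator {0..1} t *\<^sub>R ?f t)" by (simp add: set_integrable_def)
  have "ennreal \<bar>v x - v z\<bar> = ennreal (norm (integral\<^sup>L lborel (\<lambda>t. indicator {0..1} t *\<^sub>R ?f t)))"
    unfolding eq by (simp add: abs_minus_commute)
  also have "\<dots> \<le> (\<integral>\<^sup>+t. ennreal (norm (indicator {0..1} t *\<^sub>R ?f t)) \<partial>lborel)"
    by (rule integral_norm_bound_ennreal[OF int])
  also have "\<dots> \<le> (\<integral>\<^sup>+t\<in>{0..1}. ennreal (norm (G (?p t)) * norm (z - x)) \<partial>lborel)"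
    by (intro nn_integral_mono) (auto simp: indicator_def intro!: ennreal_leI Cauchy_Schwarz_ineq2)
  finally show ?thesis .
qed

text \<open>The segment bound is integrated over the ball and the order of integration is exchanged.
  The slice at time \<open>t\<close> is a rescaled integral over the ball of radius
  \<open>t * R\<close>: the Jacobian t^d and the growth of that integral cancel, leaving a bound
  independent of \<open>t\<close>.\<close>

lemma c1_ball_oscillation:
  fixes v :: "real^'n::finite \<Rightarrow> real"
  assumes v: "\<And>x. (v has_derivative (\<lambda>h. G x \<bullet> h)) (at x)" and G: "continuous_on UNIV G"
    and R: "0 < R" "R < real CARD('n) + 1"
  shows "(\<integral>\<^sup>+z\<in>ball x R. ennreal \<bar>v x - v z\<bar> \<partial>lborel) \<le> ennreal (R * R ^ CARD('n)) * maxf (\<lambda>z. norm (G z)) x"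
proof -
  let ?d = "CARD('n)"
  let ?f = "\<lambda>z. norm (G z)"
  have [measurable]: "G \<in> borel_measurable borel" by (rule borel_measurable_continuous_onI[OF G])
  have pc: "continuous_on UNIV (\<lambda>p::(real^'n) \<times> real. G (x + snd p *\<^sub>R (fst p - x)))"
    by (intro continuous_on_compose2[OF G] continuous_intros) auto
  then have pm: "(\<lambda>p::(real^'n) \<times> real. G (x + snd p *\<^sub>R (fst p - x))) \<in> borel_measurable (borel \<Otimes>\<^sub>M borel)"
    unfolding borel_prod by (rule borel_measurable_continuous_onI)
  then have [measurable]: "(\<lambda>(z, t). G (x + t *\<^sub>R (z - x))) \<in> borel_measurable (borel \<Otimes>\<^sub>M borel)"
    by (simp add: case_prod_beta')
  have slice: "(\<integral>\<^sup>+z\<in>ball x R. ennreal (?f (x + t *\<^sub>R (z - x))) \<partial>lborel) \<le> ennreal (R ^ ?d) * maxf ?f x" if t: "0 < t" "t \<le> 1" for t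
  proof -
    have td: "0 < t ^ ?d" using t by simp
    have "t * R \<le> 1 * R" using t R by (intro mult_right_mono) auto
    then have tR: "0 < t * R" "t * R < real ?d + 1" using t R by (simp, linarith)
    have "ennreal (t ^ ?d) * (\<integral>\<^sup>+z\<in>ball x R. ennreal (?f (x + t *\<^sub>R (z - x))) \<partial>lborel) = (\<integral>\<^sup>+y\<in>ball x (t * R). ennreal (?f y) \<partial>lborel)"
      using nn_integral_ball_affine[of "\<lambda>y. ennreal (?f y)" t x R] t by simp
    also have "\<dots> = (\<integral>\<^sup>+y\<in>ball x (t * R). ennreal \<bar>?f y\<bar> \<partial>lebesgue)"
      unfolding nn_integral_completion by simp
    also have "\<dots> \<le> ennreal ((t * R) ^ ?d) * maxf ?f x" by (rule ball_integral_le_maxf[OF tR])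
    also have "\<dots> = ennreal (t ^ ?d) * (ennreal (R ^ ?d) * maxf ?f x)"
      using t R by (simp add: power_mult_distrib ennreal_mult mult.assoc)
    finally have le: "ennreal (t ^ ?d) * (\<integral>\<^sup>+z\<in>ball x R. ennreal (?f (x + t *\<^sub>R (z - x))) \<partial>lborel) \<le>
      ennreal (t ^ ?d) * (ennreal (R ^ ?d) * maxf ?f x)" .
    show ?thesis
    proof (rule ccontr)
      assume "\<not> ?thesis"
      then have "ennreal (t ^ ?d) * (ennreal (R ^ ?d) * maxf ?f x) <
          ennreal (t ^ ?d) * (\<integral>\<^sup>+z\<in>ball x R. ennreal (?f (x + t *\<^sub>R (z - x))) \<partial>lborel)"
        using td by (intro ennreal_mult_strict_left_mono) auto
      with le show False by simp
    qed
  qed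
  have "(\<integral>\<^sup>+z\<in>ball x R. ennreal \<bar>v x - v z\<bar> \<partial>lborel) \<le>
      (\<integral>\<^sup>+z. (\<integral>\<^sup>+t. ennreal R * (ennreal (?f (x + t *\<^sub>R (z - x))) * indicator (ball x R) z * indicator {0..1} t) \<partial>lborel) \<partial>lborel)"
  proof (rule nn_integral_mono)
    fix z :: "real^'n"
    show "ennreal \<bar>v x - v z\<bar> * indicator (ball x R) z \<le> (\<integral>\<^sup>+t. ennreal R * (ennreal (?f (x + t *\<^sub>R (z - x))) * indicator (ball x R) z * indicator {0..1} t) \<partial>lborel)"
    proof (cases "z \<in> ball x R")
      case True
      then have zR: "norm (z - x) \<le> R" by (simp add: dist_norm norm_minus_commute)
      have "ennreal \<bar>v x - v z\<bar> \<le> (\<integral>\<^sup>+t\<in>{0..1}. ennreal (?f (x + t *\<^sub>R (z - x)) * norm (z - x)) \<partial>lborel)"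
        by (rule c1_segment_bound[OF v G])
      also have "\<dots> \<le> (\<integral>\<^sup>+t. ennreal R * (ennreal (?f (x + t *\<^sub>R (z - x))) * indicator {0..1} t) \<partial>lborel)"
      proof (rule nn_integral_mono)
        fix t :: real
        have "?f (x + t *\<^sub>R (z - x)) * norm (z - x) \<le> R * ?f (x + t *\<^sub>R (z - x))"
          using mult_left_mono[OF zR, of "?f (x + t *\<^sub>R (z - x))"] by (simp add: mult.commute)
        then have "ennreal (?f (x + t *\<^sub>R (z - x)) * norm (z - x)) \<le> ennreal R * ennreal (?f (x + t *\<^sub>R (z - x)))"
          using R by (simp add: ennreal_mult[symmetric] ennreal_leI)
        then show "ennreal (?f (x + t *\<^sub>R (z - x)) * norm (z - x)) * indicator {0..1} t \<le> ennreal R * (ennreal (?f (x + t *\<^sub>R (z - x))) * indicator {0..1} t)"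
          by (simp add: indicator_def)
      qed
      finally show ?thesis using True by (simp only: indicator_simps mult_1_right)
    qed simp
  qed
  also have "\<dots> = (\<integral>\<^sup>+t. (\<integral>\<^sup>+z. ennreal R * (ennreal (?f (x + t *\<^sub>R (z - x))) * indicator (ball x R) z * indicator {0..1} t) \<partial>lborel) \<partial>lborel)"
    by (rule lborel_pair.Fubini') measurable
  also have "\<dots> \<le> (\<integral>\<^sup>+t. (ennreal R * (ennreal (R ^ ?d) * maxf ?f x)) * indicator {0..1::real} t \<partial>lborel)"
  proof (rule nn_integral_mono_AE)
    \<comment> \<open>The rescaling degenerates at \<open>t = 0\<close>, a null set of
      times.\<close>
    have "AE t::real in lborel. t \<noteq> 0" by (rule AE_lborel_singleton)
    then show "AE t in lborel. (\<integral>\<^sup>+z. ennreal R * (ennreal (?f (x + t *\<^sub>R (z - x))) * indicator (ball x R) z * indicator {0..1} t) \<partial>lborel)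
      \<le> (ennreal R * (ennreal (R ^ ?d) * maxf ?f x)) * indicator {0..1} t"
    proof eventually_elim
      case (elim t)
      show ?case
      proof (cases "t \<in> {0..1}")
        case True
        then have t: "0 < t" "t \<le> 1" using elim by auto
        have [measurable]: "(\<lambda>z. G (x + t *\<^sub>R (z - x))) \<in> borel_measurable borel"
          by (intro borel_measurable_continuous_onI continuous_on_compose2[OF G] continuous_intros) auto
        have "(\<integral>\<^sup>+z. ennreal R * (ennreal (?f (x + t *\<^sub>R (z - x))) * indicator (ball x R) z * indicator {0..1} t) \<partial>lborel) =
            ennreal R * (\<integral>\<^sup>+z\<in>ball x R. ennreal (?f (x + t *\<^sub>R (z - x))) \<partial>lborel)"
          using True by (subst nn_integral_cmult) auto
        also have "\<dots> \<le> ennreal R * (ennreal (R ^ ?d) * maxf ?f x)" by (intro mult_left_mono slice t) simp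
        finally show ?thesis using True by simp
      qed simp
    qed
  qed
  also have "\<dots> = ennreal R * (ennreal (R ^ ?d) * maxf ?f x)"
    by (subst nn_integral_cmult_indicator) auto
  also have "\<dots> = ennreal (R * R ^ ?d) * maxf ?f x"
    using R by (simp add: ennreal_mult mult.assoc)
  finally show ?thesis .
qed

lemma ennreal_inverse_mult: "0 < c \<Longrightarrow> ennreal (1 / c) * ennreal c = 1"
  by (simp add: ennreal_mult[symmetric])

text \<open>Both values are compared with those on the ball of radius R/2 about the midpoint, which
  lies in the balls of radius R about either point. The constant is the quotient of R^d and the
  volume of that ball.\<close>

lemma c1_pointwise:
  obtains C where "C > 0" "\<And>(v :: real^'n::finite \<Rightarrow> real) G x y. (\<And>x. (v has_derivative (\<lambda>h. G x \<bullet> h)) (at x)) \<Longrightarrow>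
    continuous_on UNIV G \<Longrightarrow> norm (x - y) < real CARD('n) + 1 \<Longrightarrow>
    ennreal \<bar>v x - v y\<bar> \<le> ennreal (C * norm (x - y)) * (maxf (\<lambda>z. norm (G z)) x + maxf (\<lambda>z. norm (G z)) y)"
proof -
  let ?d = "CARD('n)"
  define V where "V = unit_ball_vol (real ?d)"
  have V: "V > 0" unfolding V_def by simp
  show thesis
  proof (rule that[of "2 ^ ?d / V"])
    fix v :: "real^'n \<Rightarrow> real" and G and x y :: "real^'n"
    assume v: "\<And>x. (v has_derivative (\<lambda>h. G x \<bullet> h)) (at x)" and G: "continuous_on UNIV G"
      and xy: "norm (x - y) < real ?d + 1"
    let ?M = "maxf (\<lambda>z. norm (G z))"
    define R where "R = norm (x - y)"
    show "ennreal \<bar>v x - v y\<bar> \<le> ennreal (2 ^ ?d / V * norm (x - y)) * (?M x + ?M y)"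
    proof (cases "x = y")
      case False
      then have R: "0 < R" "R < real ?d + 1" using xy by (auto simp: R_def)
      let ?m = "(1/2) *\<^sub>R (x + y)"
      have vc: "continuous_on UNIV v"
        using v by (intro differentiable_imp_continuous_on) (auto simp: differentiable_on_def differentiable_def)
      have [measurable]: "v \<in> borel_measurable borel" by (rule borel_measurable_continuous_onI[OF vc])
      have dm: "dist x ?m = R / 2" "dist y ?m = R / 2"
      proof -
        have "x - ?m = (1/2) *\<^sub>R (x - y)" "y - ?m = (1/2) *\<^sub>R (y - x)" by (simp_all add: algebra_simps vec_eq_iff)
        then show "dist x ?m = R / 2" "dist y ?m = R / 2" by (simp_all only: dist_norm norm_scaleR R_def norm_minus_commute[of y x])
      qed
      have "ball ?m (R/2) \<subseteq> ball x R \<inter> ball y R"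
      proof
        fix z assume "z \<in> ball ?m (R/2)"
        then have "dist ?m z < R/2" by simp
        then show "z \<in> ball x R \<inter> ball y R"
          using dist_triangle[of x z ?m] dist_triangle[of y z ?m] dm by auto
      qed
      then have sub: "indicator (ball ?m (R/2)) z \<le> (indicator (ball x R) z :: ennreal)" "indicator (ball ?m (R/2)) z \<le> (indicator (ball y R) z :: ennreal)" for z
        by (auto simp: indicator_def)
      have vol: "emeasure lborel (ball ?m (R/2)) = ennreal (V * (R/2) ^ ?d)"
        using R by (simp add: emeasure_ball V_def)
      have "ennreal (V * (R/2) ^ ?d) * ennreal \<bar>v x - v y\<bar> = (\<integral>\<^sup>+z\<in>ball ?m (R/2). ennreal \<bar>v x - v y\<bar> \<partial>lborel)"
        by (simp add: nn_integral_cmult_indicator vol mult.commute)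
      also have "\<dots> \<le> (\<integral>\<^sup>+z. ennreal \<bar>v x - v z\<bar> * indicator (ball x R) z + ennreal \<bar>v y - v z\<bar> * indicator (ball y R) z \<partial>lborel)"
      proof (rule nn_integral_mono)
        fix z
        have "ennreal \<bar>v x - v y\<bar> \<le> ennreal \<bar>v x - v z\<bar> + ennreal \<bar>v y - v z\<bar>"
          by (auto simp flip: ennreal_plus intro!: ennreal_leI)
        then have "ennreal \<bar>v x - v y\<bar> * indicator (ball ?m (R/2)) z \<le> (ennreal \<bar>v x - v z\<bar> + ennreal \<bar>v y - v z\<bar>) * indicator (ball ?m (R/2)) z"
          by (rule mult_right_mono) simp
        also have "\<dots> \<le> ennreal \<bar>v x - v z\<bar> * indicator (ball x R) z + ennreal \<bar>v y - v z\<bar> * indicator (ball y R) z"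
          unfolding distrib_right by (intro add_mono mult_left_mono sub) auto
        finally show "ennreal \<bar>v x - v y\<bar> * indicator (ball ?m (R/2)) z \<le> \<dots>" .
      qed
      also have "\<dots> = (\<integral>\<^sup>+z\<in>ball x R. ennreal \<bar>v x - v z\<bar> \<partial>lborel) + (\<integral>\<^sup>+z\<in>ball y R. ennreal \<bar>v y - v z\<bar> \<partial>lborel)"
        by (rule nn_integral_add) auto
      also have "\<dots> \<le> ennreal (R * R ^ ?d) * ?M x + ennreal (R * R ^ ?d) * ?M y"
        by (intro add_mono c1_ball_oscillation v G R)
      finally have le: "ennreal (V * (R/2) ^ ?d) * ennreal \<bar>v x - v y\<bar> \<le> ennreal (R * R ^ ?d) * (?M x + ?M y)"
        by (simp add: distrib_left)
      have pos: "0 < V * (R/2) ^ ?d" using V R by simp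
      have one: "ennreal (1 / (V * (R/2) ^ ?d)) * ennreal (V * (R/2) ^ ?d) = 1"
        by (rule ennreal_inverse_mult[OF pos])
      have "ennreal \<bar>v x - v y\<bar> = ennreal (1 / (V * (R/2) ^ ?d)) * (ennreal (V * (R/2) ^ ?d) * ennreal \<bar>v x - v y\<bar>)"
        by (simp only: mult.assoc[symmetric] one mult_1_left)
      also have "\<dots> \<le> ennreal (1 / (V * (R/2) ^ ?d)) * (ennreal (R * R ^ ?d) * (?M x + ?M y))"
        by (intro mult_left_mono le) simp
      also have "\<dots> = ennreal (1 / (V * (R/2) ^ ?d) * (R * R ^ ?d)) * (?M x + ?M y)"
      proof -
        have "0 \<le> 1 / (V * (R/2) ^ ?d)" "0 \<le> R * R ^ ?d" using pos R by auto
        then show ?thesis by (simp only: ennreal_mult mult.assoc)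
      qed
      also have "1 / (V * (R/2) ^ ?d) * (R * R ^ ?d) = 2 ^ ?d / V * R"
        using V R by (simp add: power_divide field_simps)
      finally show ?thesis by (simp add: R_def)
    qed simp
  qed (use V in simp)
qed

section \<open>Passage from continuously differentiable to Sobolev functions\<close>

lemma summable_half_powers: "summable (\<lambda>k. c * (1/2 :: real) ^ k)"
  by (intro summable_mult summable_geometric) simp

text \<open>Borel-Cantelli in the cube, where the measures are summable; periodicity of the sets
  spreads the conclusion over the whole space.\<close>

lemma AE_eventually_small:
  fixes P :: "nat \<Rightarrow> (real^'n::finite) set"
  assumes meas: "\<And>k. P k \<in> sets lebesgue"
    and bnd: "\<And>k. emeasure lebesgue (P k \<inter> unit_cube) \<le> ennreal (c * (1/2) ^ k)" and "c \<ge> 0"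
    and per: "\<And>k x l. l \<in> lattice \<Longrightarrow> x + l \<in> P k \<longleftrightarrow> x \<in> P k"
  shows "AE x in lebesgue. \<forall>\<^sub>F k in sequentially. x \<notin> P k"
proof (rule AE_periodic)
  have "AE x in lebesgue. \<forall>\<^sub>F k in sequentially. x \<in> space lebesgue - (P k \<inter> unit_cube)"
  proof (rule borel_cantelli_AE1)
    show "P k \<inter> unit_cube \<in> sets lebesgue" for k using meas by auto
    show "emeasure lebesgue (P k \<inter> unit_cube) < \<infinity>" for k
      by (rule le_less_trans[OF bnd]) simp
    show "summable (\<lambda>k. measure lebesgue (P k \<inter> unit_cube))"
    proof (rule summable_comparison_test'[OF summable_half_powers[of c], of 0])
      fix k
      have "measure lebesgue (P k \<inter> unit_cube) = enn2real (emeasure lebesgue (P k \<inter> unit_cube))" by (simp add: measure_def)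
      also have "\<dots> \<le> enn2real (ennreal (c * (1/2) ^ k))" by (intro enn2real_mono bnd) simp
      also have "\<dots> = c * (1/2) ^ k" using \<open>c \<ge> 0\<close> by (intro enn2real_ennreal) simp
      finally show "norm (measure lebesgue (P k \<inter> unit_cube)) \<le> c * (1/2) ^ k" by simp
    qed
  qed
  then show "AE x in lebesgue. x \<in> unit_cube \<longrightarrow> (\<forall>\<^sub>F k in sequentially. x \<notin> P k)"
    by eventually_elim (intro impI, erule eventually_mono, blast)
qed (simp add: per)

definition gradient_estimate :: "real \<Rightarrow> (real^'n \<Rightarrow> real) \<Rightarrow> (real^'n \<Rightarrow> real^'n) \<Rightarrow> bool" where
  "gradient_estimate C u g \<longleftrightarrow> (\<exists>S. (AE x in lebesgue. x \<in> S) \<and>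
     (\<forall>x\<in>S. \<forall>y\<in>S. norm (x - y) < real CARD('n) + 1 \<longrightarrow> ennreal \<bar>u x - u y\<bar> \<le>
        ennreal (C * norm (x - y)) * (maxf (\<lambda>z. norm (g z)) x + maxf (\<lambda>z. norm (g z)) y)))"

text \<open>Smooth approximants with L^1 errors 4^-k are used at the level 2^-k: Chebyshev's
  inequality for the functions and the weak type bound for the gradients give exceptional sets of
  measure of order 2^-k. By Borel-Cantelli almost every point eventually leaves them, and there the
  estimate for the approximants passes to the limit. Integrability of the gradient is enough, since
  no strong type bound enters.\<close>

lemma sobolev_pointwise_borel:
  obtains C where "C > 0" "\<And>(u :: real^'n::finite \<Rightarrow> real) g. borel_weak_gradient u g \<Longrightarrow> gradient_estimate C u g"
proof -
  let ?d = "CARD('n)"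
  obtain C where C: "C > 0" "\<And>(v :: real^'n \<Rightarrow> real) G x y. (\<And>x. (v has_derivative (\<lambda>h. G x \<bullet> h)) (at x)) \<Longrightarrow>
    continuous_on UNIV G \<Longrightarrow> norm (x - y) < real CARD('n) + 1 \<Longrightarrow>
    ennreal \<bar>v x - v y\<bar> \<le> ennreal (C * norm (x - y)) * (maxf (\<lambda>z. norm (G z)) x + maxf (\<lambda>z. norm (G z)) y)"
    using c1_pointwise by blast
  obtain W where W: "W > 0" "\<And>(f :: real^'n \<Rightarrow> real) t. f \<in> borel_measurable lebesgue \<Longrightarrow> periodic f \<Longrightarrow>
    0 < t \<Longrightarrow> ennreal t * emeasure lebesgue ({x. ennreal t < maxf f x} \<inter> unit_cube) \<le> ennreal W * qint (\<lambda>x. ennreal \<bar>f x\<bar>)"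
    using maxf_weak_type by blast
  show thesis
  proof (rule that[OF C(1)])
    fix u :: "real^'n \<Rightarrow> real" and g :: "real^'n \<Rightarrow> real^'n"
    assume bw: "borel_weak_gradient u g"
    note [measurable] = borel_weak_gradientD(1,2)[OF bw] and per = borel_weak_gradientD(3,4)[OF bw]
    let ?good = "\<lambda>k p. (\<forall>x. (fst p has_derivative (\<lambda>h. snd p x \<bullet> h)) (at x)) \<and> continuous_on UNIV (snd p) \<and>
      periodic (fst p) \<and> periodic (snd p) \<and> qint (\<lambda>x. ennreal \<bar>u x - fst p x\<bar>) \<le> ennreal ((1/4) ^ k) \<and>
      qint (\<lambda>x. ennreal (norm (g x - snd p x))) \<le> ennreal ((1/4) ^ k)"
    have "\<forall>k. \<exists>p. ?good k p"
    proof
      fix k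
      obtain v G where "\<And>x. (v has_derivative (\<lambda>h. G x \<bullet> h)) (at x)" "continuous_on UNIV G"
        "periodic v" "periodic G" "qint (\<lambda>x. ennreal \<bar>u x - v x\<bar>) \<le> ennreal ((1/4) ^ k)"
        "qint (\<lambda>x. ennreal (norm (g x - G x))) \<le> ennreal ((1/4) ^ k)"
        by (rule smooth_approximation[OF bw, of "(1/4) ^ k"]) auto
      then show "\<exists>p. ?good k p" by (intro exI[of _ "(v, G)"]) simp
    qed
    from choice[OF this] obtain p where p: "\<forall>k. ?good k (p k)" ..
    define v where "v k = fst (p k)" for k
    define G where "G k = snd (p k)" for k
    have v: "\<And>k x. (v k has_derivative (\<lambda>h. G k x \<bullet> h)) (at x)"
      and G: "\<And>k. continuous_on UNIV (G k)" and vper: "\<And>k. periodic (v k)" and Gper: "\<And>k. periodic (G k)"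
      and vb: "\<And>k. qint (\<lambda>x. ennreal \<bar>u x - v k x\<bar>) \<le> ennreal ((1/4) ^ k)"
      and Gb: "\<And>k. qint (\<lambda>x. ennreal (norm (g x - G k x))) \<le> ennreal ((1/4) ^ k)"
      using p by (auto simp: v_def G_def)
    have [measurable]: "G k \<in> borel_measurable borel" for k by (rule borel_measurable_continuous_onI[OF G])
    have [measurable]: "v k \<in> borel_measurable borel" for k
    proof (rule borel_measurable_continuous_onI)
      show "continuous_on UNIV (v k)"
        using v[of k] by (intro differentiable_imp_continuous_on) (auto simp: differentiable_on_def differentiable_def)
    qed
    let ?D = "\<lambda>k x. norm (g x - G k x)"
    have Dm: "?D k \<in> borel_measurable lebesgue" for k by (rule borel_measurable_lebesgueI) simp
    have Dper: "periodic (?D k)" for k using per(2) Gper[of k] by (simp add: periodic_def)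
    have quarter: "2 ^ k * (1/4) ^ k = (1/2 :: real) ^ k" for k by (simp add: power_mult_distrib[symmetric])
    have quarter': "ennreal (2 ^ k) * ennreal ((1/4) ^ k) = ennreal ((1/2) ^ k)" for k
      by (subst ennreal_mult[symmetric]) (simp_all add: quarter)
    have AE1: "AE x in lebesgue. \<forall>\<^sub>F k in sequentially. x \<notin> {x. (1/2) ^ k < \<bar>u x - v k x\<bar>}"
    proof (rule AE_eventually_small)
      show "{x. (1/2) ^ k < \<bar>u x - v k x\<bar>} \<in> sets lebesgue" for k
      proof -
        have "{x. (1/2) ^ k < \<bar>u x - v k x\<bar>} \<in> sets borel" by measurable
        then show ?thesis by simp
      qed
      show "emeasure lebesgue ({x. (1/2) ^ k < \<bar>u x - v k x\<bar>} \<inter> unit_cube) \<le> ennreal (1 * (1/2) ^ k)" for k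
      proof -
        have "emeasure lborel ({x. (1/2) ^ k < \<bar>u x - v k x\<bar>} \<inter> unit_cube) = (\<integral>\<^sup>+x. indicator ({x. (1/2) ^ k < \<bar>u x - v k x\<bar>} \<inter> unit_cube) x \<partial>lborel)"
          by simp
        also have "\<dots> \<le> (\<integral>\<^sup>+x. ennreal (2 ^ k) * (ennreal \<bar>u x - v k x\<bar> * indicator unit_cube x) \<partial>lborel)"
        proof (rule nn_integral_mono)
          fix x
          show "indicator ({x. (1/2) ^ k < \<bar>u x - v k x\<bar>} \<inter> unit_cube) x \<le> ennreal (2 ^ k) * (ennreal \<bar>u x - v k x\<bar> * indicator unit_cube x)"
          proof (cases "x \<in> {x. (1/2) ^ k < \<bar>u x - v k x\<bar>} \<inter> unit_cube")
            case True
            have "1 = 2 ^ k * (1/2 :: real) ^ k" by (simp add: power_mult_distrib[symmetric])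
            also have "\<dots> \<le> 2 ^ k * \<bar>u x - v k x\<bar>" using True by (intro mult_left_mono) auto
            finally have "1 \<le> ennreal (2 ^ k) * ennreal \<bar>u x - v k x\<bar>" by (simp add: ennreal_mult[symmetric] ennreal_ge_1)
            then show ?thesis using True by (simp add: indicator_def)
          qed simp
        qed
        also have "\<dots> = ennreal (2 ^ k) * qint (\<lambda>x. ennreal \<bar>u x - v k x\<bar>)"
          unfolding qint_lborel by (rule nn_integral_cmult) simp
        also have "\<dots> \<le> ennreal (2 ^ k) * ennreal ((1/4) ^ k)" by (intro mult_left_mono vb) simp
        finally show ?thesis by (simp add: quarter')
      qed
      show "(x + l \<in> {x. (1/2) ^ k < \<bar>u x - v k x\<bar>}) = (x \<in> {x. (1/2) ^ k < \<bar>u x - v k x\<bar>})" if "l \<in> lattice" for k x l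
        using periodic_add[OF per(1) that] periodic_add[OF vper that] by simp
    qed simp
    have AE2: "AE x in lebesgue. \<forall>\<^sub>F k in sequentially. x \<notin> {x. ennreal ((1/2) ^ k) < maxf (?D k) x}"
    proof (rule AE_eventually_small)
      show "{x. ennreal ((1/2) ^ k) < maxf (?D k) x} \<in> sets lebesgue" for k by (rule maxf_level_sets[OF Dm])
      show "emeasure lebesgue ({x. ennreal ((1/2) ^ k) < maxf (?D k) x} \<inter> unit_cube) \<le> ennreal (W * (1/2) ^ k)" for k
      proof -
        let ?E = "emeasure lebesgue ({x. ennreal ((1/2) ^ k) < maxf (?D k) x} \<inter> unit_cube)"
        have one: "ennreal (2 ^ k) * ennreal ((1/2) ^ k) = 1"
          by (subst ennreal_mult[symmetric]) (simp_all add: power_mult_distrib[symmetric])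
        have "?E = ennreal (2 ^ k) * (ennreal ((1/2) ^ k) * ?E)" by (simp only: mult.assoc[symmetric] one mult_1_left)
        also have "\<dots> \<le> ennreal (2 ^ k) * (ennreal W * qint (\<lambda>x. ennreal \<bar>?D k x\<bar>))"
          by (intro mult_left_mono W(2) Dm Dper) auto
        also have "\<dots> \<le> ennreal (2 ^ k) * (ennreal W * ennreal ((1/4) ^ k))"
          using Gb[of k] by (intro mult_left_mono) auto
        also have "\<dots> = ennreal W * (ennreal (2 ^ k) * ennreal ((1/4) ^ k))" by (simp only: mult_ac)
        also have "\<dots> = ennreal (W * (1/2) ^ k)" unfolding quarter' using W(1) by (simp add: ennreal_mult)
        finally show ?thesis .
      qed
      show "(x + l \<in> {x. ennreal ((1/2) ^ k) < maxf (?D k) x}) = (x \<in> {x. ennreal ((1/2) ^ k) < maxf (?D k) x})" if "l \<in> lattice" for k x l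
        using periodic_add[OF periodic_maxf[OF Dm Dper] that] by simp
    qed (use W(1) in simp)
    let ?M = "maxf (\<lambda>z. norm (g z))"
    let ?S = "{x. (\<forall>\<^sub>F k in sequentially. \<not> (1/2) ^ k < \<bar>u x - v k x\<bar>) \<and> (\<forall>\<^sub>F k in sequentially. \<not> ennreal ((1/2) ^ k) < maxf (?D k) x)}"
    show "gradient_estimate C u g"
      unfolding gradient_estimate_def
    proof (intro exI[of _ ?S] conjI ballI impI)
      show "AE x in lebesgue. x \<in> ?S" using AE1 AE2 by eventually_elim simp
      fix x y assume x: "x \<in> ?S" and y: "y \<in> ?S" and xy: "norm (x - y) < real CARD('n) + 1"
      let ?c = "ennreal (C * norm (x - y))"
      have Gg: "maxf (\<lambda>z. norm (G k z)) x \<le> ?M x + maxf (?D k) x" for k x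
      proof (rule maxf_add)
        show "(\<lambda>z. norm (g z)) \<in> borel_measurable lebesgue" by (rule borel_measurable_lebesgueI) simp
        have "norm (G k z) \<le> norm (g z) + norm (g z - G k z)" for z
          using norm_triangle_ineq4[of "g z" "g z - G k z"] by simp
        then show "AE z in lebesgue. \<bar>norm (G k z)\<bar> \<le> \<bar>norm (g z)\<bar> + \<bar>norm (g z - G k z)\<bar>" by simp
      qed (rule Dm)
      let ?rhs = "\<lambda>k. (ennreal ((1/2) ^ k) + ennreal ((1/2) ^ k)) + ?c * (ennreal ((1/2) ^ k) + ennreal ((1/2) ^ k)) + ?c * (?M x + ?M y)"
      have "\<forall>\<^sub>F k in sequentially. ennreal \<bar>u x - u y\<bar> \<le> ?rhs k"
      proof -
        have "\<forall>\<^sub>F k in sequentially. \<bar>u x - v k x\<bar> \<le> (1/2) ^ k \<and> \<bar>u y - v k y\<bar> \<le> (1/2) ^ k \<and>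
           maxf (?D k) x \<le> ennreal ((1/2) ^ k) \<and> maxf (?D k) y \<le> ennreal ((1/2) ^ k)"
          using x y by (auto simp: not_less eventually_conj_iff)
        then show ?thesis
        proof eventually_elim
          case (elim k)
          have "ennreal \<bar>u x - u y\<bar> \<le> ennreal ((1/2) ^ k + (1/2) ^ k + \<bar>v k x - v k y\<bar>)"
            using elim by (intro ennreal_leI) linarith
          also have "\<dots> = (ennreal ((1/2) ^ k) + ennreal ((1/2) ^ k)) + ennreal \<bar>v k x - v k y\<bar>" by (simp flip: ennreal_plus)
          also have "ennreal \<bar>v k x - v k y\<bar> \<le> ?c * (maxf (\<lambda>z. norm (G k z)) x + maxf (\<lambda>z. norm (G k z)) y)"
            by (rule C(2)[OF v G xy])
          also have "\<dots> \<le> ?c * ((?M x + ennreal ((1/2) ^ k)) + (?M y + ennreal ((1/2) ^ k)))"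
            using elim by (intro mult_left_mono add_mono order_trans[OF Gg]) auto
          also have "\<dots> = ?c * (ennreal ((1/2) ^ k) + ennreal ((1/2) ^ k)) + ?c * (?M x + ?M y)"
            by (simp only: distrib_left[symmetric] add_ac)
          finally show ?case by (simp only: add_ac) (simp add: add_left_mono add_ac)
        qed
      qed
      moreover have "?rhs \<longlonglongrightarrow> (0 + 0) + ?c * (0 + 0) + ?c * (?M x + ?M y)"
      proof -
        have "(\<lambda>k. (1/2 :: real) ^ k) \<longlonglongrightarrow> 0" by (rule LIMSEQ_realpow_zero) auto
        from tendsto_ennrealI[OF this] have h: "(\<lambda>k. ennreal ((1/2) ^ k)) \<longlonglongrightarrow> 0" by simp
        show ?thesis by (intro tendsto_add h tendsto_const tendsto_mult_ennreal) auto
      qed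
      ultimately have "ennreal \<bar>u x - u y\<bar> \<le> (0 + 0) + ?c * (0 + 0) + ?c * (?M x + ?M y)"
        by (intro tendsto_lowerbound[of ?rhs _ sequentially]) auto
      then show "ennreal \<bar>u x - u y\<bar> \<le> ?c * (?M x + ?M y)" by simp
    qed
  qed
qed

subsection \<open>The asymmetric estimate\<close>

text \<open>If every point of \<open>S\<close> in the ball had a value above the average,
  integration over the ball would give an integral strictly larger than itself. That the point can
  be found in a prescribed set of full measure is what the chain needs. The assumption made for
  contradiction also forces the integral to be finite.\<close>

lemma exists_below_average:
  fixes w :: "real^'n::finite \<Rightarrow> real"
  assumes [measurable]: "w \<in> borel_measurable lebesgue" and w: "\<And>z. 0 \<le> w z"
    and S: "AE z in lebesgue. z \<in> S" and s: "0 < s"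
  obtains (pick) z where "z \<in> S" "z \<in> ball y s"
    "ennreal (unit_ball_vol (real CARD('n)) * s ^ CARD('n) * w z) \<le> (\<integral>\<^sup>+z\<in>ball y s. ennreal \<bar>w z\<bar> \<partial>lebesgue)"
proof (rule ccontr)
  assume no: "\<not> thesis"
  define P where "P = unit_ball_vol (real CARD('n)) * s ^ CARD('n)"
  have P: "P > 0" unfolding P_def using s by simp
  let ?I = "(\<integral>\<^sup>+z\<in>ball y s. ennreal \<bar>w z\<bar> \<partial>lebesgue)"
  have vol: "emeasure lebesgue (ball y s) = ennreal P"
    using s by (simp add: emeasure_ball P_def)
  have big: "?I < ennreal (P * w z)" if "z \<in> S" "z \<in> ball y s" for z
  proof (rule ccontr)
    assume "\<not> ?thesis"
    then have "ennreal (unit_ball_vol (real CARD('n)) * s ^ CARD('n) * w z) \<le> ?I" by (simp add: P_def not_less)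
    from pick[OF \<open>z \<in> S\<close> \<open>z \<in> ball y s\<close> this] no show False by blast
  qed
  have nonnull: "\<not> (AE z in lebesgue. z \<notin> ball y s)"
  proof
    assume "AE z in lebesgue. z \<notin> ball y s"
    then have "emeasure lebesgue (ball y s) = 0" by (subst (asm) AE_iff_measurable[OF _ refl]) (auto simp: ball_def)
    then show False using vol P by simp
  qed
  have "\<exists>z. z \<in> S \<and> z \<in> ball y s"
  proof (rule ccontr)
    assume "\<nexists>z. z \<in> S \<and> z \<in> ball y s"
    then have "AE z in lebesgue. z \<notin> ball y s" using S by (auto elim!: eventually_mono)
    with nonnull show False ..
  qed
  then obtain z0 where "z0 \<in> S" "z0 \<in> ball y s" by blast
  from big[OF this] have "?I < top" by (rule less_trans) simp
  then obtain I where I: "?I = ennreal I" "0 \<le> I" by (cases ?I) auto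
  have big': "I / P < w z" if "z \<in> S" "z \<in> ball y s" for z
    using big[OF that] I P w[of z] by (simp add: ennreal_less_iff field_simps)
  have "(\<integral>\<^sup>+z\<in>ball y s. ennreal (I / P) \<partial>lebesgue) < ?I"
  proof (rule nn_integral_less)
    have eq: "(\<integral>\<^sup>+z\<in>ball y s. ennreal (I / P) \<partial>lebesgue) = ennreal I"
      using P I(2) by (simp add: nn_integral_cmult_indicator vol ennreal_mult[symmetric])
    show "(\<integral>\<^sup>+z\<in>ball y s. ennreal (I / P) \<partial>lebesgue) \<noteq> \<infinity>" unfolding eq by simp
    show "AE z in lebesgue. ennreal (I / P) * indicator (ball y s) z \<le> ennreal \<bar>w z\<bar> * indicator (ball y s) z"
      using S
    proof eventually_elim
      case (elim z)
      then show ?case using big'[of z] w[of z] by (cases "z \<in> ball y s") (auto intro!: ennreal_leI)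
    qed
    show "\<not> (AE z in lebesgue. ennreal \<bar>w z\<bar> * indicator (ball y s) z \<le> ennreal (I / P) * indicator (ball y s) z)"
    proof
      assume "AE z in lebesgue. ennreal \<bar>w z\<bar> * indicator (ball y s) z \<le> ennreal (I / P) * indicator (ball y s) z"
      then have "AE z in lebesgue. z \<notin> ball y s" using S
      proof eventually_elim
        case (elim z)
        show ?case
        proof
          assume z: "z \<in> ball y s"
          then have "ennreal \<bar>w z\<bar> \<le> ennreal (I / P)" using elim(1) by simp
          moreover have "0 \<le> I / P" using I(2) P by simp
          ultimately have "w z \<le> I / P" using w[of z] by simp
          then show False using big'[OF elim(2) z] by simp
        qed
      qed
      with nonnull show False ..
    qed
  qed simp_all
  also have "(\<integral>\<^sup>+z\<in>ball y s. ennreal (I / P) \<partial>lebesgue) = ennreal I"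
    using P I(2) by (simp add: nn_integral_cmult_indicator vol ennreal_mult[symmetric])
  finally show False using I by simp
qed

lemma sum_powr_geometric_le:
  fixes \<eta> :: real
  assumes "0 < \<eta>"
  shows "(\<Sum>j\<le>J. 2 powr (real j * \<eta>)) \<le> 2 powr \<eta> / (2 powr \<eta> - 1) * 2 powr (real J * \<eta>)"
proof -
  let ?b = "2 powr \<eta>"
  have b: "?b > 1" using assms by simp
  have pw: "2 powr (real k * \<eta>) = ?b ^ k" for k
    by (simp add: powr_powr[symmetric] powr_realpow mult.commute[of _ \<eta>])
  have "(\<Sum>j\<le>J. ?b ^ j) = (?b ^ Suc J - 1) / (?b - 1)"
    using b by (subst lessThan_Suc_atMost[symmetric], subst geometric_sum) auto
  also have "\<dots> \<le> ?b ^ Suc J / (?b - 1)" using b by (intro divide_right_mono) auto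
  finally show ?thesis unfolding pw by simp
qed

lemma sum_powr_geometric_decay:
  fixes \<delta> :: real
  assumes "0 < \<delta>"
  shows "(\<Sum>j\<le>J. 2 powr (- (real j * \<delta>))) \<le> 1 / (1 - 2 powr (- \<delta>))"
proof -
  let ?b = "2 powr (- \<delta>)"
  have b: "0 < ?b" "?b < 1" using assms by (auto simp: powr_less_one)
  have pw: "2 powr (- (real k * \<delta>)) = ?b ^ k" for k
  proof -
    have "2 powr (- (real k * \<delta>)) = (2 powr (- \<delta>)) powr real k" by (simp add: powr_powr mult.commute)
    also have "\<dots> = ?b ^ k" by (rule powr_realpow) simp
    finally show ?thesis .
  qed
  have "(\<Sum>j\<le>J. ?b ^ j) = (1 - ?b ^ Suc J) / (1 - ?b)"
    using b by (subst lessThan_Suc_atMost[symmetric], subst sum_gp_strict) auto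
  also have "\<dots> \<le> 1 / (1 - ?b)" using b by (intro divide_right_mono) auto
  finally show ?thesis unfolding pw .
qed

lemma dyadic_level:
  assumes "1 < T"
  obtains J where "T \<le> 2 ^ J" "(2::real) ^ J \<le> 2 * T"
proof -
  obtain k0 where "T < 2 ^ k0" using real_arch_pow[of 2 T] by auto
  define J where "J = (LEAST n. T \<le> 2 ^ n)"
  have J: "T \<le> 2 ^ J" unfolding J_def using \<open>T < 2 ^ k0\<close> by (intro LeastI[of "\<lambda>n. T \<le> 2 ^ n" k0]) simp
  have "J \<noteq> 0" using J assms by (auto intro: ccontr)
  then obtain k where k: "J = Suc k" by (cases J) auto
  have "\<not> T \<le> 2 ^ k" using not_less_Least[of k "\<lambda>n. T \<le> 2 ^ n"] k unfolding J_def by simp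
  then have "(2::real) ^ J \<le> 2 * T" using k by simp
  with J show thesis by (rule that)
qed

text \<open>Either \<open>h\<close> is at most \<open>\<mu> 2\<^bsup>j/\<gamma>\<^esup>\<close>, or one trades a power of \<open>h\<close> for
  decay in \<open>j\<close>.\<close>

lemma level_dichotomy:
  fixes h :: real
  assumes "0 \<le> h" "h powr (1 + \<kappa>) \<le> B * 2 powr (real j * d)" "0 < \<mu>" "0 < \<gamma>" "0 < \<kappa>" "0 \<le> B"
  shows "2 powr (- real j) * h \<le> \<mu> * 2 powr (real j * (1 / \<gamma> - 1)) +
     B * \<mu> powr (- \<kappa>) * 2 powr (- (real j * (\<kappa> / \<gamma> - (d - 1))))"
proof (cases "h \<le> \<mu> * 2 powr (real j / \<gamma>)")
  case True
  have "2 powr (- real j) * h \<le> 2 powr (- real j) * (\<mu> * 2 powr (real j / \<gamma>))"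
    using True by (intro mult_left_mono) auto
  also have "\<dots> = \<mu> * 2 powr (real j * (1 / \<gamma> - 1))"
    by (simp add: powr_add[symmetric] mult.left_commute algebra_simps)
  finally show ?thesis using assms(6) by (simp add: add_increasing2)
next
  case False
  then have h: "0 < h" "\<mu> * 2 powr (real j / \<gamma>) \<le> h" using assms(1,3)
    by (auto simp: not_le intro: less_trans[rotated])
  \<comment> \<open>The positive power is controlled by the average, and the negative power by the
    lower bound on \<open>h\<close> that defines this case.\<close>
  have "h = h powr (1 + \<kappa>) * h powr (- \<kappa>)" using h(1) by (simp add: powr_add[symmetric])
  also have "\<dots> \<le> (B * 2 powr (real j * d)) * (\<mu> * 2 powr (real j / \<gamma>)) powr (- \<kappa>)"
    using assms h by (intro mult_mono powr_mono2') auto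
  also have "(\<mu> * 2 powr (real j / \<gamma>)) powr (- \<kappa>) = \<mu> powr (- \<kappa>) * 2 powr (- (real j * \<kappa> / \<gamma>))"
    using assms(3) by (simp add: powr_mult powr_powr)
  finally have "2 powr (- real j) * h \<le> 2 powr (- real j) * ((B * 2 powr (real j * d)) * (\<mu> powr (- \<kappa>) * 2 powr (- (real j * \<kappa> / \<gamma>))))"
    by (intro mult_left_mono) auto
  also have "\<dots> = B * \<mu> powr (- \<kappa>) * (2 powr (- real j) * (2 powr (real j * d) * 2 powr (- (real j * \<kappa> / \<gamma>))))"
    by (simp add: mult_ac)
  also have "2 powr (- real j) * (2 powr (real j * d) * 2 powr (- (real j * \<kappa> / \<gamma>))) = 2 powr (- (real j * (\<kappa> / \<gamma> - (d - 1))))"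
    by (simp add: powr_add[symmetric] algebra_simps)
  finally show ?thesis using assms(3) by (simp add: add_increasing)
qed

text \<open>Telescoping along x, z_0, ..., z_J, y. Since z_j is within R / 2^j of \<open>y\<close>,
  the first link has length at most 2 R, the link from z_j at most 2 R / 2^j, and the last one at
  most R / 2^J. An interior point takes part in two links, with coefficients 4 and 2, hence the
  6.\<close>

lemma chain_estimate:
  fixes u H :: "'a::real_normed_vector \<Rightarrow> real" and z :: "nat \<Rightarrow> 'a"
  assumes hyp: "\<And>x y. x \<in> S \<Longrightarrow> y \<in> S \<Longrightarrow> norm (x - y) \<le> 2 * R \<Longrightarrow> \<bar>u x - u y\<bar> \<le> norm (x - y) * (H x + H y)"
    and H: "\<And>x. 0 \<le> H x" and R: "R = norm (x - y)"
    and S: "x \<in> S" "y \<in> S" "\<And>j. z j \<in> S" and z: "\<And>j. norm (z j - y) \<le> R / 2 ^ j"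
  shows "\<bar>u x - u y\<bar> \<le> R * (2 * H x + 6 * (\<Sum>j\<le>J. H (z j) / 2 ^ j) + H y / 2 ^ J)"
proof -
  have R0: "0 \<le> R" using R by simp
  \<comment> \<open>The current endpoint has received only its incoming link and carries the
    coefficient 4; the next link raises it to 6.\<close>
  have step: "\<bar>u x - u (z J)\<bar> \<le> 2 * R * H x + (\<Sum>j<J. 6 * (R / 2 ^ j) * H (z j)) + 4 * (R / 2 ^ J) * H (z J)" for J
  proof (induction J)
    case 0
    have "norm (x - z 0) \<le> norm (x - y) + norm (z 0 - y)"
      using norm_triangle_ineq4[of "x - y" "z 0 - y"] by simp
    then have le: "norm (x - z 0) \<le> 2 * R" using z[of 0] R by simp
    have "\<bar>u x - u (z 0)\<bar> \<le> norm (x - z 0) * (H x + H (z 0))" by (rule hyp[OF S(1,3) le])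
    also have "\<dots> \<le> 2 * R * (H x + H (z 0))" using le H by (intro mult_right_mono) auto
    also have "\<dots> \<le> 2 * R * H x + 4 * R * H (z 0)"
      using mult_nonneg_nonneg[OF R0 H[of "z 0"]] by (simp add: distrib_left)
    finally show ?case by simp
  next
    case (Suc J)
    have "R / 2 ^ Suc J \<le> R / 2 ^ J" using R0 by (simp add: field_simps)
    moreover have "norm (z J - z (Suc J)) \<le> norm (z J - y) + norm (z (Suc J) - y)"
      using norm_triangle_ineq4[of "z J - y" "z (Suc J) - y"] by simp
    ultimately have le: "norm (z J - z (Suc J)) \<le> 2 * (R / 2 ^ J)" using z[of J] z[of "Suc J"] by linarith
    have "R / 2 ^ J \<le> R" using R0 by (simp add: divide_le_eq mult_left_mono[of 1 _ R, simplified])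
    then have le': "norm (z J - z (Suc J)) \<le> 2 * R" using le by linarith
    have "\<bar>u (z J) - u (z (Suc J))\<bar> \<le> norm (z J - z (Suc J)) * (H (z J) + H (z (Suc J)))" by (rule hyp[OF S(3) S(3) le'])
    also have "\<dots> \<le> 2 * (R / 2 ^ J) * (H (z J) + H (z (Suc J)))" using le H by (intro mult_right_mono) auto
    finally have "\<bar>u x - u (z (Suc J))\<bar> \<le> \<bar>u x - u (z J)\<bar> + 2 * (R / 2 ^ J) * (H (z J) + H (z (Suc J)))" by linarith
    moreover have "2 * (R / 2 ^ J) * (H (z J) + H (z (Suc J))) = 2 * ((R / 2 ^ J) * H (z J)) + 4 * (R / 2 ^ Suc J) * H (z (Suc J))"
      by (simp add: field_simps)
    moreover have "4 * (R / 2 ^ J) * H (z J) = 4 * ((R / 2 ^ J) * H (z J))" "6 * (R / 2 ^ J) * H (z J) = 6 * ((R / 2 ^ J) * H (z J))"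
      by simp_all
    ultimately show ?case using Suc unfolding sum.lessThan_Suc by linarith
  qed
  have "R / 2 ^ J \<le> R" using R0 by (simp add: divide_le_eq mult_left_mono[of 1 _ R, simplified])
  then have le: "norm (z J - y) \<le> 2 * R" using z[of J] R0 by linarith
  have "\<bar>u (z J) - u y\<bar> \<le> norm (z J - y) * (H (z J) + H y)" by (rule hyp[OF S(3,2) le])
  also have "\<dots> \<le> (R / 2 ^ J) * (H (z J) + H y)" using z H by (intro mult_right_mono) auto
  finally have "\<bar>u x - u y\<bar> \<le> 2 * R * H x + (\<Sum>j<J. 6 * (R / 2 ^ j) * H (z j)) + 4 * (R / 2 ^ J) * H (z J) + (R / 2 ^ J) * (H (z J) + H y)"
    using step[of J] by linarith
  also have "\<dots> \<le> 2 * R * H x + ((\<Sum>j<J. 6 * (R / 2 ^ j) * H (z j)) + 6 * (R / 2 ^ J) * H (z J)) + (R / 2 ^ J) * H y"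
  proof -
    have "0 \<le> (R / 2 ^ J) * H (z J)" using R0 H by simp
    moreover have "4 * (R / 2 ^ J) * H (z J) = 4 * ((R / 2 ^ J) * H (z J))" "6 * (R / 2 ^ J) * H (z J) = 6 * ((R / 2 ^ J) * H (z J))"
      "(R / 2 ^ J) * (H (z J) + H y) = (R / 2 ^ J) * H (z J) + (R / 2 ^ J) * H y"
      by (simp_all only: mult.assoc distrib_left)
    ultimately show ?thesis by linarith
  qed
  also have "(\<Sum>j<J. 6 * (R / 2 ^ j) * H (z j)) + 6 * (R / 2 ^ J) * H (z J) = (\<Sum>j\<le>J. 6 * (R / 2 ^ j) * H (z j))"
    by (simp add: lessThan_Suc_atMost[symmetric])
  also have "(\<Sum>j\<le>J. 6 * (R / 2 ^ j) * H (z j)) = R * (6 * (\<Sum>j\<le>J. H (z j) / 2 ^ j))"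
    by (simp add: sum_distrib_left mult_ac)
  finally show ?thesis by (simp add: algebra_simps)
qed

definition hajlasz_gradient :: "(real^'n) set \<Rightarrow> (real^'n \<Rightarrow> real) \<Rightarrow> (real^'n \<Rightarrow> real) \<Rightarrow> bool" where
  "hajlasz_gradient S u H \<longleftrightarrow> H \<in> borel_measurable lebesgue \<and> (\<forall>z. 0 \<le> H z) \<and> (AE z in lebesgue. z \<in> S) \<and>
     (\<forall>x\<in>S. \<forall>y\<in>S. norm (x - y) < real CARD('n) + 1 \<longrightarrow> \<bar>u x - u y\<bar> \<le> norm (x - y) * (H x + H y))"

text \<open>The parameter \<mu> carries the scaling: multiplying \<open>u\<close>, \<open>H\<close>
  and \<mu> by one positive factor multiplies both sides by it. With the norm of the gradient as
  \<mu> this yields bounds that are linear in that norm.\<close>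

definition asymmetric_bound ::
  "real \<Rightarrow> real \<Rightarrow> real \<Rightarrow> real \<Rightarrow> (real^'n \<Rightarrow> real) \<Rightarrow> (real^'n \<Rightarrow> real) \<Rightarrow> real^'n \<Rightarrow> real^'n \<Rightarrow> bool" where
  "asymmetric_bound C \<gamma> \<kappa> \<mu> u H x y \<longleftrightarrow> ennreal \<bar>u x - u y\<bar> \<le> ennreal (norm (x - y)) *
     ((ennreal (2 * H x) + ennreal (C * \<mu> powr (- \<kappa>)) * maxf (\<lambda>z. H z powr (1 + \<kappa>)) x) +
       ennreal (C * \<mu> powr \<gamma> * H y powr (1 - \<gamma>)))"

text \<open>The chain runs from \<open>y\<close> to \<open>x\<close> through points \<open>z\<^sub>j\<close> of \<open>B(y, 2\<^sup>-\<^sup>j |x - y|)\<close> at which \<open>H\<close> is at most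
  average, and stops at the scale where \<open>2\<^sup>-\<^sup>J H(y)\<close> drops below \<open>\<mu>\<^sup>\<gamma> H(y)\<^bsup>1 - \<gamma>\<^esup>\<close>.\<close>

lemma asymmetric_estimate:
  fixes \<gamma> \<kappa> :: real
  assumes \<gamma>: "0 < \<gamma>" "\<gamma> < 1" and \<kappa>: "0 < \<kappa>" "\<gamma> * (real CARD('n) - 1) < \<kappa>"
  obtains C where "C > 0" "\<And>(u :: real^'n::finite \<Rightarrow> real) H S \<mu> x y.
    hajlasz_gradient S u H \<Longrightarrow> 0 < \<mu> \<Longrightarrow> x \<in> S \<Longrightarrow> y \<in> S \<Longrightarrow> 2 * norm (x - y) < real CARD('n) + 1 \<Longrightarrow>
    asymmetric_bound C \<gamma> \<kappa> \<mu> u H x y"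
proof -
  let ?d = "CARD('n)"
  define V where "V = unit_ball_vol (real ?d)"
  have V: "V > 0" unfolding V_def by simp
  define \<eta> where "\<eta> = 1 / \<gamma> - 1"
  define \<delta> where "\<delta> = \<kappa> / \<gamma> - (real ?d - 1)"
  have \<eta>: "\<eta> > 0" using \<gamma> by (simp add: \<eta>_def)
  have \<delta>: "\<delta> > 0" using \<gamma> \<kappa> by (simp add: \<delta>_def field_simps)
  \<comment> \<open>In both constants the 6 comes from the chain. In \<open>c2\<close> the factor
    \<open>2 ^ ?d / V\<close> compares averages about \<open>y\<close> with integrals over the ball
    of radius 2 R about \<open>x\<close>, and the rest sums the decaying series. In
    \<open>c3\<close> the 1 pays for the last link, and the final \<open>2 powr \<eta>\<close> for
    rounding the stopping scale up to a power of 2.\<close>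
  define c2 where "c2 = 6 * (2 ^ ?d / V) * (1 / (1 - 2 powr (- \<delta>)))"
  define c3 where "c3 = 1 + 6 * (2 powr \<eta> / (2 powr \<eta> - 1) * 2 powr \<eta>)"
  have b1: "1 - 2 powr (- \<delta>) > 0" using \<delta> by (simp add: powr_less_one)
  have b2: "2 powr \<eta> - 1 > 0" using \<eta> by simp
  have c2: "c2 > 0" unfolding c2_def using V b1 by (intro mult_pos_pos divide_pos_pos) auto
  have c3: "c3 \<ge> 1" unfolding c3_def using b2 by (simp add: less_imp_le)
  define C where "C = c2 + c3"
  have C: "C > 0" "c2 \<le> C" "c3 \<le> C" "1 \<le> C" using c2 c3 by (auto simp: C_def)
  show thesis
  proof (rule that[OF C(1)])
    fix u H :: "real^'n \<Rightarrow> real" and S :: "(real^'n) set" and \<mu> :: real and x y :: "real^'n"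
    assume hg: "hajlasz_gradient S u H" and \<mu>: "0 < \<mu>" and xS: "x \<in> S" and yS: "y \<in> S" and xy: "2 * norm (x - y) < real ?d + 1"
    have Hm [measurable]: "H \<in> borel_measurable lebesgue" and H: "\<And>z. 0 \<le> H z" and S: "AE z in lebesgue. z \<in> S"
      and hyp: "\<And>x y. x \<in> S \<Longrightarrow> y \<in> S \<Longrightarrow> norm (x - y) < real ?d + 1 \<Longrightarrow> \<bar>u x - u y\<bar> \<le> norm (x - y) * (H x + H y)"
      using hg unfolding hajlasz_gradient_def by blast+
    define R where "R = norm (x - y)"
    let ?w = "\<lambda>z. H z powr (1 + \<kappa>)"
    let ?M = "maxf ?w x"
    let ?b = "\<mu> powr \<gamma> * H y powr (1 - \<gamma>)"
    let ?rhs = "(ennreal (2 * H x) + ennreal (C * \<mu> powr (- \<kappa>)) * ?M) + ennreal (C * \<mu> powr \<gamma> * H y powr (1 - \<gamma>))"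
    have b0: "0 \<le> ?b" by simp
    have C\<mu>: "0 < C * \<mu> powr (- \<kappa>)" using C \<mu> by simp
    have "ennreal \<bar>u x - u y\<bar> \<le> ennreal (norm (x - y)) * ?rhs"
    proof (cases "x = y \<or> ?M = top")
      case True
      then show ?thesis
      proof
        assume "?M = top"
        then have "?rhs = top" using C(1) \<mu> by (simp add: ennreal_mult_top)
        then show ?thesis by (cases "x = y") (simp_all add: ennreal_mult_top)
      qed simp
    next
      case False
      then have R: "0 < R" and Mt: "?M \<noteq> top" by (auto simp: R_def)
      then obtain m where m: "?M = ennreal m" "0 \<le> m" by (cases ?M) auto
      have suff: "ennreal \<bar>u x - u y\<bar> \<le> ennreal (norm (x - y)) * ?rhs"
        if "\<bar>u x - u y\<bar> \<le> R * (2 * H x + C * \<mu> powr (- \<kappa>) * m + C * ?b)"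
      proof -
        have "ennreal \<bar>u x - u y\<bar> \<le> ennreal (R * (2 * H x + C * \<mu> powr (- \<kappa>) * m + C * ?b))"
          by (rule ennreal_leI[OF that])
        also have "\<dots> = ennreal R * (ennreal (2 * H x) + ennreal (C * \<mu> powr (- \<kappa>) * m) + ennreal (C * ?b))"
          using R H[of x] m(2) C(1) by (simp add: ennreal_mult ennreal_plus)
        also have "ennreal (C * \<mu> powr (- \<kappa>) * m) = ennreal (C * \<mu> powr (- \<kappa>)) * ?M"
          unfolding m(1) using C\<mu> m(2) by (intro ennreal_mult) auto
        finally show ?thesis by (simp only: R_def mult.assoc)
      qed
      have mterm: "0 \<le> C * \<mu> powr (- \<kappa>) * m" using C\<mu> m(2) by simp
      show ?thesis
      \<comment> \<open>In this case no chain is required: H(y) is itself at most \<mu>^\<gamma>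
        H(y)^(1 - \<gamma>), and the symmetric inequality suffices.\<close>
      proof (cases "H y \<le> \<mu>")
        case True
        have "H y \<le> ?b"
        proof (cases "H y = 0")
          case False
          then have Hy: "0 < H y" using H[of y] by simp
          have "H y = H y powr \<gamma> * H y powr (1 - \<gamma>)" using Hy by (simp add: powr_add[symmetric])
          also have "\<dots> \<le> ?b" using True Hy \<gamma> by (intro mult_right_mono powr_mono2) auto
          finally show ?thesis .
        qed simp
        also have "?b \<le> C * ?b" using mult_right_mono[OF C(4) b0] by simp
        finally have "H x + H y \<le> 2 * H x + C * \<mu> powr (- \<kappa>) * m + C * ?b"
          using mterm H[of x] by linarith
        then have "R * (H x + H y) \<le> R * (2 * H x + C * \<mu> powr (- \<kappa>) * m + C * ?b)"
          using R by (intro mult_left_mono) auto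
        moreover have "\<bar>u x - u y\<bar> \<le> R * (H x + H y)"
          unfolding R_def using xy by (intro hyp xS yS) (use norm_ge_zero[of "x - y"] in linarith)
        ultimately show ?thesis by (intro suff) linarith
      next
        case False
        then have Hy: "0 < H y" "\<mu> < H y" using \<mu> by auto
        \<comment> \<open>This scale balances the two contributions at \<open>y\<close>: the last
          link costs H(y) / T, the growing series costs \<mu> T^\<eta>, and both equal
          \<mu>^\<gamma> H(y)^(1 - \<gamma>) because \<gamma> \<eta> = 1 - \<gamma>.\<close>
        define T where "T = (H y / \<mu>) powr \<gamma>"
        have "1 < H y / \<mu>" using Hy \<mu> by simp
        then have T: "1 < T" unfolding T_def using \<gamma> by (intro gr_one_powr) auto
        obtain J where J: "T \<le> 2 ^ J" "(2::real) ^ J \<le> 2 * T" using dyadic_level[OF T] by blast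
        have "\<forall>j. \<exists>z. z \<in> S \<and> z \<in> ball y (R / 2 ^ j) \<and>
            ennreal (V * (R / 2 ^ j) ^ ?d * ?w z) \<le> (\<integral>\<^sup>+z\<in>ball y (R / 2 ^ j). ennreal \<bar>?w z\<bar> \<partial>lebesgue)"
        proof
          fix j :: nat
          have "0 < R / 2 ^ j" using R by simp
          then obtain z where "z \<in> S" "z \<in> ball y (R / 2 ^ j)"
             "ennreal (unit_ball_vol (real ?d) * (R / 2 ^ j) ^ ?d * ?w z) \<le> (\<integral>\<^sup>+z\<in>ball y (R / 2 ^ j). ennreal \<bar>?w z\<bar> \<partial>lebesgue)"
            using exists_below_average[of ?w S "R / 2 ^ j" y] S by auto
          then show "\<exists>z. z \<in> S \<and> z \<in> ball y (R / 2 ^ j) \<and>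
            ennreal (V * (R / 2 ^ j) ^ ?d * ?w z) \<le> (\<integral>\<^sup>+z\<in>ball y (R / 2 ^ j). ennreal \<bar>?w z\<bar> \<partial>lebesgue)"
            unfolding V_def by blast
        qed
        from choice[OF this] obtain z where z': "\<forall>j. z j \<in> S \<and> z j \<in> ball y (R / 2 ^ j) \<and>
            ennreal (V * (R / 2 ^ j) ^ ?d * ?w (z j)) \<le> (\<integral>\<^sup>+z\<in>ball y (R / 2 ^ j). ennreal \<bar>?w z\<bar> \<partial>lebesgue)" ..
        have zS: "z j \<in> S" and zb: "norm (z j - y) \<le> R / 2 ^ j" for j
          using z' by (auto simp: dist_norm norm_minus_commute less_imp_le)
        define B where "B = 2 ^ ?d / V * m"
        have B: "0 \<le> B" using V m(2) by (simp add: B_def)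
        \<comment> \<open>Enlarging the small ball about \<open>y\<close> to the ball of radius 2 R
          about \<open>x\<close> moves the bound from \<open>y\<close> to \<open>x\<close>. The
          quotient of the volumes is the loss 2^(j d) against which \<delta> must be
          positive.\<close>
        have level: "?w (z j) \<le> B * 2 powr (real j * real ?d)" for j
        proof -
          have "R / 2 ^ j \<le> R" using R by (simp add: divide_le_eq)
          have "ball y (R / 2 ^ j) \<subseteq> ball x (2 * R)"
          proof
            fix q assume "q \<in> ball y (R / 2 ^ j)"
            then show "q \<in> ball x (2 * R)"
              using dist_triangle[of x q y] \<open>R / 2 ^ j \<le> R\<close> by (simp add: R_def dist_norm[of x y])
          qed
          then have "(\<integral>\<^sup>+z\<in>ball y (R / 2 ^ j). ennreal \<bar>?w z\<bar> \<partial>lebesgue) \<le> (\<integral>\<^sup>+z\<in>ball x (2 * R). ennreal \<bar>?w z\<bar> \<partial>lebesgue)"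
            by (intro nn_integral_mono mult_left_mono) (auto simp: indicator_def)
          also have "\<dots> \<le> ennreal ((2 * R) ^ ?d) * ?M"
            by (rule ball_integral_le_maxf) (use R xy in \<open>auto simp: R_def\<close>)
          also have "\<dots> = ennreal ((2 * R) ^ ?d * m)" unfolding m(1) using R m(2) by (simp add: ennreal_mult)
          finally have "ennreal (V * (R / 2 ^ j) ^ ?d * ?w (z j)) \<le> ennreal ((2 * R) ^ ?d * m)"
            using z' by (blast intro: order_trans)
          moreover have "0 \<le> (2 * R) ^ ?d * m" using R m(2) by simp
          ultimately have le: "V * (R / 2 ^ j) ^ ?d * ?w (z j) \<le> (2 * R) ^ ?d * m" by (simp add: ennreal_le_iff)
          have pw: "2 powr (real j * real ?d) = (2 ^ j) ^ ?d"
            by (simp add: powr_realpow[symmetric] powr_powr)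
          have "?w (z j) = (V * (R / 2 ^ j) ^ ?d * ?w (z j)) * ((2 ^ j) ^ ?d / (V * R ^ ?d))"
            using V R by (simp add: power_divide)
          also have "\<dots> \<le> ((2 * R) ^ ?d * m) * ((2 ^ j) ^ ?d / (V * R ^ ?d))"
            using V R by (intro mult_right_mono le) auto
          also have "\<dots> = B * 2 powr (real j * real ?d)"
            unfolding pw B_def using V R by (simp add: power_mult_distrib)
          finally show ?thesis .
        qed
        have termle: "H (z j) / 2 ^ j \<le> \<mu> * 2 powr (real j * \<eta>) + B * \<mu> powr (- \<kappa>) * 2 powr (- (real j * \<delta>))" for j
        proof -
          have "2 powr (- real j) * H (z j) = H (z j) / 2 ^ j"
            by (simp add: powr_minus powr_realpow divide_inverse mult.commute)
          then show ?thesis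
            using level_dichotomy[OF H level \<mu> \<gamma>(1) \<kappa>(1) B, of j] by (simp add: \<eta>_def \<delta>_def)
        qed
        have pow\<eta>: "2 powr (real J * \<eta>) \<le> 2 powr \<eta> * (H y / \<mu>) powr (1 - \<gamma>)"
        proof -
          have "2 powr (real J * \<eta>) = (2 ^ J) powr \<eta>" by (simp add: powr_realpow[symmetric] powr_powr)
          also have "\<dots> \<le> (2 * T) powr \<eta>" using J \<eta> by (intro powr_mono2) auto
          also have "\<dots> = 2 powr \<eta> * T powr \<eta>" using T by (simp add: powr_mult)
          also have "T powr \<eta> = (H y / \<mu>) powr (1 - \<gamma>)"
            unfolding T_def \<eta>_def using \<gamma> by (simp add: powr_powr right_diff_distrib)
          finally show ?thesis .
        qed
        have beq: "\<mu> * (H y / \<mu>) powr (1 - \<gamma>) = ?b"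
        proof -
          have "\<mu> * (H y / \<mu>) powr (1 - \<gamma>) = (\<mu> powr 1 / \<mu> powr (1 - \<gamma>)) * H y powr (1 - \<gamma>)"
            using \<mu> Hy by (simp add: powr_divide)
          also have "\<mu> powr 1 / \<mu> powr (1 - \<gamma>) = \<mu> powr \<gamma>" using \<mu> by (subst powr_diff[symmetric]) simp
          finally show ?thesis .
        qed
        have "(\<Sum>j\<le>J. H (z j) / 2 ^ j) \<le> (\<Sum>j\<le>J. \<mu> * 2 powr (real j * \<eta>) + B * \<mu> powr (- \<kappa>) * 2 powr (- (real j * \<delta>)))"
          by (intro sum_mono termle)
        also have "\<dots> = \<mu> * (\<Sum>j\<le>J. 2 powr (real j * \<eta>)) + B * \<mu> powr (- \<kappa>) * (\<Sum>j\<le>J. 2 powr (- (real j * \<delta>)))"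
          by (simp add: sum.distrib sum_distrib_left)
        also have "\<dots> \<le> \<mu> * (2 powr \<eta> / (2 powr \<eta> - 1) * (2 powr \<eta> * (H y / \<mu>) powr (1 - \<gamma>))) + B * \<mu> powr (- \<kappa>) * (1 / (1 - 2 powr (- \<delta>)))"
          using \<mu> B b2
          by (intro add_mono mult_left_mono order_trans[OF sum_powr_geometric_le[OF \<eta>]] sum_powr_geometric_decay \<delta> pow\<eta>) auto
        also have "\<mu> * (2 powr \<eta> / (2 powr \<eta> - 1) * (2 powr \<eta> * (H y / \<mu>) powr (1 - \<gamma>))) =
            (2 powr \<eta> / (2 powr \<eta> - 1) * 2 powr \<eta>) * ?b"
          unfolding beq[symmetric] by simp
        finally have "6 * (\<Sum>j\<le>J. H (z j) / 2 ^ j) \<le>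
            6 * ((2 powr \<eta> / (2 powr \<eta> - 1) * 2 powr \<eta>) * ?b + B * \<mu> powr (- \<kappa>) * (1 / (1 - 2 powr (- \<delta>))))"
          by (rule mult_left_mono) simp
        also have "\<dots> = (c3 - 1) * ?b + c2 * \<mu> powr (- \<kappa>) * m"
        proof -
          have "c3 - 1 = 6 * (2 powr \<eta> / (2 powr \<eta> - 1) * 2 powr \<eta>)" by (simp add: c3_def)
          moreover have "6 * (B * \<mu> powr (- \<kappa>) * (1 / (1 - 2 powr (- \<delta>)))) = c2 * \<mu> powr (- \<kappa>) * m"
            by (simp add: c2_def B_def)
          ultimately show ?thesis by (simp only: distrib_left mult.assoc)
        qed
        finally have sum: "6 * (\<Sum>j\<le>J. H (z j) / 2 ^ j) \<le> (c3 - 1) * ?b + c2 * \<mu> powr (- \<kappa>) * m" .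
        have last: "H y / 2 ^ J \<le> ?b"
        proof -
          have "H y / 2 ^ J \<le> H y / T" using J(1) T Hy by (intro divide_left_mono) auto
          also have "\<dots> = \<mu> * (H y / \<mu>) powr (1 - \<gamma>)"
            unfolding T_def using Hy \<mu> by (simp add: powr_diff)
          finally show ?thesis unfolding beq .
        qed
        have "\<bar>u x - u y\<bar> \<le> R * (2 * H x + 6 * (\<Sum>j\<le>J. H (z j) / 2 ^ j) + H y / 2 ^ J)"
          by (rule chain_estimate[where S=S]) (use hyp H xS yS zS zb xy in \<open>auto simp: R_def\<close>)
        also have "\<dots> \<le> R * (2 * H x + C * \<mu> powr (- \<kappa>) * m + C * ?b)"
        proof (intro mult_left_mono)
          have "c2 * \<mu> powr (- \<kappa>) * m \<le> C * \<mu> powr (- \<kappa>) * m" using C(2) m(2) by (intro mult_right_mono) auto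
          moreover have "c3 * ?b \<le> C * ?b" using C(3) b0 by (rule mult_right_mono)
          moreover have "(c3 - 1) * ?b + ?b = c3 * ?b" by (simp add: algebra_simps)
          ultimately show "2 * H x + 6 * (\<Sum>j\<le>J. H (z j) / 2 ^ j) + H y / 2 ^ J \<le> 2 * H x + C * \<mu> powr (- \<kappa>) * m + C * ?b"
            using sum last by linarith
        qed (use R in simp)
        finally show ?thesis by (rule suff)
      qed
    qed
    then show "asymmetric_bound C \<gamma> \<kappa> \<mu> u H x y" unfolding asymmetric_bound_def .
  qed
qed

subsection \<open>Convergence of powers and of maximal functions in \<open>L\<^sup>p\<close>\<close>

text \<open>The p-th power of the norm. It is additive only up to the factor
  \<open>2 powr p\<close>, but this replaces Minkowski's inequality wherever only convergence to 0
  matters.\<close>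

definition pint :: "real \<Rightarrow> (real^'n \<Rightarrow> real) \<Rightarrow> ennreal" where
  "pint p f = qint (\<lambda>x. ennreal (\<bar>f x\<bar> powr p))"

lemma pint_mono_AE:
  assumes "AE x in lebesgue. \<bar>f x\<bar> \<le> \<bar>g x\<bar>" "0 \<le> p"
  shows "pint p f \<le> pint p g"
  unfolding pint_def
  by (rule nn_integral_mono_AE, use assms(1) in eventually_elim)
     (use assms(2) in \<open>auto intro!: mult_right_mono ennreal_leI powr_mono2\<close>)

lemma pint_cong_AE:
  assumes "AE x in lebesgue. \<bar>f x\<bar> = \<bar>g x\<bar>"
  shows "pint p f = pint p g"
  unfolding pint_def by (rule nn_integral_cong_AE, use assms in eventually_elim) simp

lemma pint_cmult:
  assumes [measurable]: "f \<in> borel_measurable lebesgue"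
  shows "pint p (\<lambda>x. c * f x) = ennreal (\<bar>c\<bar> powr p) * pint p f"
proof -
  have "pint p (\<lambda>x. c * f x) = (\<integral>\<^sup>+x. ennreal (\<bar>c\<bar> powr p) * (ennreal (\<bar>f x\<bar> powr p) * indicator unit_cube x) \<partial>lebesgue)"
    unfolding pint_def by (intro nn_integral_cong) (simp add: abs_mult powr_mult ennreal_mult mult.assoc)
  also have "\<dots> = ennreal (\<bar>c\<bar> powr p) * pint p f"
    unfolding pint_def by (rule nn_integral_cmult) simp
  finally show ?thesis .
qed

lemma powr_add_le:
  fixes s t p :: real
  assumes "0 \<le> s" "0 \<le> t" "0 \<le> p"
  shows "(s + t) powr p \<le> 2 powr p * (s powr p + t powr p)"
proof -
  have "(s + t) powr p \<le> (2 * max s t) powr p" using assms by (intro powr_mono2) auto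
  also have "\<dots> = 2 powr p * max s t powr p" using assms by (simp add: powr_mult)
  also have "max s t powr p \<le> s powr p + t powr p" by (simp add: max_def)
  finally show ?thesis by simp
qed

lemma pint_add_le:
  assumes [measurable]: "f \<in> borel_measurable lebesgue" "g \<in> borel_measurable lebesgue"
    and le: "AE x in lebesgue. \<bar>h x\<bar> \<le> \<bar>f x\<bar> + \<bar>g x\<bar>" and "0 \<le> p"
  shows "pint p h \<le> ennreal (2 powr p) * (pint p f + pint p g)"
proof -
  have "pint p h \<le> (\<integral>\<^sup>+x. ennreal (2 powr p) * (ennreal (\<bar>f x\<bar> powr p) * indicator unit_cube x + ennreal (\<bar>g x\<bar> powr p) * indicator unit_cube x) \<partial>lebesgue)"
    unfolding pint_def
  proof (rule nn_integral_mono_AE, use le in eventually_elim)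
    fix x assume "\<bar>h x\<bar> \<le> \<bar>f x\<bar> + \<bar>g x\<bar>"
    then have "\<bar>h x\<bar> powr p \<le> (\<bar>f x\<bar> + \<bar>g x\<bar>) powr p" using \<open>0 \<le> p\<close> by (intro powr_mono2) auto
    also have "\<dots> \<le> 2 powr p * (\<bar>f x\<bar> powr p + \<bar>g x\<bar> powr p)" using \<open>0 \<le> p\<close> by (intro powr_add_le) auto
    finally have "ennreal (\<bar>h x\<bar> powr p) \<le> ennreal (2 powr p) * (ennreal (\<bar>f x\<bar> powr p) + ennreal (\<bar>g x\<bar> powr p))"
      by (simp add: ennreal_mult[symmetric] ennreal_plus[symmetric] ennreal_leI del: ennreal_plus)
    then show "ennreal (\<bar>h x\<bar> powr p) * indicator unit_cube x \<le> ennreal (2 powr p) * (ennreal (\<bar>f x\<bar> powr p) * indicator unit_cube x + ennreal (\<bar>g x\<bar> powr p) * indicator unit_cube x)"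
      by (simp add: indicator_def)
  qed
  also have "\<dots> = ennreal (2 powr p) * (pint p f + pint p g)"
    unfolding pint_def by (subst nn_integral_cmult, simp, subst nn_integral_add) auto
  finally show ?thesis .
qed

text \<open>By homogeneity only the ratio of \<open>s\<close> and \<open>t\<close> matters. If it is
  close to 1, continuity of the power at 1 gives the first term; otherwise both numbers are at most
  a multiple of their distance, which gives the second. The argument treats exponents below and
  above 1 alike.\<close>

lemma powr_diff_bound:
  fixes \<sigma> e :: real
  assumes "0 < \<sigma>" "0 < e"
  obtains K where "0 < K" "\<And>s t. 0 \<le> s \<Longrightarrow> 0 \<le> t \<Longrightarrow> \<bar>s powr \<sigma> - t powr \<sigma>\<bar> \<le> e * t powr \<sigma> + K * \<bar>s - t\<bar> powr \<sigma>"
proof -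
  have "isCont (\<lambda>x::real. x powr \<sigma>) 1" by (intro continuous_intros) auto
  then have "\<exists>\<delta>>0. \<forall>x. dist x 1 < \<delta> \<longrightarrow> dist (x powr \<sigma>) (1 powr \<sigma>) < e"
    unfolding continuous_at_eps_delta using \<open>0 < e\<close> by blast
  then obtain \<delta> where \<delta>: "\<delta> > 0" "\<And>x. \<bar>x - 1\<bar> < \<delta> \<Longrightarrow> \<bar>x powr \<sigma> - 1\<bar> < e"
    by (auto simp: dist_real_def)
  let ?K = "(1 + 1 / \<delta>) powr \<sigma>"
  show thesis
  proof (rule that[of ?K])
    have "0 < 1 + 1 / \<delta>" using \<delta>(1) by (simp add: add_pos_pos)
    then show "0 < ?K" by (metis less_irrefl powr_gt_zero)
    fix s t :: real assume st: "0 \<le> s" "0 \<le> t"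
    show "\<bar>s powr \<sigma> - t powr \<sigma>\<bar> \<le> e * t powr \<sigma> + ?K * \<bar>s - t\<bar> powr \<sigma>"
    proof (cases "\<bar>s - t\<bar> < \<delta> * t")
      case True
      then have t: "0 < t" using \<delta>(1) st by (cases "t = 0") auto
      have "\<bar>s / t - 1\<bar> = \<bar>s - t\<bar> / t" using t by (simp add: diff_divide_distrib[symmetric] abs_divide[symmetric] field_simps)
      also have "\<dots> < \<delta>" using True t by (simp add: divide_less_eq)
      finally have "\<bar>(s / t) powr \<sigma> - 1\<bar> < e" by (rule \<delta>(2))
      then have "\<bar>(s / t) powr \<sigma> - 1\<bar> * t powr \<sigma> \<le> e * t powr \<sigma>" by (intro mult_right_mono) auto
      moreover have "\<bar>(s / t) powr \<sigma> - 1\<bar> * t powr \<sigma> = \<bar>s powr \<sigma> - t powr \<sigma>\<bar>"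
      proof -
        have "\<bar>(s / t) powr \<sigma> - 1\<bar> * t powr \<sigma> = \<bar>((s / t) powr \<sigma> - 1) * t powr \<sigma>\<bar>" by (simp add: abs_mult)
        also have "((s / t) powr \<sigma> - 1) * t powr \<sigma> = s powr \<sigma> - t powr \<sigma>"
          using t st by (simp add: powr_divide left_diff_distrib)
        finally show ?thesis .
      qed
      ultimately have "\<bar>s powr \<sigma> - t powr \<sigma>\<bar> \<le> e * t powr \<sigma>" by simp
      moreover have "0 \<le> ?K * \<bar>s - t\<bar> powr \<sigma>" by simp
      ultimately show ?thesis by linarith
    next
      case False
      let ?D = "(1 + 1 / \<delta>) * \<bar>s - t\<bar>"
      have tD: "t \<le> \<bar>s - t\<bar> / \<delta>" using False \<delta>(1) by (simp add: field_simps)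
      then have "s \<le> ?D" "t \<le> ?D" using st by (auto simp: distrib_right)
      then have "s powr \<sigma> \<le> ?D powr \<sigma>" "t powr \<sigma> \<le> ?D powr \<sigma>" using st \<open>0 < \<sigma>\<close> by (auto intro!: powr_mono2)
      moreover have "?D powr \<sigma> = ?K * \<bar>s - t\<bar> powr \<sigma>" using \<delta>(1) by (simp add: powr_mult)
      moreover have "0 \<le> s powr \<sigma>" "0 \<le> t powr \<sigma>" "0 \<le> e * t powr \<sigma>" using \<open>0 < e\<close> by auto
      ultimately show ?thesis by linarith
    qed
  qed
qed

lemma pint_powr:
  assumes "\<And>x. 0 \<le> h x"
  shows "pint p (\<lambda>x. h x powr \<sigma>) = pint (\<sigma> * p) h"
  unfolding pint_def using assms by (simp add: powr_powr)

text \<open>In the bound of \<open>powr_diff_bound\<close> the term with \<open>e\<close> is small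
  because \<open>h\<close> has finite norm, uniformly in \<open>n\<close>; once \<open>e\<close> and
  therefore \<open>K\<close> are fixed, the other term tends to 0.\<close>

lemma tendsto_pint_powr:
  fixes h :: "real^'n::finite \<Rightarrow> real" and hn :: "nat \<Rightarrow> real^'n \<Rightarrow> real"
  assumes [measurable]: "h \<in> borel_measurable lebesgue" "\<And>n. hn n \<in> borel_measurable lebesgue"
    and nonneg: "\<And>x. 0 \<le> h x" "\<And>n x. 0 \<le> hn n x" and pos: "0 < \<sigma>" "0 < p"
    and fin: "pint (\<sigma> * p) h < \<infinity>" and lim: "(\<lambda>n. pint (\<sigma> * p) (\<lambda>x. hn n x - h x)) \<longlonglongrightarrow> 0"
  shows "(\<lambda>n. pint p (\<lambda>x. hn n x powr \<sigma> - h x powr \<sigma>)) \<longlonglongrightarrow> 0"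
proof (rule tendsto_zero_ennreal)
  fix r :: real assume r: "0 < r"
  obtain I where I: "pint (\<sigma> * p) h = ennreal I" "0 \<le> I" using fin by (cases "pint (\<sigma> * p) h") auto
  \<comment> \<open>Makes the first term less than \<open>r / 2\<close> after the factor
    \<open>2 powr p\<close>; \<open>I + 1\<close> in place of \<open>I\<close> avoids division by
    0.\<close>
  define e where "e = (r / (2 * 2 powr p * (I + 1))) powr (1 / p)"
  have r1: "0 < r / (2 * 2 powr p * (I + 1))" using r I(2) by (intro divide_pos_pos mult_pos_pos) auto
  have e: "0 < e" using r1 unfolding e_def by (metis less_irrefl powr_gt_zero)
  have ep: "e powr p = r / (2 * 2 powr p * (I + 1))" 
  proof -
    have "e powr p = (r / (2 * 2 powr p * (I + 1))) powr (1 / p * p)" by (simp only: e_def powr_powr)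
    also have "1 / p * p = 1" using pos by simp
    also have "(r / (2 * 2 powr p * (I + 1))) powr 1 = r / (2 * 2 powr p * (I + 1))" by (rule powr_one) (rule less_imp_le[OF r1])
    finally show ?thesis .
  qed
  obtain K where K: "0 < K" "\<And>s t. 0 \<le> s \<Longrightarrow> 0 \<le> t \<Longrightarrow> \<bar>s powr \<sigma> - t powr \<sigma>\<bar> \<le> e * t powr \<sigma> + K * \<bar>s - t\<bar> powr \<sigma>"
    using powr_diff_bound[OF pos(1) e] by blast
  define r2 where "r2 = r / (2 * 2 powr p * K powr p)"
  have r2: "0 < r2" unfolding r2_def using r K by (intro divide_pos_pos mult_pos_pos) auto
  have "\<forall>\<^sub>F n in sequentially. pint (\<sigma> * p) (\<lambda>x. hn n x - h x) < ennreal r2"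
    using lim r2 by (intro order_tendstoD) auto
  then show "\<forall>\<^sub>F n in sequentially. pint p (\<lambda>x. hn n x powr \<sigma> - h x powr \<sigma>) < ennreal r"
  proof eventually_elim
    case (elim n)
    have "pint p (\<lambda>x. hn n x powr \<sigma> - h x powr \<sigma>) \<le>
       ennreal (2 powr p) * (pint p (\<lambda>x. e * h x powr \<sigma>) + pint p (\<lambda>x. K * \<bar>hn n x - h x\<bar> powr \<sigma>))"
      using K nonneg e pos by (intro pint_add_le) auto
    also have "pint p (\<lambda>x. e * h x powr \<sigma>) = ennreal (e powr p) * pint (\<sigma> * p) h"
      using e nonneg by (subst pint_cmult) (auto simp: pint_powr)
    also have "pint p (\<lambda>x. K * \<bar>hn n x - h x\<bar> powr \<sigma>) = ennreal (K powr p) * pint (\<sigma> * p) (\<lambda>x. hn n x - h x)"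
    proof -
      have "pint p (\<lambda>x. K * \<bar>hn n x - h x\<bar> powr \<sigma>) = ennreal (\<bar>K\<bar> powr p) * pint p (\<lambda>x. \<bar>hn n x - h x\<bar> powr \<sigma>)"
        by (rule pint_cmult) simp
      also have "pint p (\<lambda>x. \<bar>hn n x - h x\<bar> powr \<sigma>) = pint (\<sigma> * p) (\<lambda>x. \<bar>hn n x - h x\<bar>)" by (rule pint_powr) simp
      also have "\<dots> = pint (\<sigma> * p) (\<lambda>x. hn n x - h x)" by (rule pint_cong_AE) simp
      finally show ?thesis using K(1) by simp
    qed
    also have "ennreal (2 powr p) * (ennreal (e powr p) * pint (\<sigma> * p) h + ennreal (K powr p) * pint (\<sigma> * p) (\<lambda>x. hn n x - h x))
      \<le> ennreal (2 powr p) * (ennreal (e powr p) * ennreal I + ennreal (K powr p) * ennreal r2)"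
      using elim by (intro mult_left_mono add_mono) (auto simp: I(1) less_imp_le)
    also have "\<dots> = ennreal (2 powr p * (e powr p * I + K powr p * r2))"
      using I(2) r2 by (simp add: ennreal_mult ennreal_plus)
    also have "\<dots> < ennreal r"
    proof (rule ennreal_lessI[OF r])
      have p2: "2 powr p > 0" by simp
      have "2 powr p * (e powr p * I) = r / 2 * (I / (I + 1))" 
      proof -
        have gen: "P * (r / (2 * P * Q) * I) = r / 2 * (I / Q)" if "P \<noteq> 0" "Q \<noteq> 0" for P Q :: real using that by simp
        show ?thesis unfolding ep by (rule gen) (use I(2) in auto)
      qed
      also have "\<dots> < r / 2 * 1" using r I(2) by (intro mult_strict_left_mono) (auto simp: divide_less_eq)
      finally have "2 powr p * (e powr p * I) < r / 2" by simp
      moreover have "2 powr p * (K powr p * r2) = r / 2" unfolding r2_def using K(1) by simp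
      ultimately show "2 powr p * (e powr p * I + K powr p * r2) < r" by (simp add: distrib_left)
    qed
    finally show ?case .
  qed
qed

lemma tendsto_pint_mult:
  fixes h :: "real^'n::finite \<Rightarrow> real" and hn :: "nat \<Rightarrow> real^'n \<Rightarrow> real"
  assumes [measurable]: "h \<in> borel_measurable lebesgue" "\<And>n. hn n \<in> borel_measurable lebesgue"
    and p: "0 < p" and fin: "pint p h < \<infinity>" and lim: "(\<lambda>n. pint p (\<lambda>x. hn n x - h x)) \<longlonglongrightarrow> 0"
    and c: "cn \<longlonglongrightarrow> c"
  shows "(\<lambda>n. pint p (\<lambda>x. cn n * hn n x - c * h x)) \<longlonglongrightarrow> 0"
proof (rule tendsto_0_le_ennreal)
  have "(\<lambda>n. \<bar>cn n\<bar> powr p) \<longlonglongrightarrow> \<bar>c\<bar> powr p"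
    using p by (intro tendsto_powr' tendsto_intros c) auto
  then have t1: "(\<lambda>n. ennreal (\<bar>cn n\<bar> powr p)) \<longlonglongrightarrow> ennreal (\<bar>c\<bar> powr p)" by (rule tendsto_ennrealI)
  have "(\<lambda>n. \<bar>cn n - c\<bar> powr p) \<longlonglongrightarrow> \<bar>c - c\<bar> powr p"
    using p by (intro tendsto_powr' tendsto_intros c) auto
  from tendsto_ennrealI[OF this] have t2: "(\<lambda>n. ennreal (\<bar>cn n - c\<bar> powr p)) \<longlonglongrightarrow> 0" using p by simp
  have "(\<lambda>n. ennreal (2 powr p) * (ennreal (\<bar>cn n\<bar> powr p) * pint p (\<lambda>x. hn n x - h x) + ennreal (\<bar>cn n - c\<bar> powr p) * pint p h)) \<longlonglongrightarrow>
    ennreal (2 powr p) * (ennreal (\<bar>c\<bar> powr p) * 0 + 0 * pint p h)"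
    using fin by (intro tendsto_mult_ennreal tendsto_add tendsto_const t1 t2 lim) auto
  then show "(\<lambda>n. ennreal (2 powr p) * (ennreal (\<bar>cn n\<bar> powr p) * pint p (\<lambda>x. hn n x - h x) + ennreal (\<bar>cn n - c\<bar> powr p) * pint p h)) \<longlonglongrightarrow> 0"
    by simp
  fix n
  have "pint p (\<lambda>x. cn n * hn n x - c * h x) \<le> ennreal (2 powr p) * (pint p (\<lambda>x. cn n * (hn n x - h x)) + pint p (\<lambda>x. (cn n - c) * h x))"
  proof (rule pint_add_le)
    have "\<bar>cn n * hn n x - c * h x\<bar> \<le> \<bar>cn n * (hn n x - h x)\<bar> + \<bar>(cn n - c) * h x\<bar>" for x
      using abs_triangle_ineq[of "cn n * (hn n x - h x)" "(cn n - c) * h x"] by (simp add: algebra_simps)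
    then show "AE x in lebesgue. \<bar>cn n * hn n x - c * h x\<bar> \<le> \<bar>cn n * (hn n x - h x)\<bar> + \<bar>(cn n - c) * h x\<bar>" by simp
  qed (use p in auto)
  also have "\<dots> = ennreal (2 powr p) * (ennreal (\<bar>cn n\<bar> powr p) * pint p (\<lambda>x. hn n x - h x) + ennreal (\<bar>cn n - c\<bar> powr p) * pint p h)"
    by (simp add: pint_cmult)
  finally show "pint p (\<lambda>x. cn n * hn n x - c * h x) \<le> \<dots>" .
qed

section \<open>Norms of extended-real functions and real-valued maximal functions\<close>

lemma enn_powr_zero_iff: "enn_powr t p = 0 \<longleftrightarrow> t = 0"
  by (cases t) (auto simp: enn_powr_def)

lemma enn_powr_powr: "0 < p \<Longrightarrow> 0 < s \<Longrightarrow> enn_powr (enn_powr t p) s = enn_powr t (p * s)"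
  by (cases t) (auto simp: enn_powr_def powr_powr)

lemma enn_powr_1: "enn_powr t 1 = t"
  by (cases t) (auto simp: enn_powr_def)

lemma tendsto_enn_powr_zero:
  assumes "(\<lambda>n. f n) \<longlonglongrightarrow> (0 :: ennreal)" "0 < s"
  shows "(\<lambda>n. enn_powr (f n) s) \<longlonglongrightarrow> 0"
proof (rule tendsto_zero_ennreal)
  fix r :: real assume r: "0 < r"
  let ?e = "(r / 2) powr (1 / s)"
  have "\<forall>\<^sub>F n in sequentially. f n < ennreal ?e" using assms(1) r by (intro order_tendstoD) auto
  then show "\<forall>\<^sub>F n in sequentially. enn_powr (f n) s < ennreal r"
  proof eventually_elim
    case (elim n)
    have "enn_powr (f n) s \<le> enn_powr (ennreal ?e) s" using elim assms(2) by (intro enn_powr_mono) auto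
    also have "\<dots> = ennreal (r / 2)" using r assms(2) by (simp add: enn_powr_ennreal powr_powr)
    also have "\<dots> < ennreal r" using r by (intro ennreal_lessI) auto
    finally show ?case .
  qed
qed

lemma abs_Lp_norm_pint: "abs_Lp_norm p f = enn_powr (pint p (\<lambda>x. norm (f x))) (1 / p)"
  unfolding Lp_norm_def pint_def by (simp add: enn_powr_ennreal)

lemma pint_eq_abs_Lp_norm:
  assumes "0 < p" shows "pint p (\<lambda>x. norm (f x)) = enn_powr (abs_Lp_norm p f) p"
  unfolding abs_Lp_norm_pint using assms by (simp add: enn_powr_powr enn_powr_1)

lemma Lp_norm_cong_AE:
  assumes "AE x in lebesgue. F x = G x" shows "Lp_norm p F = Lp_norm p G"
  unfolding Lp_norm_def
  by (rule arg_cong[where f="\<lambda>t. enn_powr t (1 / p)"], rule nn_integral_cong_AE, use assms in eventually_elim) simp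

text \<open>The cube has measure 1. In place of Hoelder's inequality, Young's inequality is applied
  pointwise after dividing by the larger norm \<open>L\<close>; the right-hand side then integrates
  to exactly \<open>L powr p\<close>.\<close>

lemma Lp_norm_mono_exponent:
  fixes F :: "real^'n::finite \<Rightarrow> ennreal"
  assumes [measurable]: "F \<in> borel_measurable lebesgue" and p: "0 < p" "p \<le> p'"
  shows "Lp_norm p F \<le> Lp_norm p' F"
proof (cases "qint (\<lambda>x. enn_powr (F x) p')")
  case top
  then show ?thesis by (simp add: Lp_norm_def enn_powr_def)
next
  case (real N)
  have p': "0 < p'" using p by simp
  show ?thesis
  proof (cases "N = 0")
    case True
    then have "AE x in lebesgue. enn_powr (F x) p' * indicator unit_cube x = 0"
      using real by (subst nn_integral_0_iff_AE[symmetric]) auto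
    then have "AE x in lebesgue. enn_powr (F x) p * indicator unit_cube x = 0"
      by eventually_elim (auto simp: enn_powr_zero_iff)
    then have "qint (\<lambda>x. enn_powr (F x) p) = 0" by (subst nn_integral_0_iff_AE) auto
    then show ?thesis by (simp add: Lp_norm_def enn_powr_def)
  next
    case False
    then have N: "0 < N" using real by simp
    define L where "L = N powr (1 / p')"
    have L: "0 < L" "L powr p' = N" using N p' by (auto simp: L_def powr_powr)
    let ?\<alpha> = "p / p'"
    have \<alpha>: "0 < ?\<alpha>" "?\<alpha> \<le> 1" using p p' by auto
    have ptw: "t powr p \<le> L powr p * (1 - ?\<alpha>) + ?\<alpha> * L powr p / N * t powr p'" if t: "0 \<le> t" for t
    proof (cases "t = 0")
      case False
      then have t0: "0 < t" using t by simp
      have "(t powr p' / N) powr ?\<alpha> * 1 powr (1 - ?\<alpha>) \<le> ?\<alpha> * (t powr p' / N) + (1 - ?\<alpha>) * 1"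
        using \<alpha> t0 N by (intro Youngs_inequality_0) auto
      also have "(t powr p' / N) powr ?\<alpha> * 1 powr (1 - ?\<alpha>) = t powr p / L powr p"
        using t0 N p p' L(1) by (simp add: powr_divide powr_powr L(2)[symmetric])
      finally have "t powr p / L powr p * L powr p \<le> (?\<alpha> * (t powr p' / N) + (1 - ?\<alpha>) * 1) * L powr p"
        by (intro mult_right_mono) auto
      then show ?thesis using L(1) by (simp add: algebra_simps)
    qed (use \<alpha> in simp)
    have nn1: "0 \<le> L powr p * (1 - ?\<alpha>)" using \<alpha> by simp
    have nn2: "0 < ?\<alpha> * L powr p / N" using N L(1) by (intro divide_pos_pos mult_pos_pos \<alpha>(1)) auto
    note nn = nn1 nn2
    have ptw': "enn_powr T p \<le> ennreal (L powr p * (1 - ?\<alpha>)) + ennreal (?\<alpha> * L powr p / N) * enn_powr T p'" for T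
    proof (cases T)
      case (real t)
      then have "enn_powr T p \<le> ennreal (L powr p * (1 - ?\<alpha>) + ?\<alpha> * L powr p / N * t powr p')"
        using ptw[of t] by (simp add: enn_powr_ennreal ennreal_leI)
      also have "\<dots> = ennreal (L powr p * (1 - ?\<alpha>)) + ennreal (?\<alpha> * L powr p / N) * ennreal (t powr p')"
        by (simp only: ennreal_plus[OF nn1 mult_nonneg_nonneg[OF less_imp_le[OF nn2] powr_ge_zero]] ennreal_mult[OF less_imp_le[OF nn2] powr_ge_zero])
      finally show ?thesis using real by (simp add: enn_powr_ennreal)
    next
      case top
      have "ennreal (?\<alpha> * L powr p / N) * top = top" 
      proof -
        have "ennreal (?\<alpha> * L powr p / N) \<noteq> 0" using nn2 by (simp only: ennreal_eq_0_iff not_le)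
        then show ?thesis by (simp only: ennreal_mult_top if_False)
      qed
      then show ?thesis using top by (simp add: enn_powr_def)
    qed
    have "qint (\<lambda>x. enn_powr (F x) p) \<le> (\<integral>\<^sup>+x. ennreal (L powr p * (1 - ?\<alpha>)) * indicator unit_cube x + ennreal (?\<alpha> * L powr p / N) * (enn_powr (F x) p' * indicator unit_cube x) \<partial>lebesgue)"
      using ptw' by (intro nn_integral_mono) (auto simp: indicator_def)
    also have "\<dots> = ennreal (L powr p * (1 - ?\<alpha>)) + ennreal (?\<alpha> * L powr p / N) * ennreal N"
      by (subst nn_integral_add, simp, simp, subst nn_integral_cmult, simp)
         (simp add: real nn_integral_cmult_indicator emeasure_unit_cube)
    also have "\<dots> = ennreal (L powr p * (1 - ?\<alpha>) + ?\<alpha> * L powr p / N * N)"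
      by (simp only: ennreal_plus[OF nn1 mult_nonneg_nonneg[OF less_imp_le[OF nn2] less_imp_le[OF N]]] ennreal_mult[OF less_imp_le[OF nn2] less_imp_le[OF N]])
    also have "L powr p * (1 - ?\<alpha>) + ?\<alpha> * L powr p / N * N = L powr p" using N by (simp add: algebra_simps)
    finally have "Lp_norm p F \<le> enn_powr (ennreal (L powr p)) (1 / p)"
      unfolding Lp_norm_def using p by (intro enn_powr_mono) auto
    also have "\<dots> = ennreal L" using L p by (simp add: enn_powr_ennreal powr_powr)
    also have "\<dots> = Lp_norm p' F" unfolding Lp_norm_def real(2) using N by (simp add: enn_powr_ennreal L_def)
    finally show ?thesis .
  qed
qed

text \<open>A real-valued version, for which differences make sense. Where \<open>maxf\<close> is
  infinite the value is 0; for periodic functions with finite L^p norm and p > 1 this concerns only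
  a null set.\<close>

definition mx :: "(real^'n \<Rightarrow> real) \<Rightarrow> real^'n \<Rightarrow> real" where
  "mx f x = enn2real (maxf f x)"

lemma mx_nonneg: "0 \<le> mx f x" by (simp add: mx_def)

lemma mx_measurable [measurable]:
  fixes f :: "real^'n::finite \<Rightarrow> real"
  assumes [measurable]: "f \<in> borel_measurable lebesgue"
  shows "mx f \<in> borel_measurable lebesgue"
  unfolding mx_def[abs_def] by measurable

lemma periodic_mx:
  fixes f :: "real^'n::finite \<Rightarrow> real"
  assumes "f \<in> borel_measurable lebesgue" "periodic f" shows "periodic (mx f)"
  using periodic_maxf[OF assms] by (simp add: periodic_def mx_def)

lemma maxf_finite_AE:
  fixes f :: "real^'n::finite \<Rightarrow> real"
  assumes [measurable]: "f \<in> borel_measurable lebesgue" and per: "periodic f" and p: "1 < p" and fin: "pint p f < \<infinity>"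
  shows "AE x in lebesgue. maxf f x < \<infinity>"
proof -
  obtain C where C: "C > 0" "\<And>f :: real^'n \<Rightarrow> real. f \<in> borel_measurable lebesgue \<Longrightarrow> periodic f \<Longrightarrow>
    qint (\<lambda>x. enn_powr (maxf f x) p) \<le> ennreal C * qint (\<lambda>x. ennreal (\<bar>f x\<bar> powr p))"
    using maxf_strong_type[OF p] by blast
  have "qint (\<lambda>x. enn_powr (maxf f x) p) \<le> ennreal C * pint p f" unfolding pint_def by (rule C(2)[OF assms(1) per])
  also have "\<dots> < top" using fin by (simp add: ennreal_mult_less_top)
  finally have "qint (\<lambda>x. enn_powr (maxf f x) p) \<noteq> \<infinity>" by simp
  then have "AE x in lebesgue. enn_powr (maxf f x) p * indicator unit_cube x \<noteq> \<infinity>"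
    by (intro nn_integral_PInf_AE) auto
  then have "AE x in lebesgue. x \<in> unit_cube \<longrightarrow> maxf f x < \<infinity>"
    by eventually_elim (auto simp: enn_powr_def less_top split: if_splits)
  then show ?thesis
    by (rule AE_periodic) (simp add: periodic_add[OF periodic_maxf[OF assms(1) per]])
qed

lemma pint_mx:
  assumes p: "1 < p"
  obtains C where "C > 0" "\<And>f :: real^'n::finite \<Rightarrow> real. f \<in> borel_measurable lebesgue \<Longrightarrow> periodic f \<Longrightarrow>
    pint p (mx f) \<le> ennreal C * pint p f"
proof -
  obtain C where C: "C > 0" "\<And>f :: real^'n \<Rightarrow> real. f \<in> borel_measurable lebesgue \<Longrightarrow> periodic f \<Longrightarrow>
    qint (\<lambda>x. enn_powr (maxf f x) p) \<le> ennreal C * qint (\<lambda>x. ennreal (\<bar>f x\<bar> powr p))"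
    using maxf_strong_type[OF p] by blast
  have le: "ennreal (\<bar>enn2real m\<bar> powr p) \<le> enn_powr m p" for m by (simp add: enn_powr_def)
  show thesis
  proof (rule that[OF C(1)])
    fix f :: "real^'n \<Rightarrow> real" assume "f \<in> borel_measurable lebesgue" "periodic f"
    note C(2)[OF this]
    moreover have "pint p (mx f) \<le> qint (\<lambda>x. enn_powr (maxf f x) p)"
      unfolding pint_def mx_def by (intro nn_integral_mono mult_right_mono le) simp
    ultimately show "pint p (mx f) \<le> ennreal C * pint p f" unfolding pint_def by (rule order_trans[rotated])
  qed
qed

lemma pint_mx_finite:
  fixes f :: "real^'n::finite \<Rightarrow> real"
  assumes "1 < p" "f \<in> borel_measurable lebesgue" "periodic f" "pint p f < \<infinity>"
  shows "pint p (mx f) < \<infinity>"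
proof -
  obtain C where "\<And>f :: real^'n \<Rightarrow> real. f \<in> borel_measurable lebesgue \<Longrightarrow> periodic f \<Longrightarrow> pint p (mx f) \<le> ennreal C * pint p f"
    using pint_mx[OF assms(1)] by blast
  from this[OF assms(2,3)] show ?thesis using assms(4) by (auto intro: le_less_trans simp: ennreal_mult_less_top)
qed

text \<open>Sublinearity in both directions. It holds almost everywhere because passing from
  \<open>maxf\<close> to \<open>mx\<close> respects inequalities only where the larger side is
  finite. Together with the strong type bound it makes the maximal operator Lipschitz in
  L^p.\<close>

lemma mx_diff_AE:
  fixes f g :: "real^'n::finite \<Rightarrow> real"
  assumes m [measurable]: "f \<in> borel_measurable lebesgue" "g \<in> borel_measurable lebesgue"
    and per: "periodic f" "periodic g" and p: "1 < p" and fin: "pint p f < \<infinity>" "pint p g < \<infinity>"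
  shows "AE x in lebesgue. \<bar>mx f x - mx g x\<bar> \<le> mx (\<lambda>x. f x - g x) x"
proof -
  let ?h = "\<lambda>x. f x - g x"
  have perh: "periodic ?h" using per by (simp add: periodic_def)
  have "pint p ?h \<le> ennreal (2 powr p) * (pint p f + pint p g)" using p by (intro pint_add_le) auto
  also have "\<dots> < \<infinity>" using fin by (simp add: ennreal_mult_less_top)
  finally have finh: "pint p ?h < \<infinity>" .
  have "AE x in lebesgue. maxf ?h x < \<infinity>" using perh p finh by (intro maxf_finite_AE[of _ p]) auto
  with maxf_finite_AE[OF m(1) per(1) p fin(1)] maxf_finite_AE[OF m(2) per(2) p fin(2)]
  show ?thesis
  proof eventually_elim
    case (elim x)
    have real: "enn2real a \<le> enn2real b + enn2real c" if "a \<le> b + c" "b < \<infinity>" "c < \<infinity>" for a b c :: ennreal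
    proof -
      have "enn2real a \<le> enn2real (b + c)" using that by (intro enn2real_mono) auto
      also have "\<dots> = enn2real b + enn2real c" using that by (intro enn2real_plus) auto
      finally show ?thesis .
    qed
    have "maxf f x \<le> maxf g x + maxf ?h x" by (rule maxf_add) auto
    then have "mx f x \<le> mx g x + mx ?h x" unfolding mx_def by (rule real) (use elim in auto)
    moreover have "maxf g x \<le> maxf f x + maxf ?h x" by (rule maxf_add) auto
    then have "mx g x \<le> mx f x + mx ?h x" unfolding mx_def by (rule real) (use elim in auto)
    ultimately show ?case by linarith
  qed
qed

lemma tendsto_pint_mx:
  fixes f :: "real^'n::finite \<Rightarrow> real" and fn :: "nat \<Rightarrow> real^'n \<Rightarrow> real"
  assumes m [measurable]: "f \<in> borel_measurable lebesgue" "\<And>n. fn n \<in> borel_measurable lebesgue"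
    and per: "periodic f" "\<And>n. periodic (fn n)" and p: "1 < p" and fin: "pint p f < \<infinity>" "\<And>n. pint p (fn n) < \<infinity>"
    and lim: "(\<lambda>n. pint p (\<lambda>x. fn n x - f x)) \<longlonglongrightarrow> 0"
  shows "(\<lambda>n. pint p (\<lambda>x. mx (fn n) x - mx f x)) \<longlonglongrightarrow> 0"
proof -
  obtain C where C: "C > 0" "\<And>f :: real^'n \<Rightarrow> real. f \<in> borel_measurable lebesgue \<Longrightarrow> periodic f \<Longrightarrow>
    pint p (mx f) \<le> ennreal C * pint p f" using pint_mx[OF p] by blast
  have "(\<lambda>n. ennreal C * pint p (\<lambda>x. fn n x - f x)) \<longlonglongrightarrow> ennreal C * 0"
    by (intro tendsto_mult_ennreal tendsto_const lim) auto
  then have "(\<lambda>n. ennreal C * pint p (\<lambda>x. fn n x - f x)) \<longlonglongrightarrow> 0" by simp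
  then show ?thesis
  proof (rule tendsto_0_le_ennreal)
    fix n
    have "pint p (\<lambda>x. mx (fn n) x - mx f x) \<le> pint p (mx (\<lambda>x. fn n x - f x))"
    proof (rule pint_mono_AE)
      show "AE x in lebesgue. \<bar>mx (fn n) x - mx f x\<bar> \<le> \<bar>mx (\<lambda>x. fn n x - f x) x\<bar>"
        using mx_diff_AE[OF m(2)[of n] m(1) per(2)[of n] per(1) p fin(2)[of n] fin(1)] by eventually_elim linarith
    qed (use p in simp)
    also have "\<dots> \<le> ennreal C * pint p (\<lambda>x. fn n x - f x)"
      using per by (intro C(2)) (auto simp: periodic_def)
    finally show "pint p (\<lambda>x. mx (fn n) x - mx f x) \<le> \<dots>" .
  qed
qed

subsection \<open>Weak gradients\<close>

lemma Lp_norm_1: "Lp_norm 1 F = qint F"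
  unfolding Lp_norm_def by (simp add: enn_powr_1)

lemma borel_measurable_vec:
  fixes f :: "'a \<Rightarrow> real^'n::finite"
  assumes "\<And>i. (\<lambda>x. f x $ i) \<in> borel_measurable M"
  shows "f \<in> borel_measurable M"
  by (rule borel_measurable_euclidean_space[THEN iffD2]) (use assms in \<open>auto simp: Basis_vec_def inner_axis\<close>)

lemma borel_measurable_nth:
  fixes f :: "'a \<Rightarrow> real^'n::finite"
  assumes "f \<in> borel_measurable M"
  shows "(\<lambda>x. f x $ i) \<in> borel_measurable M"
  by (rule measurable_compose[OF assms]) (intro borel_measurable_continuous_onI continuous_intros)

lemma set_integral_lebesgue_lborel:
  fixes f f' :: "real^'n::finite \<Rightarrow> real"
  assumes f: "f \<in> borel_measurable lebesgue" and f' [measurable]: "f' \<in> borel_measurable borel"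
    and ae: "AE x in lebesgue. f x = f' x" and h [measurable]: "h \<in> borel_measurable borel"
  shows "(LINT x:unit_cube|lebesgue. f x * h x) = (LINT x:unit_cube|lborel. f' x * h x)"
proof -
  note [measurable] = f
  have hl [measurable]: "h \<in> borel_measurable lebesgue" "f' \<in> borel_measurable lebesgue"
    by (auto intro: borel_measurable_lebesgueI)
  have "(LINT x:unit_cube|lebesgue. f x * h x) = (LINT x:unit_cube|lebesgue. f' x * h x)"
    unfolding set_lebesgue_integral_def by (rule integral_cong_AE) (use ae in auto)
  also have "\<dots> = (LINT x:unit_cube|lborel. f' x * h x)"
    unfolding set_lebesgue_integral_def by (rule integral_completion) measurable
  finally show ?thesis .
qed

lemma partial_deriv_smooth_continuous: "smooth \<phi> \<Longrightarrow> continuous_on UNIV (partial_deriv i \<phi>)"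
proof -
  assume "smooth \<phi>"
  then have "Ck (Suc 0) \<phi>" by (simp add: smooth_def del: Ck.simps)
  then show ?thesis by simp
qed

lemma smooth_continuous: "smooth \<phi> \<Longrightarrow> continuous_on UNIV \<phi>"
  unfolding smooth_def using Ck.simps(1) by blast

text \<open>Passage to Borel representatives, for which Fubini's theorem is available.\<close>

lemma has_weak_gradient_borel:
  fixes u :: "real^'n::finite \<Rightarrow> real"
  assumes "has_weak_gradient u g"
  obtains u' g' where "borel_weak_gradient u' g'" "AE x in lebesgue. u x = u' x" "AE x in lebesgue. g x = g' x"
proof -
  have u: "periodic u" "u \<in> borel_measurable lebesgue" "abs_Lp_norm 1 u < \<infinity>"
    and g: "periodic g" "g \<in> borel_measurable lebesgue" "abs_Lp_norm 1 g < \<infinity>"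
    using assms by (auto simp: has_weak_gradient_def Lp_def)
  obtain u' where u': "u' \<in> borel_measurable borel" "periodic u'" "AE x in lebesgue. u x = u' x"
    using periodic_borel_representative[OF u(2,1)] by blast
  have "\<forall>i. \<exists>h. h \<in> borel_measurable borel \<and> periodic h \<and> (AE x in lebesgue. g x $ i = h x)"
  proof
    fix i
    have "periodic (\<lambda>x. g x $ i)" using g(1) by (simp add: periodic_def)
    from periodic_borel_representative[OF borel_measurable_nth[OF g(2)] this]
    show "\<exists>h. h \<in> borel_measurable borel \<and> periodic h \<and> (AE x in lebesgue. g x $ i = h x)" by blast
  qed
  from choice[OF this] obtain h where h: "\<forall>i. h i \<in> borel_measurable borel \<and> periodic (h i) \<and> (AE x in lebesgue. g x $ i = h i x)" ..
  define g' where "g' x = (\<chi> i. h i x)" for x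
  have g'm: "g' \<in> borel_measurable borel" by (rule borel_measurable_vec) (use h in \<open>simp add: g'_def\<close>)
  have g'p: "periodic g'" using h by (simp add: periodic_def g'_def)
  have "AE x in lebesgue. \<forall>i\<in>UNIV. g x $ i = h i x" using h by (subst AE_ball_countable) auto
  then have g'e: "AE x in lebesgue. g x = g' x" by eventually_elim (simp add: g'_def vec_eq_iff)
  have "qint (\<lambda>x. ennreal \<bar>u' x\<bar>) = qint (\<lambda>x. ennreal (norm (u x)))"
    by (rule nn_integral_cong_AE, use u'(3) in eventually_elim) simp
  then have u'f: "qint (\<lambda>x. ennreal \<bar>u' x\<bar>) < \<infinity>" using u(3) by (simp add: Lp_norm_1)
  have "qint (\<lambda>x. ennreal (norm (g' x))) = qint (\<lambda>x. ennreal (norm (g x)))"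
    by (rule nn_integral_cong_AE, use g'e in eventually_elim) simp
  then have g'f: "qint (\<lambda>x. ennreal (norm (g' x))) < \<infinity>" using g(3) by (simp add: Lp_norm_1)
  have weak: "(LINT z:unit_cube|lborel. u' z * partial_deriv i \<phi> z) = - (LINT z:unit_cube|lborel. g' z $ i * \<phi> z)"
    if \<phi>: "trig_poly \<phi>" for \<phi> i
  proof -
    have "(LINT x:unit_cube|lebesgue. u x * partial_deriv i \<phi> x) = - (LINT x:unit_cube|lebesgue. g x $ i * \<phi> x)"
      using assms smooth_trig_poly[OF \<phi>] periodic_trig_poly[OF \<phi>] by (auto simp: has_weak_gradient_def)
    moreover have "(LINT x:unit_cube|lebesgue. u x * partial_deriv i \<phi> x) = (LINT z:unit_cube|lborel. u' z * partial_deriv i \<phi> z)"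
      by (rule set_integral_lebesgue_lborel[OF u(2) u'(1) u'(3)]) (intro trig_poly_measurable trig_poly_partial_deriv \<phi>)
    moreover have "(LINT x:unit_cube|lebesgue. g x $ i * \<phi> x) = (LINT z:unit_cube|lborel. g' z $ i * \<phi> z)"
    proof (rule set_integral_lebesgue_lborel)
      show "AE x in lebesgue. g x $ i = g' x $ i" using g'e by eventually_elim simp
    qed (use borel_measurable_nth[OF g(2)] borel_measurable_nth[OF g'm] trig_poly_measurable[OF \<phi>] in auto)
    ultimately show ?thesis by simp
  qed
  have "borel_weak_gradient u' g'"
    unfolding borel_weak_gradient_def using u'(1,2) g'm g'p u'f g'f weak by blast
  then show thesis by (rule that[OF _ u'(3) g'e])
qed

text \<open>The mollifier kernels are test functions, so two weak gradients of one function have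
  identical mollifications; these converge in L^1 to both of them.\<close>

lemma weak_gradient_unique_AE:
  fixes u :: "real^'n::finite \<Rightarrow> real"
  assumes "has_weak_gradient u g" "has_weak_gradient u h"
  shows "AE x in lebesgue. g x = h x"
proof -
  obtain u1 g' where g': "borel_weak_gradient u1 g'" "AE x in lebesgue. u x = u1 x" "AE x in lebesgue. g x = g' x"
    by (rule has_weak_gradient_borel[OF assms(1)])
  obtain u2 h' where h': "borel_weak_gradient u2 h'" "AE x in lebesgue. u x = u2 x" "AE x in lebesgue. h x = h' x"
    by (rule has_weak_gradient_borel[OF assms(2)])
  note G = borel_weak_gradientD[OF g'(1)] and H = borel_weak_gradientD[OF h'(1)]
  have gm [measurable]: "(\<lambda>x. g' x $ i) \<in> borel_measurable borel" "(\<lambda>x. h' x $ i) \<in> borel_measurable borel" for i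
    by (rule borel_measurable_nth, fact G H)+
  have gp: "periodic (\<lambda>x. g' x $ i)" "periodic (\<lambda>x. h' x $ i)" for i
    using G(4) H(4) by (auto simp: periodic_def)
  have gf: "qint (\<lambda>x. ennreal \<bar>g' x $ i\<bar>) < \<infinity>" "qint (\<lambda>x. ennreal \<bar>h' x $ i\<bar>) < \<infinity>" for i
  proof -
    have "qint (\<lambda>x. ennreal \<bar>g' x $ i\<bar>) \<le> qint (\<lambda>x. ennreal (norm (g' x)))" "qint (\<lambda>x. ennreal \<bar>h' x $ i\<bar>) \<le> qint (\<lambda>x. ennreal (norm (h' x)))"
      by (auto intro!: nn_integral_mono mult_right_mono ennreal_leI component_le_norm_cart)
    then show "qint (\<lambda>x. ennreal \<bar>g' x $ i\<bar>) < \<infinity>" "qint (\<lambda>x. ennreal \<bar>h' x $ i\<bar>) < \<infinity>"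
      using G(6) H(6) by (auto intro: le_less_trans)
  qed
  have u12: "AE x in lebesgue. u1 x = u2 x" using g'(2) h'(2) by eventually_elim simp
  have same: "mollify n (\<lambda>x. g' x $ i) x = mollify n (\<lambda>x. h' x $ i) x" for n i x
  proof -
    let ?k = "\<lambda>z::real^'n. bump z ^ n * (1 / bump_mass TYPE('n) n)"
    have k: "trig_poly (\<lambda>z. ?k (z - x))"
      by (rule trig_poly_translate) (intro trig_poly.mult trig_poly_power trig_poly_bump trig_poly.const)
    have km: "partial_deriv i (\<lambda>z. ?k (z - x)) \<in> borel_measurable borel"
      by (intro trig_poly_measurable trig_poly_partial_deriv k)
    \<comment> \<open>The two applications of \<open>has_weak_gradient_borel\<close> may return
      different representatives of \<open>u\<close>; as these agree almost everywhere, the integrals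
      coincide.\<close>
    have "(LINT z:unit_cube|lborel. u1 z * partial_deriv i (\<lambda>z. ?k (z - x)) z) = (LINT z:unit_cube|lborel. u2 z * partial_deriv i (\<lambda>z. ?k (z - x)) z)"
      using set_integral_lebesgue_lborel[OF borel_measurable_lebesgueI[OF G(1)] G(1) _ km]
        set_integral_lebesgue_lborel[OF borel_measurable_lebesgueI[OF G(1)] H(1) u12 km] by simp
    then have "(LINT z:unit_cube|lborel. g' z $ i * ?k (z - x)) = (LINT z:unit_cube|lborel. h' z $ i * ?k (z - x))"
      using G(7)[OF k, of i] H(7)[OF k, of i] by simp
    then show ?thesis by (simp add: mollify_def)
  qed
  have "AE x in lebesgue. g' x $ i = h' x $ i" for i
  proof -
    let ?w = "\<lambda>x. \<bar>g' x $ i - h' x $ i\<bar>"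
    have wl: "?w \<in> borel_measurable lebesgue" by (rule borel_measurable_lebesgueI) simp
    have small: "qint (\<lambda>x. ennreal (?w x)) \<le> ennreal e" if e: "0 < e" for e :: real
    proof -
      have e2: "0 < e / 2" using e by simp
      have "\<forall>\<^sub>F n in sequentially. qint (\<lambda>x. ennreal \<bar>mollify n (\<lambda>x. g' x $ i) x - g' x $ i\<bar>) \<le> ennreal (e/2) \<and>
        qint (\<lambda>x. ennreal \<bar>mollify n (\<lambda>x. h' x $ i) x - h' x $ i\<bar>) \<le> ennreal (e/2)"
        by (intro eventually_conj mollify_L1 gm gp gf e2)
      then obtain n where n: "qint (\<lambda>x. ennreal \<bar>mollify n (\<lambda>x. g' x $ i) x - g' x $ i\<bar>) \<le> ennreal (e/2)"
        "qint (\<lambda>x. ennreal \<bar>mollify n (\<lambda>x. h' x $ i) x - h' x $ i\<bar>) \<le> ennreal (e/2)"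
        by (auto simp: eventually_sequentially)
      have si: "set_integrable lborel unit_cube (\<lambda>x. g' x $ i)" "set_integrable lborel unit_cube (\<lambda>x. h' x $ i)"
        by (intro set_integrable_periodic gm gf)+
      have [measurable]: "mollify n (\<lambda>x. g' x $ i) \<in> borel_measurable borel" "mollify n (\<lambda>x. h' x $ i) \<in> borel_measurable borel"
        by (intro borel_measurable_continuous_onI mollify_continuous si)+
      have "qint (\<lambda>x. ennreal (?w x)) \<le> (\<integral>\<^sup>+x. ennreal \<bar>mollify n (\<lambda>x. g' x $ i) x - g' x $ i\<bar> * indicator unit_cube x +
          ennreal \<bar>mollify n (\<lambda>x. h' x $ i) x - h' x $ i\<bar> * indicator unit_cube x \<partial>lborel)"
        unfolding qint_lborel same[of n i] by (intro nn_integral_mono) (auto simp: indicator_def simp flip: ennreal_plus intro!: ennreal_leI)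
      also have "\<dots> = qint (\<lambda>x. ennreal \<bar>mollify n (\<lambda>x. g' x $ i) x - g' x $ i\<bar>) + qint (\<lambda>x. ennreal \<bar>mollify n (\<lambda>x. h' x $ i) x - h' x $ i\<bar>)"
        unfolding qint_lborel by (rule nn_integral_add) auto
      also have "\<dots> \<le> ennreal (e/2) + ennreal (e/2)" by (intro add_mono n)
      also have "\<dots> = ennreal e" using e by (simp flip: ennreal_plus)
      finally show ?thesis .
    qed
    have "qint (\<lambda>x. ennreal (?w x)) \<le> 0"
    proof (rule ennreal_le_epsilon)
      fix e :: real assume "0 < e"
      from small[OF this] show "qint (\<lambda>x. ennreal (?w x)) \<le> 0 + ennreal e" by (simp only: add_0_left)
    qed
    then have "qint (\<lambda>x. ennreal (?w x)) = 0" by simp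
    then have "AE x in lebesgue. ennreal (?w x) * indicator unit_cube x = 0"
      using wl by (subst nn_integral_0_iff_AE[symmetric]) auto
    then have "AE x in lebesgue. x \<in> unit_cube \<longrightarrow> g' x $ i = h' x $ i"
      by eventually_elim (auto simp: indicator_def)
    then show ?thesis
      by (rule AE_periodic) (simp add: periodic_add[OF gp(1)] periodic_add[OF gp(2)])
  qed
  then have "AE x in lebesgue. \<forall>i\<in>UNIV. g' x $ i = h' x $ i" by (subst AE_ball_countable) auto
  with g'(3) h'(3) show ?thesis by eventually_elim (simp add: vec_eq_iff)
qed

lemma set_integrable_mult_continuous:
  fixes f h :: "real^'n::finite \<Rightarrow> real"
  assumes f [measurable]: "f \<in> borel_measurable lebesgue" and fin: "qint (\<lambda>x. ennreal \<bar>f x\<bar>) < \<infinity>"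
    and h: "continuous_on UNIV h"
  shows "set_integrable lebesgue unit_cube (\<lambda>x. f x * h x)"
proof -
  have [measurable]: "h \<in> borel_measurable lebesgue"
    by (intro borel_measurable_lebesgueI borel_measurable_continuous_onI h)
  have "compact (h ` unit_cube)"
    using h by (intro compact_continuous_image) (auto intro: continuous_on_subset)
  then obtain B where "\<forall>z\<in>unit_cube. \<bar>h z\<bar> \<le> B" by (auto dest!: compact_imp_bounded simp: bounded_iff)
  then have B: "\<bar>h z\<bar> \<le> \<bar>B\<bar>" if "z \<in> unit_cube" for z using that by fastforce
  have "(\<integral>\<^sup>+x. ennreal (norm (indicator unit_cube x *\<^sub>R (f x * h x))) \<partial>lebesgue) \<le> (\<integral>\<^sup>+x. ennreal \<bar>B\<bar> * (ennreal \<bar>f x\<bar> * indicator unit_cube x) \<partial>lebesgue)"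
  proof (rule nn_integral_mono)
    fix x :: "real^'n"
    show "ennreal (norm (indicator unit_cube x *\<^sub>R (f x * h x))) \<le> ennreal \<bar>B\<bar> * (ennreal \<bar>f x\<bar> * indicator unit_cube x)"
    proof (cases "x \<in> unit_cube")
      case True
      then have "\<bar>f x * h x\<bar> \<le> \<bar>B\<bar> * \<bar>f x\<bar>" using mult_left_mono[OF B[OF True], of "\<bar>f x\<bar>"] by (simp add: abs_mult mult.commute)
      then show ?thesis using True by (simp add: ennreal_mult[symmetric] ennreal_leI)
    qed simp
  qed
  also have "\<dots> = ennreal \<bar>B\<bar> * qint (\<lambda>x. ennreal \<bar>f x\<bar>)" by (rule nn_integral_cmult) simp
  also have "\<dots> < \<infinity>" using fin by (simp add: ennreal_mult_less_top)
  finally show ?thesis unfolding set_integrable_def integrable_iff_bounded by simp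
qed

lemma has_weak_gradient_diff:
  fixes u v :: "real^'n::finite \<Rightarrow> real"
  assumes u: "has_weak_gradient u g" and v: "has_weak_gradient v h"
  shows "has_weak_gradient (\<lambda>x. v x - u x) (\<lambda>x. h x - g x)"
proof -
  have U: "periodic u" "u \<in> borel_measurable lebesgue" "qint (\<lambda>x. ennreal \<bar>u x\<bar>) < \<infinity>"
    and G: "periodic g" "g \<in> borel_measurable lebesgue" "qint (\<lambda>x. ennreal (norm (g x))) < \<infinity>"
    and V: "periodic v" "v \<in> borel_measurable lebesgue" "qint (\<lambda>x. ennreal \<bar>v x\<bar>) < \<infinity>"
    and H: "periodic h" "h \<in> borel_measurable lebesgue" "qint (\<lambda>x. ennreal (norm (h x))) < \<infinity>"
    using u v by (auto simp: has_weak_gradient_def Lp_def Lp_norm_1)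
  have Lp1: "(\<lambda>x. b x - a x) \<in> Lp 1" if a: "a \<in> Lp 1" and b: "b \<in> Lp 1" for a b :: "real^'n \<Rightarrow> 'b::euclidean_space"
  proof -
    have [measurable]: "a \<in> borel_measurable lebesgue" "b \<in> borel_measurable lebesgue" using a b by (auto simp: Lp_def)
    have "qint (\<lambda>x. ennreal (norm (b x - a x))) \<le> (\<integral>\<^sup>+x. ennreal (norm (b x)) * indicator unit_cube x + ennreal (norm (a x)) * indicator unit_cube x \<partial>lebesgue)"
      by (intro nn_integral_mono) (auto simp: indicator_def simp flip: ennreal_plus intro!: ennreal_leI norm_triangle_ineq4)
    also have "\<dots> = qint (\<lambda>x. ennreal (norm (b x))) + qint (\<lambda>x. ennreal (norm (a x)))" by (rule nn_integral_add) auto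
    also have "\<dots> < \<infinity>" using a b by (simp add: Lp_def Lp_norm_1)
    finally show ?thesis using a b by (simp add: Lp_def Lp_norm_1 periodic_def)
  qed
  have comp: "qint (\<lambda>x. ennreal \<bar>w x $ i\<bar>) < \<infinity>" if "qint (\<lambda>x. ennreal (norm (w x))) < \<infinity>" for w :: "real^'n \<Rightarrow> real^'n" and i
  proof -
    have "qint (\<lambda>x. ennreal \<bar>w x $ i\<bar>) \<le> qint (\<lambda>x. ennreal (norm (w x)))"
      by (intro nn_integral_mono mult_right_mono ennreal_leI component_le_norm_cart) auto
    then show ?thesis using that by (rule le_less_trans)
  qed
  show ?thesis unfolding has_weak_gradient_def
  proof (intro conjI allI impI)
    show "(\<lambda>x. v x - u x) \<in> Lp 1" "(\<lambda>x. h x - g x) \<in> Lp 1"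
      using u v by (auto simp: has_weak_gradient_def intro!: Lp1)
    fix \<phi> :: "real^'n \<Rightarrow> real" and i assume "periodic \<phi> \<and> smooth \<phi>"
    then have \<phi>: "periodic \<phi>" "smooth \<phi>" by auto
    note c = partial_deriv_smooth_continuous[OF \<phi>(2), of i] smooth_continuous[OF \<phi>(2)]
    have "(LINT x:unit_cube|lebesgue. (v x - u x) * partial_deriv i \<phi> x) =
       (LINT x:unit_cube|lebesgue. v x * partial_deriv i \<phi> x) - (LINT x:unit_cube|lebesgue. u x * partial_deriv i \<phi> x)"
      unfolding left_diff_distrib by (intro set_integral_diff(2) set_integrable_mult_continuous U V c)
    also have "\<dots> = - (LINT x:unit_cube|lebesgue. h x $ i * \<phi> x) - - (LINT x:unit_cube|lebesgue. g x $ i * \<phi> x)"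
      using u v \<phi> by (simp add: has_weak_gradient_def)
    also have "\<dots> = - ((LINT x:unit_cube|lebesgue. h x $ i * \<phi> x) - (LINT x:unit_cube|lebesgue. g x $ i * \<phi> x))" by simp
    also have "(LINT x:unit_cube|lebesgue. h x $ i * \<phi> x) - (LINT x:unit_cube|lebesgue. g x $ i * \<phi> x) =
       (LINT x:unit_cube|lebesgue. h x $ i * \<phi> x - g x $ i * \<phi> x)"
      by (intro set_integral_diff(2)[symmetric] set_integrable_mult_continuous comp borel_measurable_nth G H c)
    also have "(LINT x:unit_cube|lebesgue. h x $ i * \<phi> x - g x $ i * \<phi> x) = (LINT x:unit_cube|lebesgue. (h x - g x) $ i * \<phi> x)"
      by (simp add: left_diff_distrib)
    finally show "(LINT x:unit_cube|lebesgue. (v x - u x) * partial_deriv i \<phi> x) = - (LINT x:unit_cube|lebesgue. (h x - g x) $ i * \<phi> x)" .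
  qed
qed

lemma sobolev_pointwise:
  obtains C where "C > 0" "\<And>(u :: real^'n::finite \<Rightarrow> real) g. has_weak_gradient u g \<Longrightarrow> gradient_estimate C u g"
proof -
  obtain C where C: "C > 0" "\<And>(u :: real^'n \<Rightarrow> real) g. borel_weak_gradient u g \<Longrightarrow> gradient_estimate C u g"
    by (rule sobolev_pointwise_borel) blast
  show thesis
  proof (rule that[OF C(1)])
    fix u :: "real^'n \<Rightarrow> real" and g assume "has_weak_gradient u g"
    then obtain u' g' where b: "borel_weak_gradient u' g'" "AE x in lebesgue. u x = u' x" "AE x in lebesgue. g x = g' x"
      by (rule has_weak_gradient_borel)
    have m: "maxf (\<lambda>z. norm (g z)) x = maxf (\<lambda>z. norm (g' z)) x" for x
      by (rule maxf_cong_AE, use b(3) in eventually_elim) simp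
    from C(2)[OF b(1)] obtain S where S: "AE x in lebesgue. x \<in> S"
      "\<And>x y. x \<in> S \<Longrightarrow> y \<in> S \<Longrightarrow> norm (x - y) < real CARD('n) + 1 \<Longrightarrow>
      ennreal \<bar>u' x - u' y\<bar> \<le> ennreal (C * norm (x - y)) * (maxf (\<lambda>z. norm (g z)) x + maxf (\<lambda>z. norm (g z)) y)"
      unfolding m gradient_estimate_def by blast
    show "gradient_estimate C u g"
      unfolding gradient_estimate_def
    proof (intro exI[of _ "S \<inter> {x. u x = u' x}"] conjI)
      show "AE x in lebesgue. x \<in> S \<inter> {x. u x = u' x}" using S(1) b(2) by eventually_elim simp
    qed (use S(2) in auto)
  qed
qed

text \<open>The choice behind \<open>weak_gradient\<close> only guarantees a gradient in L^1. It
  agrees almost everywhere with the witness from \<open>W1 r\<close>, which supplies the finite L^r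
  norm.\<close>

lemma W1_weak_gradient:
  fixes u :: "real^'n::finite \<Rightarrow> real"
  assumes "u \<in> W1 r" "0 < r"
  shows "has_weak_gradient u (weak_gradient u)" "abs_Lp_norm r (weak_gradient u) < \<infinity>"
    "pint r (\<lambda>x. norm (weak_gradient u x)) < \<infinity>"
proof -
  obtain g where g: "g \<in> Lp r" "has_weak_gradient u g" using assms(1) by (auto simp: W1_def)
  show w: "has_weak_gradient u (weak_gradient u)" unfolding weak_gradient_def by (rule someI[where P="has_weak_gradient u", OF g(2)])
  have "abs_Lp_norm r (weak_gradient u) = abs_Lp_norm r g"
    by (rule Lp_norm_cong_AE, use weak_gradient_unique_AE[OF w g(2)] in eventually_elim) simp
  then show fin: "abs_Lp_norm r (weak_gradient u) < \<infinity>" using g(1) by (simp add: Lp_def)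
  then show "pint r (\<lambda>x. norm (weak_gradient u x)) < \<infinity>"
    unfolding pint_eq_abs_Lp_norm[OF assms(2)] by (cases "abs_Lp_norm r (weak_gradient u)") (auto simp: enn_powr_def)
qed

text \<open>\<open>weak_gradient\<close> chooses separately for each function, so it is linear only
  almost everywhere, through linearity of the defining identity and uniqueness.\<close>

lemma W1_weak_gradient_diff:
  fixes u v :: "real^'n::finite \<Rightarrow> real"
  assumes "u \<in> W1 r" "v \<in> W1 r" "0 < r"
  shows "AE x in lebesgue. weak_gradient (\<lambda>x. v x - u x) x = weak_gradient v x - weak_gradient u x"
proof -
  have d: "has_weak_gradient (\<lambda>x. v x - u x) (\<lambda>x. weak_gradient v x - weak_gradient u x)"
    using assms by (intro has_weak_gradient_diff W1_weak_gradient)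
  have "has_weak_gradient (\<lambda>x. v x - u x) (weak_gradient (\<lambda>x. v x - u x))"
    unfolding weak_gradient_def[of "\<lambda>x. v x - u x"] by (rule someI[where P="has_weak_gradient (\<lambda>x. v x - u x)", OF d])
  from weak_gradient_unique_AE[OF this d] show ?thesis .
qed

lemma weak_gradient_norm:
  fixes u :: "real^'n::finite \<Rightarrow> real"
  assumes "u \<in> W1 r" "0 < r"
  shows "(\<lambda>x. norm (weak_gradient u x)) \<in> borel_measurable lebesgue" "periodic (\<lambda>x. norm (weak_gradient u x))"
  using W1_weak_gradient(1)[OF assms] by (auto simp: has_weak_gradient_def Lp_def periodic_def)

subsection \<open>The functions \<open>a\<close> and \<open>b\<close>\<close>

text \<open>Rounding each coordinate of \<open>x - y\<close> leaves remainders of size at most 1/2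
  and increases no coordinate in modulus. The norm is then at most d/2, so that a ball of twice this
  radius is within the range of \<open>maxf\<close>.\<close>

lemma nearest_lattice_translate:
  fixes x y :: "real^'n::finite"
  obtains k where "k \<in> lattice" "norm (x - (y + k)) \<le> norm (x - y)" "2 * norm (x - (y + k)) < real CARD('n) + 1"
proof -
  define k where "k = (\<chi> i. real_of_int (round ((x - y) $ i)))"
  have k: "k \<in> lattice" by (simp add: k_def lattice_def)
  have comp: "(x - (y + k)) $ i = (x - y) $ i - real_of_int (round ((x - y) $ i))" for i
    by (simp add: k_def)
  have le1: "\<bar>(x - (y + k)) $ i\<bar> \<le> \<bar>(x - y) $ i\<bar>" for i
    unfolding comp using round_diff_minimal[of "(x - y) $ i" 0] by (simp add: abs_minus_commute)
  have le2: "\<bar>(x - (y + k)) $ i\<bar> \<le> 1/2" for i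
    unfolding comp using of_int_round_abs_le[of "(x - y) $ i"] by (simp add: abs_minus_commute)
  have "norm (x - (y + k)) \<le> norm (x - y)"
    by (rule norm_le_componentwise_cart) (use le1 in \<open>simp only: real_norm_def\<close>)
  moreover have "norm (x - (y + k)) \<le> (\<Sum>i\<in>UNIV. \<bar>(x - (y + k)) $ i\<bar>)" by (rule norm_le_l1_cart)
  moreover have "\<dots> \<le> (\<Sum>i\<in>(UNIV::'n set). 1/2)" by (intro sum_mono le2)
  ultimately show thesis by (intro that[OF k]) auto
qed

text \<open>Completeness of Lebesgue measure. It makes \<open>good_set\<close> measurable without
  any knowledge of how that set was chosen.\<close>

lemma null_complement_sets:
  assumes "AE x in lebesgue. x \<in> S" shows "S \<in> sets (lebesgue :: 'a::euclidean_space measure)"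
proof -
  obtain N where N: "N \<in> null_sets lebesgue" "{x \<in> space lebesgue. \<not> x \<in> S} \<subseteq> N"
    using assms unfolding eventually_ae_filter by blast
  then have "- S \<subseteq> N" by auto
  then have "negligible (- S)" using N(1) by (meson negligible_iff_null_sets negligible_subset)
  then have "- S \<in> sets lebesgue" by (simp only: negligible_iff_null_sets null_sets_def mem_Collect_eq)
  then show ?thesis using sets.compl_sets[of "- S" lebesgue] by (simp add: Compl_eq_Diff_UNIV double_diff)
qed

lemma enn_powr_le_ennreal:
  assumes "t \<le> ennreal c" "0 \<le> c" "0 \<le> p" shows "enn_powr t p \<le> ennreal (c powr p)"
  using enn_powr_mono[OF assms(1,3)] enn_powr_ennreal[OF assms(2), of p] by simp

lemma Lp_dist_mono_exponent:
  fixes F G :: "real^'n::finite \<Rightarrow> ennreal"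
  assumes [measurable]: "F \<in> borel_measurable lebesgue" "G \<in> borel_measurable lebesgue" and "0 < p" "p \<le> p'"
  shows "Lp_dist p F G \<le> Lp_dist p' F G"
  unfolding Lp_dist_def by (rule Lp_norm_mono_exponent) (use assms in auto)

text \<open>Fixes the exponents and the constants of the symmetric and the asymmetric estimate, so
  that the functions built below depend on \<open>u\<close> alone.\<close>

locale asymmetric_lusin_lipschitz =
  fixes C0 C1 r \<gamma> \<kappa> :: real and TYPE_n :: "'n::finite itself"
  assumes r: "1 < r" and \<gamma>: "0 < \<gamma>" "\<gamma> < 1" and \<kappa>: "0 < \<kappa>" "1 + \<kappa> < r" and C0: "0 < C0" and C1: "0 < C1"
    and sobolev: "\<And>(u :: real^'n \<Rightarrow> real) g. has_weak_gradient u g \<Longrightarrow> gradient_estimate C0 u g"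
    and asym: "\<And>(u :: real^'n \<Rightarrow> real) H S \<mu> x y. hajlasz_gradient S u H \<Longrightarrow> 0 < \<mu> \<Longrightarrow> x \<in> S \<Longrightarrow> y \<in> S \<Longrightarrow>
      2 * norm (x - y) < real CARD('n) + 1 \<Longrightarrow> asymmetric_bound C1 \<gamma> \<kappa> \<mu> u H x y"
begin

definition grad_norm :: "(real^'n \<Rightarrow> real) \<Rightarrow> real^'n \<Rightarrow> real" where
  "grad_norm u = (\<lambda>z. norm (weak_gradient u z))"

definition hajlasz :: "(real^'n \<Rightarrow> real) \<Rightarrow> real^'n \<Rightarrow> real" where
  "hajlasz u x = C0 * mx (grad_norm u) x"

text \<open>The parameter \<mu> of the asymmetric bound.\<close>

definition energy :: "(real^'n \<Rightarrow> real) \<Rightarrow> real" where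
  "energy u = enn2real (abs_Lp_norm r (weak_gradient u))"

definition fA :: "(real^'n \<Rightarrow> real) \<Rightarrow> real^'n \<Rightarrow> real" where
  "fA u x = 2 * hajlasz u x + C1 * energy u powr (- \<kappa>) * mx (\<lambda>z. hajlasz u z powr (1 + \<kappa>)) x"

definition fB :: "(real^'n \<Rightarrow> real) \<Rightarrow> real^'n \<Rightarrow> real" where
  "fB u y = C1 * energy u powr \<gamma> * hajlasz u y powr (1 - \<gamma>)"

text \<open>Invariance under the lattice makes \<open>gA\<close> and \<open>gB\<close> periodic.
  Finiteness of the maximal function allows \<open>maxf\<close> to be replaced by its real version
  in \<open>fA\<close> at every point of \<open>S\<close>.\<close>

definition good :: "(real^'n \<Rightarrow> real) \<Rightarrow> (real^'n) set \<Rightarrow> bool" where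
  "good u S \<longleftrightarrow> hajlasz_gradient S u (hajlasz u) \<and> (\<forall>x. \<forall>k\<in>lattice. x + k \<in> S \<longleftrightarrow> x \<in> S) \<and>
     (\<forall>x\<in>S. maxf (\<lambda>z. hajlasz u z powr (1 + \<kappa>)) x < \<infinity>)"

definition good_set :: "(real^'n \<Rightarrow> real) \<Rightarrow> (real^'n) set" where
  "good_set u = (SOME S. good u S)"

definition gA :: "(real^'n \<Rightarrow> real) \<Rightarrow> real^'n \<Rightarrow> ennreal" where
  "gA u x = (if x \<in> good_set u then ennreal (fA u x) else \<infinity>)"

definition gB :: "(real^'n \<Rightarrow> real) \<Rightarrow> real^'n \<Rightarrow> ennreal" where
  "gB u x = (if x \<in> good_set u then ennreal (fB u x) else \<infinity>)"

text \<open>The integrability exponents of the two powers of \<open>hajlasz u\<close>: raised to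
  \<open>pA\<close> and \<open>pB\<close> respectively, both become its r-th power. The first also
  exceeds 1, as the maximal theorem requires.\<close>

definition pA :: real where "pA = r / (1 + \<kappa>)"
definition pB :: real where "pB = r / (1 - \<gamma>)"

lemma pA: "1 < pA" "(1 + \<kappa>) * pA = r" using \<kappa> by (auto simp: pA_def)
lemma pB: "r \<le> pB" "0 < pB" "(1 - \<gamma>) * pB = r" using \<gamma> r by (auto simp: pB_def field_simps)

section \<open>Measurability, periodicity and the pointwise inequality for a fixed function\<close>

context
  fixes u :: "real^'n \<Rightarrow> real"
  assumes u: "u \<in> W1 r"
begin

lemma grad_norm: "grad_norm u \<in> borel_measurable lebesgue" "periodic (grad_norm u)" "pint r (grad_norm u) < \<infinity>"
  using weak_gradient_norm[OF u] W1_weak_gradient(3)[OF u] r by (auto simp: grad_norm_def)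

lemma energy: "ennreal (energy u) = abs_Lp_norm r (weak_gradient u)" "0 \<le> energy u"
    "pint r (grad_norm u) = ennreal (energy u powr r)"
proof -
  show e: "ennreal (energy u) = abs_Lp_norm r (weak_gradient u)"
    unfolding energy_def using W1_weak_gradient(2)[OF u] r by (simp add: less_top)
  show "0 \<le> energy u" by (simp add: energy_def)
  then show "pint r (grad_norm u) = ennreal (energy u powr r)"
    unfolding grad_norm_def using r by (subst pint_eq_abs_Lp_norm) (simp_all add: e[symmetric] enn_powr_ennreal)
qed

lemma hajlasz: "hajlasz u \<in> borel_measurable lebesgue" "periodic (hajlasz u)" "0 \<le> hajlasz u x"
  using mx_measurable[OF grad_norm(1)] periodic_mx[OF grad_norm(1,2)] C0 mx_nonneg[of "grad_norm u" x]
  by (auto simp: hajlasz_def[abs_def] periodic_def)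

lemma hajlasz_power: "(\<lambda>z. hajlasz u z powr s) \<in> borel_measurable lebesgue" "periodic (\<lambda>z. hajlasz u z powr s)"
  using hajlasz(1,2) by (auto simp: periodic_def)

lemma pint_hajlasz_finite: "pint r (hajlasz u) < \<infinity>"
  unfolding hajlasz_def using pint_mx_finite[OF r grad_norm]
  by (subst pint_cmult) (auto intro: mx_measurable grad_norm simp: ennreal_mult_less_top)

lemma pint_hajlasz_power: "pint pA (\<lambda>z. hajlasz u z powr (1 + \<kappa>)) = pint r (hajlasz u)"
  "pint pB (\<lambda>z. hajlasz u z powr (1 - \<gamma>)) = pint r (hajlasz u)"
  using hajlasz(3) by (simp_all only: pint_powr pA pB)

lemma good_exists: "\<exists>S. good u S"
proof -
  let ?M = "maxf (grad_norm u)" and ?N = "maxf (\<lambda>z. hajlasz u z powr (1 + \<kappa>))"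
  have rr: "0 < r" using r by simp
  obtain S where S: "AE x in lebesgue. x \<in> S"
    "\<And>x y. x \<in> S \<Longrightarrow> y \<in> S \<Longrightarrow> norm (x - y) < real CARD('n) + 1 \<Longrightarrow>
        ennreal \<bar>u x - u y\<bar> \<le> ennreal (C0 * norm (x - y)) * (?M x + ?M y)"
    using sobolev[OF W1_weak_gradient(1)[OF u rr]] unfolding grad_norm_def gradient_estimate_def by blast
  let ?T = "S \<inter> {x. ?M x < \<infinity>} \<inter> {x. ?N x < \<infinity>}"
  \<comment> \<open>The sets supplied so far carry no invariance; intersecting the countably many
    lattice translates creates it and keeps full measure.\<close>
  let ?S = "{x. \<forall>k\<in>lattice. x + k \<in> ?T}"
  have "AE x in lebesgue. ?M x < \<infinity>" by (rule maxf_finite_AE[OF grad_norm(1,2) r grad_norm(3)])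
  moreover have "AE x in lebesgue. ?N x < \<infinity>"
    by (rule maxf_finite_AE[OF hajlasz_power pA(1)]) (simp only: pint_hajlasz_power pint_hajlasz_finite)
  ultimately have T: "AE x in lebesgue. x \<in> ?T" using S(1) by eventually_elim simp
  have "AE x in lebesgue. \<forall>k\<in>lattice. x + k \<in> ?T"
    using AE_lebesgue_translation[OF T] by (subst AE_ball_countable) (auto simp: countable_lattice)
  then have AE: "AE x in lebesgue. x \<in> ?S" by eventually_elim simp
  have per: "x + k \<in> ?S \<longleftrightarrow> x \<in> ?S" if k: "k \<in> lattice" for x k
  proof
    assume "x + k \<in> ?S"
    then have *: "x + k + l \<in> ?T" if "l \<in> lattice" for l using that by blast
    have "x + l \<in> ?T" if "l \<in> lattice" for l
      using *[OF lattice_diff[OF that k]] by (simp only: add.assoc diff_add_cancel add_diff_cancel_left' add.commute[of k])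
    then show "x \<in> ?S" by blast
  next
    assume "x \<in> ?S"
    then have *: "x + l \<in> ?T" if "l \<in> lattice" for l using that by blast
    have "x + k + l \<in> ?T" if "l \<in> lattice" for l
      using *[OF lattice_add[OF k that]] by (simp only: add.assoc)
    then show "x + k \<in> ?S" by blast
  qed
  have ST: "x \<in> ?T" if "x \<in> ?S" for x
  proof -
    have "(0 :: real^'n) \<in> lattice" by (simp add: lattice_def)
    then have "x + 0 \<in> ?T" using that by blast
    then show ?thesis by simp
  qed
  have est: "\<bar>u x - u y\<bar> \<le> norm (x - y) * (hajlasz u x + hajlasz u y)"
    if "x \<in> ?S" "y \<in> ?S" "norm (x - y) < real CARD('n) + 1" for x y
  proof -
    have x: "x \<in> S" "?M x < top" and y: "y \<in> S" "?M y < top" using ST[OF that(1)] ST[OF that(2)] by auto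
    have m: "?M x = ennreal (mx (grad_norm u) x)" "?M y = ennreal (mx (grad_norm u) y)"
      using x(2) y(2) by (simp_all add: mx_def)
    have "ennreal \<bar>u x - u y\<bar> \<le> ennreal (C0 * norm (x - y)) * (?M x + ?M y)" by (rule S(2)[OF x(1) y(1) that(3)])
    also have "\<dots> = ennreal (C0 * norm (x - y) * (mx (grad_norm u) x + mx (grad_norm u) y))"
      unfolding m using C0 mx_nonneg[of "grad_norm u"] by (simp add: ennreal_mult)
    finally have "\<bar>u x - u y\<bar> \<le> C0 * norm (x - y) * (mx (grad_norm u) x + mx (grad_norm u) y)"
      using C0 mx_nonneg[of "grad_norm u"] by (subst (asm) ennreal_le_iff) auto
    then show ?thesis by (simp add: hajlasz_def algebra_simps)
  qed
  have "hajlasz_gradient ?S u (hajlasz u)"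
    unfolding hajlasz_gradient_def using hajlasz(1,3) AE est by blast
  then have "good u ?S" unfolding good_def
  proof (intro conjI ballI allI impI)
    show "maxf (\<lambda>z. hajlasz u z powr (1 + \<kappa>)) x < \<infinity>" if "x \<in> ?S" for x using ST[OF that] by blast
  qed (use per in blast)+
  then show ?thesis by blast
qed

lemma good_set: "good u (good_set u)"
  unfolding good_set_def using good_exists by (rule someI_ex)

lemma AE_good: "AE x in lebesgue. x \<in> good_set u"
  using good_set by (simp add: good_def hajlasz_gradient_def)

lemma good_set_translate: "k \<in> lattice \<Longrightarrow> x + k \<in> good_set u \<longleftrightarrow> x \<in> good_set u"
  using good_set by (simp add: good_def)

lemma fA: "fA u \<in> borel_measurable lebesgue" "periodic (fA u)" "0 \<le> fA u x"
proof -
  let ?N = "mx (\<lambda>z. hajlasz u z powr (1 + \<kappa>))"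
  have [measurable]: "hajlasz u \<in> borel_measurable lebesgue" "?N \<in> borel_measurable lebesgue"
    by (intro hajlasz mx_measurable hajlasz_power)+
  show "fA u \<in> borel_measurable lebesgue" unfolding fA_def[abs_def] by measurable
  have "periodic ?N" by (intro periodic_mx hajlasz_power)
  then show "periodic (fA u)" using hajlasz(2) by (simp add: periodic_def fA_def)
  show "0 \<le> fA u x" unfolding fA_def using hajlasz(3) mx_nonneg C1 by (intro add_nonneg_nonneg mult_nonneg_nonneg) auto
qed

lemma ennreal_fA: "ennreal (fA u x) = ennreal (2 * hajlasz u x) +
    ennreal (C1 * energy u powr (- \<kappa>)) * ennreal (mx (\<lambda>z. hajlasz u z powr (1 + \<kappa>)) x)"
proof -
  have "0 \<le> 2 * hajlasz u x" "0 \<le> C1 * energy u powr (- \<kappa>)" using hajlasz(3) C1 by auto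
  then show ?thesis
    unfolding fA_def by (simp only: ennreal_plus ennreal_mult mult_nonneg_nonneg mx_nonneg)
qed

lemma fB: "fB u \<in> borel_measurable lebesgue" "periodic (fB u)" "0 \<le> fB u x"
proof -
  have [measurable]: "hajlasz u \<in> borel_measurable lebesgue" by (rule hajlasz)
  show "fB u \<in> borel_measurable lebesgue" unfolding fB_def[abs_def] by measurable
  show "periodic (fB u)" using hajlasz(2) by (simp add: periodic_def fB_def)
  show "0 \<le> fB u x" unfolding fB_def using C1 by (intro mult_nonneg_nonneg) auto
qed

lemma gA: "gA u \<in> borel_measurable lebesgue" "periodic (gA u)" "AE x in lebesgue. gA u x = ennreal (fA u x)"
proof -
  have [measurable]: "good_set u \<in> sets lebesgue" by (rule null_complement_sets[OF AE_good])
  have [measurable]: "fA u \<in> borel_measurable lebesgue" by (rule fA)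
  show "gA u \<in> borel_measurable lebesgue" unfolding gA_def[abs_def] by measurable
  show "periodic (gA u)" using good_set_translate fA(2) by (simp add: periodic_def gA_def lattice_def)
  show "AE x in lebesgue. gA u x = ennreal (fA u x)" using AE_good by eventually_elim (simp add: gA_def)
qed

lemma gB: "gB u \<in> borel_measurable lebesgue" "periodic (gB u)" "AE x in lebesgue. gB u x = ennreal (fB u x)"
proof -
  have [measurable]: "good_set u \<in> sets lebesgue" by (rule null_complement_sets[OF AE_good])
  have [measurable]: "fB u \<in> borel_measurable lebesgue" by (rule fB)
  show "gB u \<in> borel_measurable lebesgue" unfolding gB_def[abs_def] by measurable
  show "periodic (gB u)" using good_set_translate fB(2) by (simp add: periodic_def gB_def lattice_def)
  show "AE x in lebesgue. gB u x = ennreal (fB u x)" using AE_good by eventually_elim (simp add: gB_def)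
qed

text \<open>A maximal function depends only on the class of its argument, so a gradient that is 0
  almost everywhere gives the value 0 at every point.\<close>

lemma hajlasz_energy_0: "energy u = 0 \<Longrightarrow> hajlasz u x = 0"
proof -
  assume "energy u = 0"
  then have "pint r (grad_norm u) = 0" using r energy(3) by simp
  then have "AE x in lebesgue. ennreal (\<bar>grad_norm u x\<bar> powr r) * indicator unit_cube x = 0"
    unfolding pint_def using grad_norm(1) by (subst nn_integral_0_iff_AE[symmetric]) auto
  then have "AE x in lebesgue. x \<in> unit_cube \<longrightarrow> grad_norm u x = 0"
    by eventually_elim (auto simp: indicator_def)
  then have "AE x in lebesgue. grad_norm u x = 0"
    by (rule AE_periodic) (simp add: periodic_add[OF grad_norm(2)])
  then have "maxf (grad_norm u) x = maxf (\<lambda>_. 0) x" by (intro maxf_cong_AE) auto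
  also have "\<dots> = 0" using maxf_bounded[of "\<lambda>_. 0" 0 x] by simp
  finally show "hajlasz u x = 0" by (simp add: hajlasz_def mx_def)
qed

lemma pointwise: "ennreal \<bar>u x - u y\<bar> \<le> ennreal (norm (x - y)) * (gA u x + gB u y)"
proof (cases "x = y \<or> x \<notin> good_set u \<or> y \<notin> good_set u")
  case True
  then show ?thesis
  proof (cases "x = y")
    case False
    then have "gA u x = top \<or> gB u y = top" using True by (auto simp: gA_def gB_def)
    then have "ennreal (norm (x - y)) * (gA u x + gB u y) = top" using False by (auto simp: ennreal_mult_top)
    then show ?thesis by simp
  qed simp
next
  case False
  then have x: "x \<in> good_set u" and y: "y \<in> good_set u" by auto
  obtain k where k: "k \<in> lattice" "norm (x - (y + k)) \<le> norm (x - y)" "2 * norm (x - (y + k)) < real CARD('n) + 1"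
    by (rule nearest_lattice_translate)
  let ?y = "y + k"
  have y': "?y \<in> good_set u" using y good_set_translate[OF k(1)] by simp
  have uper: "periodic u" using u by (auto simp: W1_def Lp_def)
  have uk: "u ?y = u y" by (rule periodic_add[OF uper k(1)])
  have Bk: "fB u ?y = fB u y" by (rule periodic_add[OF fB(2) k(1)])
  have hg: "hajlasz_gradient (good_set u) u (hajlasz u)" and fin: "maxf (\<lambda>z. hajlasz u z powr (1 + \<kappa>)) x < top"
    using good_set x by (auto simp: good_def)
  have "ennreal \<bar>u x - u ?y\<bar> \<le> ennreal (norm (x - ?y)) * (ennreal (fA u x) + ennreal (fB u ?y))"
  proof (cases "energy u = 0")
    case True
    have "norm (x - ?y) < real CARD('n) + 1" using k(3) norm_ge_zero[of "x - ?y"] by linarith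
    then have "\<bar>u x - u ?y\<bar> \<le> norm (x - ?y) * (hajlasz u x + hajlasz u ?y)"
      using hg x y' unfolding hajlasz_gradient_def by blast
    then have "\<bar>u x - u ?y\<bar> \<le> 0" by (simp add: hajlasz_energy_0[OF True])
    then show ?thesis by simp
  next
    case False
    then have pos: "0 < energy u" using energy(2) by simp
    have "ennreal \<bar>u x - u ?y\<bar> \<le> ennreal (norm (x - ?y)) *
        ((ennreal (2 * hajlasz u x) + ennreal (C1 * energy u powr (- \<kappa>)) * maxf (\<lambda>z. hajlasz u z powr (1 + \<kappa>)) x) +
          ennreal (C1 * energy u powr \<gamma> * hajlasz u ?y powr (1 - \<gamma>)))"
      using asym[OF hg pos x y' k(3)] unfolding asymmetric_bound_def .
    also have "maxf (\<lambda>z. hajlasz u z powr (1 + \<kappa>)) x = ennreal (mx (\<lambda>z. hajlasz u z powr (1 + \<kappa>)) x)"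
      using fin by (simp add: mx_def)
    also have "ennreal (2 * hajlasz u x) + ennreal (C1 * energy u powr (- \<kappa>)) * ennreal (mx (\<lambda>z. hajlasz u z powr (1 + \<kappa>)) x) = ennreal (fA u x)"
      by (rule ennreal_fA[symmetric])
    finally show ?thesis by (simp only: fB_def)
  qed
  then have "ennreal \<bar>u x - u y\<bar> \<le> ennreal (norm (x - ?y)) * (ennreal (fA u x) + ennreal (fB u y))"
    by (simp only: uk Bk)
  also have "\<dots> \<le> ennreal (norm (x - y)) * (ennreal (fA u x) + ennreal (fB u y))"
    by (intro mult_right_mono ennreal_leI k(2)) simp
  finally show ?thesis using x y by (simp add: gA_def gB_def)
qed

end

lemma Lp_norm_real: "(\<And>x. 0 \<le> f x) \<Longrightarrow> Lp_norm p (\<lambda>x. ennreal (f x)) = enn_powr (pint p f) (1 / p)"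
  using abs_Lp_norm_pint[of p f] by (simp add: pint_def)

text \<open>Each term has degree one in the energy: the maximal theorem at the exponent
  \<open>pA\<close> yields the power 1 + \<kappa>, which the prefactor of exponent - \<kappa>
  reduces to 1, and in \<open>fB\<close> the exponents \<gamma> and 1 - \<gamma> add up to 1. The
  norm of order 1 of \<open>gA\<close> is controlled by those of orders \<open>r\<close> and
  \<open>pA\<close>, the cube having measure 1.\<close>

lemma bounds:
  obtains K where "K > 0" "\<And>u. u \<in> W1 r \<Longrightarrow> Lp_norm 1 (gA u) \<le> ennreal (K * energy u)"
    "\<And>u. u \<in> W1 r \<Longrightarrow> Lp_norm pB (gB u) \<le> ennreal (K * energy u)"
proof -
  have r0: "0 < r" using r by simp
  obtain C where C: "C > 0" "\<And>f :: real^'n \<Rightarrow> real. f \<in> borel_measurable lebesgue \<Longrightarrow> periodic f \<Longrightarrow>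
    pint r (mx f) \<le> ennreal C * pint r f" using pint_mx[OF r] by blast
  obtain C' where C': "C' > 0" "\<And>f :: real^'n \<Rightarrow> real. f \<in> borel_measurable lebesgue \<Longrightarrow> periodic f \<Longrightarrow>
    pint pA (mx f) \<le> ennreal C' * pint pA f" using pint_mx[OF pA(1)] by blast
  define c where "c = C0 powr r * C"
  have c: "0 < c" using C0 C by (simp add: c_def)
  have H: "pint r (hajlasz u) \<le> ennreal (c * energy u powr r)" if u: "u \<in> W1 r" for u
  proof -
    have "pint r (hajlasz u) = ennreal (\<bar>C0\<bar> powr r) * pint r (mx (grad_norm u))"
      unfolding hajlasz_def by (intro pint_cmult mx_measurable grad_norm u)
    also have "\<dots> \<le> ennreal (\<bar>C0\<bar> powr r) * (ennreal C * pint r (grad_norm u))"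
      by (intro mult_left_mono C(2) grad_norm u) simp
    also have "\<dots> = ennreal (c * energy u powr r)"
      using C(1) C0 energy[OF u] by (simp add: ennreal_mult[symmetric] c_def mult.assoc)
    finally show ?thesis .
  qed
  define kA where "kA = 2 * c powr (1 / r) + C1 * (C' * c) powr (1 / pA)"
  define kB where "kB = C1 * c powr (1 / pB)"
  have kA: "0 < kA" unfolding kA_def using c C1 by (simp add: add_pos_nonneg)
  have kB: "0 < kB" unfolding kB_def using c C1 by simp
  have A: "Lp_norm 1 (gA u) \<le> ennreal (kA * energy u)" if u: "u \<in> W1 r" for u
  proof -
    let ?N = "mx (\<lambda>z. hajlasz u z powr (1 + \<kappa>))" and ?e = "energy u"
    have [measurable]: "hajlasz u \<in> borel_measurable lebesgue" "?N \<in> borel_measurable lebesgue"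
      by (intro hajlasz mx_measurable hajlasz_power u)+
    have "Lp_norm 1 (gA u) = Lp_norm 1 (\<lambda>x. ennreal (fA u x))" by (rule Lp_norm_cong_AE[OF gA(3)[OF u]])
    also have "\<dots> = (\<integral>\<^sup>+x. ennreal 2 * (ennreal (hajlasz u x) * indicator unit_cube x) + ennreal (C1 * ?e powr (- \<kappa>)) * (ennreal (?N x) * indicator unit_cube x) \<partial>lebesgue)"
      unfolding Lp_norm_1 ennreal_fA[OF u]
    proof (intro nn_integral_cong)
      fix x
      have "ennreal (2 * hajlasz u x) = ennreal 2 * ennreal (hajlasz u x)"
        by (rule ennreal_mult) (simp_all add: hajlasz(3)[OF u])
      then show "(ennreal (2 * hajlasz u x) + ennreal (C1 * ?e powr (- \<kappa>)) * ennreal (?N x)) * indicator unit_cube x =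
          ennreal 2 * (ennreal (hajlasz u x) * indicator unit_cube x) + ennreal (C1 * ?e powr (- \<kappa>)) * (ennreal (?N x) * indicator unit_cube x)"
        by (simp only: distrib_right mult.assoc)
    qed
    also have "\<dots> = ennreal 2 * Lp_norm 1 (\<lambda>x. ennreal (hajlasz u x)) + ennreal (C1 * ?e powr (- \<kappa>)) * Lp_norm 1 (\<lambda>x. ennreal (?N x))"
      unfolding Lp_norm_1 by (subst nn_integral_add, simp, simp, subst nn_integral_cmult, simp, subst nn_integral_cmult) auto
    also have "\<dots> \<le> ennreal 2 * Lp_norm r (\<lambda>x. ennreal (hajlasz u x)) + ennreal (C1 * ?e powr (- \<kappa>)) * Lp_norm pA (\<lambda>x. ennreal (?N x))"
      using r pA(1) by (intro add_mono mult_left_mono Lp_norm_mono_exponent) auto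
    also have "\<dots> \<le> ennreal 2 * ennreal (c powr (1 / r) * ?e) + ennreal (C1 * ?e powr (- \<kappa>)) * ennreal ((C' * c) powr (1 / pA) * ?e powr (1 + \<kappa>))"
    proof (intro add_mono mult_left_mono)
      have "Lp_norm r (\<lambda>x. ennreal (hajlasz u x)) = enn_powr (pint r (hajlasz u)) (1 / r)"
        by (rule Lp_norm_real) (rule hajlasz(3)[OF u])
      also have "\<dots> \<le> ennreal ((c * ?e powr r) powr (1 / r))"
        using H[OF u] c r0 by (intro enn_powr_le_ennreal) auto
      also have "(c * ?e powr r) powr (1 / r) = c powr (1 / r) * ?e"
        using c r0 energy(2)[OF u] by (simp add: powr_mult powr_powr)
      finally show "Lp_norm r (\<lambda>x. ennreal (hajlasz u x)) \<le> ennreal (c powr (1 / r) * ?e)" .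
      have "Lp_norm pA (\<lambda>x. ennreal (?N x)) = enn_powr (pint pA ?N) (1 / pA)"
        by (rule Lp_norm_real) (rule mx_nonneg)
      also have "\<dots> \<le> ennreal ((C' * (c * ?e powr r)) powr (1 / pA))"
      proof (rule enn_powr_le_ennreal)
        have "pint pA ?N \<le> ennreal C' * pint pA (\<lambda>z. hajlasz u z powr (1 + \<kappa>))" by (intro C'(2) hajlasz_power u)
        also have "\<dots> \<le> ennreal C' * ennreal (c * ?e powr r)"
          unfolding pint_hajlasz_power[OF u] by (intro mult_left_mono H u) simp
        also have "\<dots> = ennreal (C' * (c * ?e powr r))" using C'(1) c by (simp add: ennreal_mult)
        finally show "pint pA ?N \<le> \<dots>" .
      qed (use C' c pA in auto)
      also have "(C' * (c * ?e powr r)) powr (1 / pA) = (C' * c) powr (1 / pA) * (?e powr r) powr (1 / pA)"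
        using C'(1) c by (simp add: powr_mult)
      also have "(?e powr r) powr (1 / pA) = ?e powr (1 + \<kappa>)"
        unfolding powr_powr using r0 \<kappa> by (simp add: pA_def)
      finally show "Lp_norm pA (\<lambda>x. ennreal (?N x)) \<le> ennreal ((C' * c) powr (1 / pA) * ?e powr (1 + \<kappa>))" .
    qed auto
    also have "\<dots> = ennreal (2 * (c powr (1 / r) * ?e) + C1 * ?e powr (- \<kappa>) * ((C' * c) powr (1 / pA) * ?e powr (1 + \<kappa>)))"
      using C1 energy(2)[OF u] by (simp add: ennreal_mult[symmetric] ennreal_plus[symmetric] del: ennreal_plus ennreal_numeral)
    also have "2 * (c powr (1 / r) * ?e) + C1 * ?e powr (- \<kappa>) * ((C' * c) powr (1 / pA) * ?e powr (1 + \<kappa>)) = kA * ?e"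
    \<comment> \<open>The law of exponents requires a positive base; at 0 both sides vanish because
      \<open>0 powr s = 0\<close> for every \<open>s\<close>.\<close>
    proof (cases "?e = 0")
      case False
      then have e: "0 < ?e" using energy(2)[OF u] by simp
      have "?e powr (- \<kappa>) * ?e powr (1 + \<kappa>) = ?e" using e by (simp add: powr_add[symmetric])
      then have "C1 * ?e powr (- \<kappa>) * ((C' * c) powr (1 / pA) * ?e powr (1 + \<kappa>)) = C1 * (C' * c) powr (1 / pA) * ?e"
        by (simp add: mult_ac)
      then show ?thesis by (simp add: kA_def distrib_right)
    qed simp
    finally show ?thesis .
  qed
  have B: "Lp_norm pB (gB u) \<le> ennreal (kB * energy u)" if u: "u \<in> W1 r" for u
  proof -
    let ?e = "energy u"
    have "Lp_norm pB (gB u) = Lp_norm pB (\<lambda>x. ennreal (fB u x))" by (rule Lp_norm_cong_AE[OF gB(3)[OF u]])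
    also have "\<dots> = enn_powr (pint pB (fB u)) (1 / pB)" by (rule Lp_norm_real) (rule fB(3)[OF u])
    also have "\<dots> \<le> ennreal ((\<bar>C1 * ?e powr \<gamma>\<bar> powr pB * (c * ?e powr r)) powr (1 / pB))"
    proof (rule enn_powr_le_ennreal)
      have "pint pB (fB u) = ennreal (\<bar>C1 * ?e powr \<gamma>\<bar> powr pB) * pint pB (\<lambda>y. hajlasz u y powr (1 - \<gamma>))"
        unfolding fB_def by (intro pint_cmult hajlasz_power u)
      also have "\<dots> \<le> ennreal (\<bar>C1 * ?e powr \<gamma>\<bar> powr pB) * ennreal (c * ?e powr r)"
        unfolding pint_hajlasz_power[OF u] by (intro mult_left_mono H u) simp
      also have "\<dots> = ennreal (\<bar>C1 * ?e powr \<gamma>\<bar> powr pB * (c * ?e powr r))" using c by (simp add: ennreal_mult)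
      finally show "pint pB (fB u) \<le> \<dots>" .
    qed (use c pB in auto)
    also have "(\<bar>C1 * ?e powr \<gamma>\<bar> powr pB * (c * ?e powr r)) powr (1 / pB) = (C1 * ?e powr \<gamma>) * (c powr (1 / pB) * ?e powr (1 - \<gamma>))"
    proof -
      have "(\<bar>C1 * ?e powr \<gamma>\<bar> powr pB * (c * ?e powr r)) powr (1 / pB) = (\<bar>C1 * ?e powr \<gamma>\<bar> powr pB) powr (1 / pB) * (c powr (1 / pB) * (?e powr r) powr (1 / pB))"
        using c by (simp add: powr_mult)
      also have "(\<bar>C1 * ?e powr \<gamma>\<bar> powr pB) powr (1 / pB) = C1 * ?e powr \<gamma>"
        using C1 pB(2) by (simp add: powr_powr)
      also have "(?e powr r) powr (1 / pB) = ?e powr (1 - \<gamma>)"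
        unfolding powr_powr using r0 \<gamma> by (simp add: pB_def)
      finally show ?thesis .
    qed
    also have "(C1 * ?e powr \<gamma>) * (c powr (1 / pB) * ?e powr (1 - \<gamma>)) = kB * ?e"
    proof (cases "?e = 0")
      case False
      then have e: "0 < ?e" using energy(2)[OF u] by simp
      have "?e powr \<gamma> * ?e powr (1 - \<gamma>) = ?e" using e by (simp add: powr_add[symmetric])
      then show ?thesis by (simp add: kB_def mult_ac)
    qed (use \<gamma> in simp)
    finally show ?thesis .
  qed
  show thesis
  proof (rule that[of "kA + kB"])
    fix u :: "real^'n \<Rightarrow> real" assume u: "u \<in> W1 r"
    have "kA * energy u \<le> (kA + kB) * energy u" "kB * energy u \<le> (kA + kB) * energy u"
      using kA kB energy(2)[OF u] by (auto intro!: mult_right_mono)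
    then show "Lp_norm 1 (gA u) \<le> ennreal ((kA + kB) * energy u)" "Lp_norm pB (gB u) \<le> ennreal ((kA + kB) * energy u)"
      using A[OF u] B[OF u] by (auto intro: order_trans ennreal_leI)
  qed (use kA kB in simp)
qed

text \<open>At \<open>energy u = 0\<close> the factor \<open>energy u powr (- \<kappa>)\<close> is singular,
  and the bound on \<open>gA\<close> is used instead.\<close>

lemma sequential_continuity:
  fixes u :: "real^'n \<Rightarrow> real" and v :: "nat \<Rightarrow> real^'n \<Rightarrow> real"
  assumes u: "u \<in> W1 r" and v: "\<And>n. v n \<in> W1 r" and lim: "(\<lambda>n. W1_norm r (\<lambda>x. v n x - u x)) \<longlonglongrightarrow> 0"
  shows "(\<lambda>n. Lp_dist 1 (gA (v n)) (gA u)) \<longlonglongrightarrow> 0" "(\<lambda>n. Lp_dist pB (gB (v n)) (gB u)) \<longlonglongrightarrow> 0"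
proof -
  have r0: "0 < r" using r by simp
  note [measurable] = grad_norm(1)[OF u] grad_norm(1)[OF v] hajlasz(1)[OF u] hajlasz(1)[OF v] fA(1)[OF u] fA(1)[OF v]
    fB(1)[OF u] fB(1)[OF v]
  have grad: "(\<lambda>n. pint r (\<lambda>x. grad_norm (v n) x - grad_norm u x)) \<longlonglongrightarrow> 0"
  proof (rule tendsto_0_le_ennreal[OF tendsto_enn_powr_zero[OF lim r0]])
    fix n
    let ?w = "weak_gradient (\<lambda>x. v n x - u x)"
    have "pint r (\<lambda>x. grad_norm (v n) x - grad_norm u x) \<le> pint r (\<lambda>x. norm (?w x))"
    proof (rule pint_mono_AE)
      show "AE x in lebesgue. \<bar>grad_norm (v n) x - grad_norm u x\<bar> \<le> \<bar>norm (?w x)\<bar>"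
        using W1_weak_gradient_diff[OF u v r0, of n]
        by eventually_elim (simp add: grad_norm_def norm_triangle_ineq3)
    qed (use r in simp)
    also have "\<dots> = enn_powr (abs_Lp_norm r ?w) r" by (rule pint_eq_abs_Lp_norm[OF r0])
    also have "\<dots> \<le> enn_powr (W1_norm r (\<lambda>x. v n x - u x)) r"
      using r0 by (intro enn_powr_mono) (auto simp: W1_norm_def)
    finally show "pint r (\<lambda>x. grad_norm (v n) x - grad_norm u x) \<le> \<dots>" .
  qed
  have haj: "(\<lambda>n. pint r (\<lambda>x. hajlasz (v n) x - hajlasz u x)) \<longlonglongrightarrow> 0"
  proof -
    have "(\<lambda>n. pint r (\<lambda>x. mx (grad_norm (v n)) x - mx (grad_norm u) x)) \<longlonglongrightarrow> 0"
      using r by (intro tendsto_pint_mx grad grad_norm u v)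
    moreover have "pint r (mx (grad_norm u)) < \<infinity>" by (rule pint_mx_finite[OF r grad_norm[OF u]])
    ultimately show ?thesis unfolding hajlasz_def
      by (intro tendsto_pint_mult tendsto_const r0 mx_measurable grad_norm u v)
  qed
  have en: "(\<lambda>n. energy (v n)) \<longlonglongrightarrow> energy u"
  proof -
    let ?d = "\<lambda>n. pint 1 (\<lambda>x. grad_norm (v n) x powr r - grad_norm u x powr r)"
    have gn: "0 \<le> grad_norm w x" for w x by (simp add: grad_norm_def)
    have d: "?d \<longlonglongrightarrow> 0"
      by (rule tendsto_pint_powr) (use grad grad_norm(1,3)[OF u] grad_norm(1)[OF v] r0 gn in auto)
    have p1: "pint r (grad_norm w) = pint 1 (\<lambda>x. grad_norm w x powr r)" for w
      by (subst pint_powr) (auto simp: grad_norm_def)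
    \<comment> \<open>The energies converge because the r-th powers of the gradients converge in
      L^1. There the triangle inequality holds with constant 1, whereas the factor in
      \<open>pint_add_le\<close> would spoil the comparison of limits.\<close>
    have add1: "pint 1 f \<le> pint 1 g + pint 1 h"
      if [measurable]: "g \<in> borel_measurable lebesgue" "h \<in> borel_measurable lebesgue" and le: "\<And>x. \<bar>f x\<bar> \<le> \<bar>g x\<bar> + \<bar>h x\<bar>"
      for f g h :: "real^'n \<Rightarrow> real"
    proof -
      have "pint 1 f \<le> (\<integral>\<^sup>+x. ennreal \<bar>g x\<bar> * indicator unit_cube x + ennreal \<bar>h x\<bar> * indicator unit_cube x \<partial>lebesgue)"
        unfolding pint_def using le by (intro nn_integral_mono) (auto simp: indicator_def simp flip: ennreal_plus intro!: ennreal_leI)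
      also have "\<dots> = pint 1 g + pint 1 h" unfolding pint_def by (subst nn_integral_add) auto
      finally show ?thesis .
    qed
    have up: "ennreal (energy (v n) powr r) \<le> ennreal (energy u powr r) + ?d n" for n
      unfolding energy(3)[OF u, symmetric] energy(3)[OF v, symmetric] p1 by (rule add1) auto
    have lo: "ennreal (energy u powr r) \<le> ennreal (energy (v n) powr r) + ?d n" for n
      unfolding energy(3)[OF u, symmetric] energy(3)[OF v, symmetric] p1 by (rule add1) auto
    have pw: "(\<lambda>n. energy (v n) powr r) \<longlonglongrightarrow> energy u powr r"
    proof (rule LIMSEQ_I)
      fix e :: real assume e: "0 < e"
      then have "\<forall>\<^sub>F n in sequentially. ?d n < ennreal e" using d by (intro order_tendstoD) auto
      then obtain N where N: "\<And>n. n \<ge> N \<Longrightarrow> ?d n < ennreal e" by (auto simp: eventually_sequentially)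
      have "norm (energy (v n) powr r - energy u powr r) < e" if n: "n \<ge> N" for n
      proof -
        obtain t where t: "?d n = ennreal t" "0 \<le> t" "t < e"
          using N[OF n] e by (cases "?d n") (auto simp: ennreal_less_iff)
        have "energy (v n) powr r \<le> energy u powr r + t"
          using up[of n] t by (simp add: ennreal_plus[symmetric] del: ennreal_plus)
        moreover have "energy u powr r \<le> energy (v n) powr r + t"
          using lo[of n] t by (simp add: ennreal_plus[symmetric] del: ennreal_plus)
        ultimately show ?thesis using t(3) by (simp add: abs_less_iff)
      qed
      then show "\<exists>N. \<forall>n\<ge>N. norm (energy (v n) powr r - energy u powr r) < e" by blast
    qed
    have "(\<lambda>n. (energy (v n) powr r) powr (1 / r)) \<longlonglongrightarrow> (energy u powr r) powr (1 / r)"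
      by (rule tendsto_powr'[OF pw tendsto_const]) (use r0 in simp)
    then show ?thesis using energy(2)[OF u] energy(2)[OF v] r0 by (simp add: powr_powr)
  qed
  have dist_eq: "Lp_dist p F G = enn_powr (pint p (\<lambda>x. f x - g x)) (1 / p)"
    if "AE x in lebesgue. F x = ennreal (f x)" "AE x in lebesgue. G x = ennreal (g x)" "\<And>x. 0 \<le> f x" "\<And>x. 0 \<le> g x"
    for p F G and f g :: "real^'n \<Rightarrow> real"
  proof -
    have "Lp_dist p F G = abs_Lp_norm p (\<lambda>x. f x - g x)" unfolding Lp_dist_def
      by (rule Lp_norm_cong_AE, use that(1,2) in eventually_elim) (simp add: that(3,4))
    then show ?thesis using abs_Lp_norm_pint[of p "\<lambda>x. f x - g x"] by (simp add: pint_def)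
  qed
  show "(\<lambda>n. Lp_dist pB (gB (v n)) (gB u)) \<longlonglongrightarrow> 0"
  proof -
    have "(\<lambda>n. pint pB (\<lambda>x. hajlasz (v n) x powr (1 - \<gamma>) - hajlasz u x powr (1 - \<gamma>))) \<longlonglongrightarrow> 0"
      by (rule tendsto_pint_powr) (use \<gamma> pB haj pint_hajlasz_finite[OF u] hajlasz(3)[OF u] hajlasz(3)[OF v] in auto)
    moreover have "(\<lambda>n. C1 * energy (v n) powr \<gamma>) \<longlonglongrightarrow> C1 * energy u powr \<gamma>"
      using \<gamma> energy(2)[OF v] by (intro tendsto_intros tendsto_powr' en) auto
    ultimately have "(\<lambda>n. pint pB (\<lambda>x. fB (v n) x - fB u x)) \<longlonglongrightarrow> 0"
      unfolding fB_def
      by (intro tendsto_pint_mult hajlasz_power u v pB) (simp_all only: pint_hajlasz_power[OF u] pint_hajlasz_finite[OF u])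
    from tendsto_enn_powr_zero[OF this, of "1 / pB"] show ?thesis
      using pB(2) by (simp add: dist_eq[OF gB(3)[OF v] gB(3)[OF u] fB(3)[OF v] fB(3)[OF u]])
  qed
  show "(\<lambda>n. Lp_dist 1 (gA (v n)) (gA u)) \<longlonglongrightarrow> 0"
  proof (cases "energy u = 0")
    case True
    obtain K where K: "K > 0" "\<And>u. u \<in> W1 r \<Longrightarrow> Lp_norm 1 (gA u) \<le> ennreal (K * energy u)"
      by (rule bounds) blast
    have f0: "fA u x = 0" for x
    proof -
      have "maxf (\<lambda>z. hajlasz u z powr (1 + \<kappa>)) x \<le> 0"
        using maxf_bounded[of "\<lambda>z. hajlasz u z powr (1 + \<kappa>)" 0 x] by (simp add: hajlasz_energy_0[OF u True])
      then show ?thesis by (simp add: fA_def hajlasz_energy_0[OF u True] mx_def)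
    qed
    have "(\<lambda>n. K * energy (v n)) \<longlonglongrightarrow> K * energy u" by (intro tendsto_intros en)
    from tendsto_ennrealI[OF this] have "(\<lambda>n. ennreal (K * energy (v n))) \<longlonglongrightarrow> 0" using True by simp
    then show ?thesis
    proof (rule tendsto_0_le_ennreal)
      fix n
      have "Lp_dist 1 (gA (v n)) (gA u) = enn_powr (pint 1 (fA (v n))) (1 / 1)"
        unfolding dist_eq[OF gA(3)[OF v] gA(3)[OF u] fA(3)[OF v] fA(3)[OF u]] by (simp add: f0)
      also have "\<dots> = Lp_norm 1 (\<lambda>x. ennreal (fA (v n) x))" by (rule Lp_norm_real[symmetric]) (rule fA(3)[OF v])
      also have "\<dots> = Lp_norm 1 (gA (v n))" by (rule Lp_norm_cong_AE) (use gA(3)[OF v, of n] in eventually_elim, simp)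
      also have "\<dots> \<le> ennreal (K * energy (v n))" by (rule K(2)[OF v])
      finally show "Lp_dist 1 (gA (v n)) (gA u) \<le> \<dots>" .
    qed
  next
    case False
    let ?N = "\<lambda>u. mx (\<lambda>z. hajlasz u z powr (1 + \<kappa>))"
    have [measurable]: "?N u \<in> borel_measurable lebesgue" "?N (v n) \<in> borel_measurable lebesgue" for n
      by (intro mx_measurable hajlasz_power u v)+
    have "(\<lambda>n. pint pA (\<lambda>x. hajlasz (v n) x powr (1 + \<kappa>) - hajlasz u x powr (1 + \<kappa>))) \<longlonglongrightarrow> 0"
      by (rule tendsto_pint_powr) (use \<kappa> pA haj pint_hajlasz_finite[OF u] hajlasz(3)[OF u] hajlasz(3)[OF v] in auto)
    then have N: "(\<lambda>n. pint pA (\<lambda>x. ?N (v n) x - ?N u x)) \<longlonglongrightarrow> 0"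
      by (intro tendsto_pint_mx hajlasz_power u v pA)
         (simp_all only: pint_hajlasz_power[OF u] pint_hajlasz_power[OF v] pint_hajlasz_finite[OF u] pint_hajlasz_finite[OF v])
    have Nfin: "pint pA (?N u) < \<infinity>"
      by (rule pint_mx_finite[OF pA(1) hajlasz_power[OF u]]) (simp only: pint_hajlasz_power[OF u] pint_hajlasz_finite[OF u])
    let ?c = "\<lambda>u. C1 * energy u powr (- \<kappa>)"
    have c: "(\<lambda>n. ?c (v n)) \<longlonglongrightarrow> ?c u" using False by (intro tendsto_intros en) auto
    have "(\<lambda>n. pint pA (\<lambda>x. ?c (v n) * ?N (v n) x - ?c u * ?N u x)) \<longlonglongrightarrow> 0"
      using pA(1) by (intro tendsto_pint_mult N Nfin c) auto
    from tendsto_enn_powr_zero[OF this, of "1 / pA"]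
    have t1: "(\<lambda>n. abs_Lp_norm pA (\<lambda>x. ?c (v n) * ?N (v n) x - ?c u * ?N u x)) \<longlonglongrightarrow> 0"
      using pA(1) unfolding abs_Lp_norm_pint by (simp add: pint_def)
    have "(\<lambda>n. pint r (\<lambda>x. 2 * hajlasz (v n) x - 2 * hajlasz u x)) \<longlonglongrightarrow> 0"
      by (intro tendsto_pint_mult haj pint_hajlasz_finite u r0 tendsto_const) auto
    from tendsto_enn_powr_zero[OF this, of "1 / r"]
    have t2: "(\<lambda>n. abs_Lp_norm r (\<lambda>x. 2 * hajlasz (v n) x - 2 * hajlasz u x)) \<longlonglongrightarrow> 0"
      using r0 unfolding abs_Lp_norm_pint by (simp add: pint_def)
    have "(\<lambda>n. abs_Lp_norm r (\<lambda>x. 2 * hajlasz (v n) x - 2 * hajlasz u x) + abs_Lp_norm pA (\<lambda>x. ?c (v n) * ?N (v n) x - ?c u * ?N u x)) \<longlonglongrightarrow> 0 + 0"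
      by (intro tendsto_add t1 t2)
    then have t: "(\<lambda>n. abs_Lp_norm r (\<lambda>x. 2 * hajlasz (v n) x - 2 * hajlasz u x) + abs_Lp_norm pA (\<lambda>x. ?c (v n) * ?N (v n) x - ?c u * ?N u x)) \<longlonglongrightarrow> 0"
      by simp
    show ?thesis
    proof (rule tendsto_0_le_ennreal[OF t])
      fix n
      let ?a = "\<lambda>x. 2 * hajlasz (v n) x - 2 * hajlasz u x" and ?b = "\<lambda>x. ?c (v n) * ?N (v n) x - ?c u * ?N u x"
      have "Lp_dist 1 (gA (v n)) (gA u) = pint 1 (\<lambda>x. fA (v n) x - fA u x)"
        unfolding dist_eq[OF gA(3)[OF v] gA(3)[OF u] fA(3)[OF v] fA(3)[OF u]] by (simp add: enn_powr_1)
      also have "\<dots> \<le> (\<integral>\<^sup>+x. ennreal (norm (?a x)) * indicator unit_cube x + ennreal (norm (?b x)) * indicator unit_cube x \<partial>lebesgue)"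
        unfolding pint_def
      proof (intro nn_integral_mono)
        fix x
        have "\<bar>fA (v n) x - fA u x\<bar> \<le> norm (?a x) + norm (?b x)"
          using abs_triangle_ineq[of "?a x" "?b x"] by (simp add: fA_def algebra_simps)
        then show "ennreal (\<bar>fA (v n) x - fA u x\<bar> powr 1) * indicator unit_cube x \<le> ennreal (norm (?a x)) * indicator unit_cube x + ennreal (norm (?b x)) * indicator unit_cube x"
          by (auto simp: indicator_def simp flip: ennreal_plus intro!: ennreal_leI)
      qed
      also have "\<dots> = abs_Lp_norm 1 ?a + abs_Lp_norm 1 ?b"
        unfolding Lp_norm_1 by (rule nn_integral_add) measurable
      also have "\<dots> \<le> abs_Lp_norm r ?a + abs_Lp_norm pA ?b"
        using r pA(1) by (intro add_mono Lp_norm_mono_exponent) auto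
      finally show "Lp_dist 1 (gA (v n)) (gA u) \<le> \<dots>" .
    qed
  qed
qed

text \<open>Were continuity to fail, functions at distance below \<open>1 / real (Suc n)\<close>
  would violate the sequential statement. The latter concerns the exponent \<open>pB\<close>, whose
  distance dominates the one for \<open>q\<close>.\<close>

lemma continuity:
  assumes q: "0 < q" "q \<le> pB" shows "continuous_pair r q gA gB"
  unfolding continuous_pair_def
proof (intro ballI allI impI)
  fix u :: "real^'n \<Rightarrow> real" and \<epsilon> :: ennreal assume u: "u \<in> W1 r" and \<epsilon>: "0 < \<epsilon>"
  show "\<exists>\<delta>>0. \<forall>v\<in>W1 r. W1_norm r (\<lambda>x. v x - u x) < \<delta> \<longrightarrow> Lp_dist 1 (gA v) (gA u) < \<epsilon> \<and> Lp_dist q (gB v) (gB u) < \<epsilon>"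
  proof (rule ccontr)
    assume neg: "\<not> ?thesis"
    have "\<forall>n. \<exists>v. v \<in> W1 r \<and> W1_norm r (\<lambda>x. v x - u x) < ennreal (1 / real (Suc n)) \<and>
       \<not> (Lp_dist 1 (gA v) (gA u) < \<epsilon> \<and> Lp_dist q (gB v) (gB u) < \<epsilon>)"
    proof
      fix n
      have "0 < ennreal (1 / real (Suc n))" by simp
      then show "\<exists>v. v \<in> W1 r \<and> W1_norm r (\<lambda>x. v x - u x) < ennreal (1 / real (Suc n)) \<and>
       \<not> (Lp_dist 1 (gA v) (gA u) < \<epsilon> \<and> Lp_dist q (gB v) (gB u) < \<epsilon>)" using neg by blast
    qed
    from choice[OF this] obtain v where v: "\<forall>n. v n \<in> W1 r \<and> W1_norm r (\<lambda>x. v n x - u x) < ennreal (1 / real (Suc n)) \<and>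
       \<not> (Lp_dist 1 (gA (v n)) (gA u) < \<epsilon> \<and> Lp_dist q (gB (v n)) (gB u) < \<epsilon>)" ..
    then have vW: "v n \<in> W1 r" for n by blast
    have "(\<lambda>n. W1_norm r (\<lambda>x. v n x - u x)) \<longlonglongrightarrow> 0"
    proof (rule tendsto_0_le_ennreal)
      have "(\<lambda>n. 1 / real (Suc n)) \<longlonglongrightarrow> 0" using LIMSEQ_Suc[OF lim_1_over_n] by simp
      from tendsto_ennrealI[OF this] show "(\<lambda>n. ennreal (1 / real (Suc n))) \<longlonglongrightarrow> 0" by simp
      show "W1_norm r (\<lambda>x. v n x - u x) \<le> ennreal (1 / real (Suc n))" for n using v by (blast intro: less_imp_le)
    qed
    note s = sequential_continuity[OF u vW this]
    have "\<forall>\<^sub>F n in sequentially. Lp_dist 1 (gA (v n)) (gA u) < \<epsilon> \<and> Lp_dist pB (gB (v n)) (gB u) < \<epsilon>"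
      using s \<epsilon> by (intro eventually_conj order_tendstoD(2)[of _ 0])
    then obtain n where n: "Lp_dist 1 (gA (v n)) (gA u) < \<epsilon>" "Lp_dist pB (gB (v n)) (gB u) < \<epsilon>"
      by (auto simp: eventually_sequentially)
    have "Lp_dist q (gB (v n)) (gB u) \<le> Lp_dist pB (gB (v n)) (gB u)"
      by (intro Lp_dist_mono_exponent gB u vW q)
    with n v show False by (meson le_less_trans)
  qed
qed

end

theorem corollary9p1:
  fixes r q :: real
  defines "d \<equiv> real CARD('n::finite)"
  assumes "1 < r" and "r \<le> d"
    and "r \<le> q" and "r < d \<Longrightarrow> q < r * ((d - 1) / (d - r))"
  shows "\<exists>C::real. C > 0 \<and>
    (\<forall>u \<in> (W1 r :: (real^'n \<Rightarrow> real) set).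
       \<exists>N a b. N \<in> null_sets lebesgue \<and> periodic (\<lambda>x. x \<in> N) \<and>
         a \<in> Lp_nonneg 1 \<and> b \<in> Lp_nonneg q \<and>
         Lp_norm 1 a \<le> ennreal C * abs_Lp_norm r (weak_gradient u) \<and>
         Lp_norm q b \<le> ennreal C * abs_Lp_norm r (weak_gradient u) \<and>
         (\<forall>x y. x \<notin> N \<longrightarrow> y \<notin> N \<longrightarrow>
            ennreal \<bar>u x - u y\<bar> \<le> ennreal (norm (x - y)) * (a x + b y))) \<and>
    (\<exists>(A :: (real^'n \<Rightarrow> real) \<Rightarrow> real^'n \<Rightarrow> ennreal) B.
       (\<forall>u \<in> W1 r.
          A u \<in> Lp_nonneg 1 \<and> B u \<in> Lp_nonneg q \<and>
          Lp_norm 1 (A u) \<le> ennreal C * abs_Lp_norm r (weak_gradient u) \<and>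
          Lp_norm q (B u) \<le> ennreal C * abs_Lp_norm r (weak_gradient u) \<and>
          (\<exists>u' \<in> W1 r. (AE x in lebesgue. u' x = u x) \<and>
             (\<forall>x y. ennreal \<bar>u' x - u' y\<bar> \<le> ennreal (norm (x - y)) * (A u x + B u y)))) \<and>
       continuous_pair r q A B)"
proof -
  have r: "1 < r" and d: "1 < d" and q: "0 < q" using assms by auto
  \<comment> \<open>The bound for \<gamma>: below 1, and small enough for some \<kappa> to fit
    between \<open>\<gamma> * (d - 1)\<close> and \<open>r - 1\<close>.\<close>
  define g where "g = min 1 ((r - 1) / (d - 1))"
  have "1 - r / q < g"
  proof -
    have "1 - r / q < 1" using r q by simp
    moreover have "1 - r / q < (r - 1) / (d - 1)"
    proof (cases "r = d")
      case False
      then have "r < d" using assms(3) by simp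
      then have "q * (d - r) < r * (d - 1)" using assms(5) by (simp add: field_simps)
      then have "(d - r) / (d - 1) < r / q" using q d by (simp add: field_simps)
      moreover have "1 - (r - 1) / (d - 1) = (d - r) / (d - 1)" using d by (simp add: field_simps)
      ultimately show ?thesis by linarith
    qed (use r q in simp)
    ultimately show ?thesis by (simp add: g_def)
  qed
  moreover have "0 \<le> 1 - r / q" using assms(4) q by simp
  \<comment> \<open>Taking \<gamma> above \<open>1 - r / q\<close> makes the exponent
    \<open>r / (1 - \<gamma>)\<close> at least \<open>q\<close>. Positivity is inherited from
    \<open>r \<le> q\<close>.\<close>
  ultimately obtain \<gamma> where \<gamma>: "1 - r / q < \<gamma>" "\<gamma> < g" "0 < \<gamma>" using dense[of "1 - r / q" g] by auto
  then have \<gamma>1: "\<gamma> < 1" "\<gamma> * (d - 1) < r - 1" using d by (auto simp: g_def field_simps)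
  obtain \<kappa> where \<kappa>: "\<gamma> * (d - 1) < \<kappa>" "\<kappa> < r - 1" using dense[OF \<gamma>1(2)] by blast
  have "0 \<le> \<gamma> * (d - 1)" using \<gamma>(3) d by simp
  then have \<kappa>0: "0 < \<kappa>" using \<kappa>(1) by linarith
  obtain C0 where C0: "C0 > 0" "\<And>(u :: real^'n \<Rightarrow> real) g. has_weak_gradient u g \<Longrightarrow> gradient_estimate C0 u g"
    by (rule sobolev_pointwise) blast
  obtain C1 where C1: "C1 > 0" "\<And>(u :: real^'n \<Rightarrow> real) H S \<mu> x y. hajlasz_gradient S u H \<Longrightarrow> 0 < \<mu> \<Longrightarrow>
      x \<in> S \<Longrightarrow> y \<in> S \<Longrightarrow> 2 * norm (x - y) < real CARD('n) + 1 \<Longrightarrow> asymmetric_bound C1 \<gamma> \<kappa> \<mu> u H x y"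
    by (rule asymmetric_estimate[OF \<gamma>(3) \<gamma>1(1) \<kappa>0 \<kappa>(1)[unfolded d_def]]) blast
  interpret L: asymmetric_lusin_lipschitz C0 C1 r \<gamma> \<kappa> "TYPE('n)"
  proof
    show "1 + \<kappa> < r" using \<kappa>(2) by simp
  qed (fact r \<gamma>(3) \<gamma>1(1) \<kappa>0 C0 C1)+
  obtain K where K: "K > 0" "\<And>u. u \<in> W1 r \<Longrightarrow> Lp_norm 1 (L.gA u) \<le> ennreal (K * L.energy u)"
    "\<And>u. u \<in> W1 r \<Longrightarrow> Lp_norm L.pB (L.gB u) \<le> ennreal (K * L.energy u)"
    by (rule L.bounds) blast
  have qB: "q \<le> L.pB"
  proof -
    have "(1 - \<gamma>) * q \<le> r" using \<gamma>(1) q by (simp add: field_simps)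
    then show ?thesis unfolding L.pB_def using \<gamma>1(1) by (simp add: field_simps)
  qed
  have main: "L.gA u \<in> Lp_nonneg 1 \<and> L.gB u \<in> Lp_nonneg q \<and>
      Lp_norm 1 (L.gA u) \<le> ennreal K * abs_Lp_norm r (weak_gradient u) \<and>
      Lp_norm q (L.gB u) \<le> ennreal K * abs_Lp_norm r (weak_gradient u)" if u: "u \<in> W1 r" for u :: "real^'n \<Rightarrow> real"
  proof -
    have e: "ennreal (K * L.energy u) = ennreal K * abs_Lp_norm r (weak_gradient u)"
      using K(1) L.energy(1,2)[OF u] by (simp add: ennreal_mult)
    have "Lp_norm q (L.gB u) \<le> Lp_norm L.pB (L.gB u)" by (intro Lp_norm_mono_exponent L.gB u q qB)
    also have "\<dots> \<le> ennreal (K * L.energy u)" by (rule K(3)[OF u])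
    finally have b: "Lp_norm q (L.gB u) \<le> ennreal (K * L.energy u)" .
    have "Lp_norm 1 (L.gA u) < \<infinity>" "Lp_norm q (L.gB u) < \<infinity>"
      using K(2)[OF u] b by (auto intro: le_less_trans)
    then show ?thesis using K(2)[OF u] b L.gA(1,2)[OF u] L.gB(1,2)[OF u] by (simp add: Lp_nonneg_def e)
  qed
  show ?thesis
  proof (intro exI[of _ K] conjI ballI)
    fix u :: "real^'n \<Rightarrow> real" assume u: "u \<in> W1 r"
    show "\<exists>N a b. N \<in> null_sets lebesgue \<and> periodic (\<lambda>x. x \<in> N) \<and>
         a \<in> Lp_nonneg 1 \<and> b \<in> Lp_nonneg q \<and>
         Lp_norm 1 a \<le> ennreal K * abs_Lp_norm r (weak_gradient u) \<and>
         Lp_norm q b \<le> ennreal K * abs_Lp_norm r (weak_gradient u) \<and>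
         (\<forall>x y. x \<notin> N \<longrightarrow> y \<notin> N \<longrightarrow>
            ennreal \<bar>u x - u y\<bar> \<le> ennreal (norm (x - y)) * (a x + b y))"
      \<comment> \<open>The infinite values of \<open>gA\<close> and \<open>gB\<close> absorb the
        exceptional set, so the empty set serves as \<open>N\<close> and, in the second part,
        \<open>u\<close> is its own representative.\<close>
      by (rule exI[of _ "{}"], rule exI[of _ "L.gA u"], rule exI[of _ "L.gB u"])
         (use main[OF u] L.pointwise[OF u] in \<open>simp add: periodic_def\<close>)
  next
    show "\<exists>(A :: (real^'n \<Rightarrow> real) \<Rightarrow> real^'n \<Rightarrow> ennreal) B.
       (\<forall>u \<in> W1 r.
          A u \<in> Lp_nonneg 1 \<and> B u \<in> Lp_nonneg q \<and>
          Lp_norm 1 (A u) \<le> ennreal K * abs_Lp_norm r (weak_gradient u) \<and>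
          Lp_norm q (B u) \<le> ennreal K * abs_Lp_norm r (weak_gradient u) \<and>
          (\<exists>u' \<in> W1 r. (AE x in lebesgue. u' x = u x) \<and>
             (\<forall>x y. ennreal \<bar>u' x - u' y\<bar> \<le> ennreal (norm (x - y)) * (A u x + B u y)))) \<and>
       continuous_pair r q A B"
    proof (rule exI[of _ L.gA], rule exI[of _ L.gB], intro conjI ballI)
      fix u :: "real^'n \<Rightarrow> real" assume u: "u \<in> W1 r"
      show "\<exists>u' \<in> W1 r. (AE x in lebesgue. u' x = u x) \<and>
             (\<forall>x y. ennreal \<bar>u' x - u' y\<bar> \<le> ennreal (norm (x - y)) * (L.gA u x + L.gB u y))"
        by (rule bexI[OF _ u]) (use L.pointwise[OF u] in simp)
    qed (use main L.continuity[OF q qB] in blast)+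
  qed (rule K(1))
qed

end
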